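(* Let $\mathcal K$ be a field with $\mathrm{char}(\mathcal K)\neq2$ and let $\mathbf Q$ be a Dynkin quiver of type $\mathbf D_n$ (i.e. any orientation of the Dynkin diagram $\mathbf D_n$, $n\ge4$). Then every indecomposable finite-dimensional $\mathcal K\mathbf Q$-module is isomorphic to a generalised tree module over $\mathcal K\mathbf Q$.
   Context: A tree is a finite quiver $T=(T_0,T_1,s,t)$ whose underlying undirected graph is simply connected (a tree). For a quiver morphism $F:T\to \mathbf Q$, the generalised tree module $F_\lambda(V_T)$ is the $\mathcal K\mathbf Q$-module (equivalently, $\mathcal K$-representation of $\mathbf Q$) with $\mathcal K$-basis $\{v_n\mid n\in T_0\}$, where $v_n$ lies in the vector space at the vertex $F(n)$, and each arrow $\gamma\in\mathbf Q_1$ acts by $\gamma\cdot v_n=\sum_{a\in T_1,\ s(a)=n,\ F(a)=\gamma}v_{t(a)}$. A generalised tree module over $\mathcal K\mathbf Q$ is a module of this form for some tree $T$ and some quiver morphism $F:T\to\mathbf Q$ (there are no relations). The Dynkin diagram $\mathbf D_n$ has vertices $1,\dots,n$, with $i$ joined to $i+1$ for $1\le i\le n-3$, and $n-2$ joined to both $n-1$ and $n$. *)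

theory Defs
  imports
    "HOL-Library.Function_Algebras"
    "Graph_Theory.Digraph_Component"
begin

section \<open>Quivers\<close>

text \<open>
  Quivers are \<^typ>\<open>('v, 'e) pre_digraph\<close>s that satisfy \<^locale>\<open>wf_digraph\<close>; the source and target
  maps are \<^const>\<open>tail\<close> and \<^const>\<open>head\<close>.
\<close>

definition dynkin_D_edges :: "nat \<Rightarrow> nat set set" where
  "dynkin_D_edges n = {{i, i + 1} | i. 1 \<le> i \<and> i \<le> n - 3} \<union> {{n - 2, n - 1}, {n - 2, n}}"

definition dynkin_D_quiver :: "nat \<Rightarrow> (nat, 'e) pre_digraph \<Rightarrow> bool" where
  "dynkin_D_quiver n Q \<longleftrightarrow> wf_digraph Q \<and> verts Q = {1..n} \<and>
     bij_betw (\<lambda>a. {tail Q a, head Q a}) (arcs Q) (dynkin_D_edges n)"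

definition quiver_morphism ::
  "('v, 'e) pre_digraph \<Rightarrow> ('w, 'f) pre_digraph \<Rightarrow> ('v \<Rightarrow> 'w) \<Rightarrow> ('e \<Rightarrow> 'f) \<Rightarrow> bool" where
  "quiver_morphism T Q F\<^sub>0 F\<^sub>1 \<longleftrightarrow>
     (\<forall>n\<in>verts T. F\<^sub>0 n \<in> verts Q) \<and>
     (\<forall>a\<in>arcs T. F\<^sub>1 a \<in> arcs Q \<and> tail Q (F\<^sub>1 a) = F\<^sub>0 (tail T a) \<and> head Q (F\<^sub>1 a) = F\<^sub>0 (head T a))"


section \<open>Trees\<close>

text \<open>
  A step of a walk in the underlying undirected graph is an arrow together with the direction in
  which it is traversed (\<^const>\<open>True\<close>: from tail to head). A walk is reduced if it never traverses an
  arrow and immediately afterwards the same arrow backwards. In particular loops and pairs of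
  parallel or opposite arrows give nonempty closed reduced walks.
\<close>

definition step_from :: "('v, 'e) pre_digraph \<Rightarrow> 'e \<times> bool \<Rightarrow> 'v" where
  "step_from T s = (if snd s then tail T (fst s) else head T (fst s))"

definition step_to :: "('v, 'e) pre_digraph \<Rightarrow> 'e \<times> bool \<Rightarrow> 'v" where
  "step_to T s = (if snd s then head T (fst s) else tail T (fst s))"

fun undirected_walk :: "('v, 'e) pre_digraph \<Rightarrow> 'v \<Rightarrow> ('e \<times> bool) list \<Rightarrow> 'v \<Rightarrow> bool" where
  "undirected_walk T u [] v \<longleftrightarrow> u \<in> verts T \<and> u = v"
| "undirected_walk T u (s # p) v \<longleftrightarrow>
     fst s \<in> arcs T \<and> step_from T s = u \<and> undirected_walk T (step_to T s) p v"

definition reduced_walk :: "('e \<times> bool) list \<Rightarrow> bool" where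
  "reduced_walk p \<longleftrightarrow> successively (\<lambda>s t. \<not> (fst s = fst t \<and> snd s \<noteq> snd t)) p"

text \<open>
  The constant \<^const>\<open>connected\<close> of the graph library is nonemptiness and connectedness of the
  underlying undirected graph. Its \<^const>\<open>tree\<close> only excludes directed cycles, so it does not apply
  here.
\<close>

definition tree_quiver :: "('v, 'e) pre_digraph \<Rightarrow> bool" where
  "tree_quiver T \<longleftrightarrow> fin_digraph T \<and> connected T \<and>
     (\<forall>u p. undirected_walk T u p u \<and> reduced_walk p \<longrightarrow> p = [])"


section \<open>Representations\<close>

text \<open>
  The vector spaces of a representation are subspaces of one ambient vector space over \<open>'k\<close>, on
  which no further condition is imposed. This loses no generality, since a family of
  vector spaces embeds into its direct sum. The values \<open>rep_space M v\<close> for \<open>v \<notin> verts Q\<close>, those of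
  \<open>rep_map M a\<close> for \<open>a \<notin> arcs Q\<close> and those of \<open>rep_map M a\<close> outside \<open>rep_space M (tail Q a)\<close> are
  irrelevant.
\<close>

record ('v, 'e, 'k, 'b) quiver_rep =
  rep_scale :: "'k \<Rightarrow> 'b \<Rightarrow> 'b"
  rep_space :: "'v \<Rightarrow> 'b set"
  rep_map :: "'e \<Rightarrow> 'b \<Rightarrow> 'b"

definition linear_between ::
  "('k \<Rightarrow> 'b \<Rightarrow> 'b) \<Rightarrow> 'b set \<Rightarrow> ('k \<Rightarrow> 'c \<Rightarrow> 'c) \<Rightarrow> 'c set \<Rightarrow>
     ('b::ab_group_add \<Rightarrow> 'c::ab_group_add) \<Rightarrow> bool" where
  "linear_between s V s' W f \<longleftrightarrow>
     (\<forall>x\<in>V. f x \<in> W) \<and>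
     (\<forall>x\<in>V. \<forall>y\<in>V. f (x + y) = f x + f y) \<and>
     (\<forall>c. \<forall>x\<in>V. f (s c x) = s' c (f x))"

definition quiver_representation ::
  "('v, 'e) pre_digraph \<Rightarrow> ('v, 'e, 'k::field, 'b::ab_group_add) quiver_rep \<Rightarrow> bool" where
  "quiver_representation Q M \<longleftrightarrow>
     vector_space (rep_scale M) \<and>
     (\<forall>v\<in>verts Q. module.subspace (rep_scale M) (rep_space M v)) \<and>
     (\<forall>a\<in>arcs Q. linear_between (rep_scale M) (rep_space M (tail Q a))
                                 (rep_scale M) (rep_space M (head Q a)) (rep_map M a))"

definition finite_dimensional_rep ::
  "('v, 'e) pre_digraph \<Rightarrow> ('v, 'e, 'k::field, 'b::ab_group_add) quiver_rep \<Rightarrow> bool" where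
  "finite_dimensional_rep Q M \<longleftrightarrow>
     (\<forall>v\<in>verts Q. \<exists>B. finite B \<and> rep_space M v = module.span (rep_scale M) B)"

definition subrepresentation ::
  "('v, 'e) pre_digraph \<Rightarrow> ('v, 'e, 'k::field, 'b::ab_group_add) quiver_rep \<Rightarrow> ('v \<Rightarrow> 'b set) \<Rightarrow> bool" where
  "subrepresentation Q M U \<longleftrightarrow>
     (\<forall>v\<in>verts Q. module.subspace (rep_scale M) (U v) \<and> U v \<subseteq> rep_space M v) \<and>
     (\<forall>a\<in>arcs Q. rep_map M a ` U (tail Q a) \<subseteq> U (head Q a))"

definition indecomposable_rep ::
  "('v, 'e) pre_digraph \<Rightarrow> ('v, 'e, 'k::field, 'b::ab_group_add) quiver_rep \<Rightarrow> bool" where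
  "indecomposable_rep Q M \<longleftrightarrow>
     (\<exists>v\<in>verts Q. rep_space M v \<noteq> {0}) \<and>
     (\<forall>U W. subrepresentation Q M U \<and> subrepresentation Q M W \<and>
        (\<forall>v\<in>verts Q. U v \<inter> W v = {0} \<and> rep_space M v = {u + w | u w. u \<in> U v \<and> w \<in> W v}) \<longrightarrow>
        (\<forall>v\<in>verts Q. U v = {0}) \<or> (\<forall>v\<in>verts Q. W v = {0}))"

definition isomorphic_reps ::
  "('v, 'e) pre_digraph \<Rightarrow> ('v, 'e, 'k::field, 'b::ab_group_add) quiver_rep \<Rightarrow>
     ('v, 'e, 'k, 'c::ab_group_add) quiver_rep \<Rightarrow> bool" where
  "isomorphic_reps Q M N \<longleftrightarrow>
     (\<exists>h. (\<forall>v\<in>verts Q. linear_between (rep_scale M) (rep_space M v) (rep_scale N) (rep_space N v) (h v) \<and>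
              bij_betw (h v) (rep_space M v) (rep_space N v)) \<and>
          (\<forall>a\<in>arcs Q. \<forall>x\<in>rep_space M (tail Q a).
              h (head Q a) (rep_map M a x) = rep_map N a (h (tail Q a) x)))"


section \<open>Generalised tree modules\<close>

text \<open>
  The ambient space consists of the functions from the vertices of \<open>T\<close> to \<open>'k\<close>; the basis vector
  \<open>v\<^sub>n\<close> is the indicator function of \<open>n\<close>. The action of an arrow is the linear extension of its
  action on the \<open>v\<^sub>n\<close>.
\<close>

definition fun_scale :: "'k::field \<Rightarrow> ('v \<Rightarrow> 'k) \<Rightarrow> 'v \<Rightarrow> 'k" where
  "fun_scale c f = (\<lambda>n. c * f n)"

definition basis_vec :: "'v \<Rightarrow> 'v \<Rightarrow> 'k::field" where
  "basis_vec n = (\<lambda>m. if m = n then 1 else 0)"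

definition tree_rep ::
  "('v, 'e) pre_digraph \<Rightarrow> ('v \<Rightarrow> 'w) \<Rightarrow> ('e \<Rightarrow> 'f) \<Rightarrow> ('w, 'f, 'k::field, 'v \<Rightarrow> 'k) quiver_rep" where
  "tree_rep T F\<^sub>0 F\<^sub>1 =
     \<lparr> rep_scale = fun_scale,
       rep_space = (\<lambda>q. module.span fun_scale (basis_vec ` {n \<in> verts T. F\<^sub>0 n = q})),
       rep_map = (\<lambda>\<gamma> x. \<Sum>n\<in>verts T. fun_scale (x n)
                    (\<Sum>a | a \<in> arcs T \<and> tail T a = n \<and> F\<^sub>1 a = \<gamma>. basis_vec (head T a))) \<rparr>"

lemma vector_space_fun_scale: "vector_space (fun_scale :: 'k::field \<Rightarrow> ('v \<Rightarrow> 'k) \<Rightarrow> 'v \<Rightarrow> 'k)"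
  by unfold_locales (auto simp: fun_scale_def fun_eq_iff algebra_simps)

lemma rep_map_tree_rep_basis_vec:
  assumes "finite (verts T)" "n \<in> verts T"
  shows "rep_map (tree_rep T F\<^sub>0 F\<^sub>1) \<gamma> (basis_vec n :: 'v \<Rightarrow> 'k::field) =
           (\<Sum>a | a \<in> arcs T \<and> tail T a = n \<and> F\<^sub>1 a = \<gamma>. basis_vec (head T a))"
proof -
  have *: "fun_scale (basis_vec n m :: 'k) y = (if m = n then y else 0)" for m and y :: "'v \<Rightarrow> 'k"
    by (auto simp: fun_scale_def basis_vec_def)
  show ?thesis
    using assms by (simp add: tree_rep_def *)
qed

lemma quiver_representation_tree_rep:
  assumes "fin_digraph T" "quiver_morphism T Q F\<^sub>0 F\<^sub>1"
  shows "quiver_representation Q (tree_rep T F\<^sub>0 F\<^sub>1 :: ('w, 'f, 'k::field, 'v \<Rightarrow> 'k) quiver_rep)"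
proof -
  interpret vector_space "fun_scale :: 'k \<Rightarrow> ('v \<Rightarrow> 'k) \<Rightarrow> 'v \<Rightarrow> 'k"
    by (rule vector_space_fun_scale)
  interpret fin_digraph T by (rule assms(1))
  have app: "fun_scale c f n = c * f n" for c :: 'k and f :: "'v \<Rightarrow> 'k" and n
    by (simp add: fun_scale_def)
  have mem: "basis_vec (head T a) \<in> span (basis_vec ` {n \<in> verts T. F\<^sub>0 n = head Q (F\<^sub>1 a)})"
    if "a \<in> arcs T" for a
    using that assms(2) by (intro span_base) (auto simp: quiver_morphism_def)
  show ?thesis
    unfolding quiver_representation_def linear_between_def tree_rep_def quiver_rep.simps
  proof (intro conjI ballI allI)
    show "vector_space (fun_scale :: 'k \<Rightarrow> ('v \<Rightarrow> 'k) \<Rightarrow> 'v \<Rightarrow> 'k)"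
      by (rule vector_space_fun_scale)
  qed (use mem in \<open>auto intro!: span_sum span_scale
         simp: scale_left_distrib sum.distrib scale_sum_right app\<close>)
qed

end

theory Submission
  imports Defs
begin

text \<open>
  Root the diagram at the branch vertex \<open>c = n - 2\<close>. If \<open>M\<close> is indecomposable and nonzero at \<open>c\<close>,
  every arrow pointing towards \<open>c\<close> is injective and every arrow pointing away from it is surjective:
  at the outermost failure, a complement of the kernel or image that is compatible with the
  filtration coming from outside would split off a summand. So \<open>M\<close> is determined by the space \<open>M c\<close>
  with a chain of subspaces (from the long arm) and two further subspaces \<open>A\<close>, \<open>B\<close> (images or kernels
  of the short arms), and every splitting of \<open>M c\<close> compatible with these data is trivial. This forces
  \<open>M c\<close> to be a line, or a plane spanned by \<open>a\<close>, \<open>b\<close> with \<open>A = \<langle>a\<rangle>\<close>, \<open>B = \<langle>b\<rangle>\<close> and \<open>\<langle>a + b\<rangle>\<close> in the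
  chain. Bases then propagate outwards along the arms in one or two rows. In the plane case the basis
  \<open>a + b\<close>, \<open>\<plusminus> b\<close> makes both rows independent except at the vertex \<open>n - 1\<close>, which is joined to both of
  them with coefficient 1, so that the rows form a tree. If \<open>M c = 0\<close>, the same argument applies with
  another root and yields a single row.
\<close>

section \<open>Splittings of a vector space\<close>

text \<open>Three distinct lines in a plane, two from the short arms and one from the chain, cannot
  all be coordinate lines of one basis. The chain line is made a coordinate line because the whole
  long arm hangs on it, and so is the line coming from the vertex \<open>n\<close>. The line of
  \<open>a\<close> remains as the diagonal, which only the single vertex \<open>n - 1\<close> has to
  absorb. The sign depends on the orientation there: if the arrow points to the branch vertex, its
  image is spanned by \<open>a = (a + b) + (- b)\<close>; if it points away, \<open>a\<close> lies
  in its kernel, so that \<open>a + b\<close> and \<open>b\<close> have the same image.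

  Arrows of both orientations are turned into linear relations directed from the outer end to the
  root, so that one pullback argument serves for injective and for surjective maps. Complements come
  from Zorn's lemma and are chosen compatibly with a chain.\<close>

text \<open>
  A locale of its own rather than the context of \<^locale>\<open>vector_space\<close>, where the interpretation for
  real vector spaces would shadow the names of new constants.
\<close>

locale ambient_space = vector_space scale
  for scale :: "'a::field \<Rightarrow> 'b::ab_group_add \<Rightarrow> 'b" (infixr "*s" 75)
begin

definition splits :: "'b set \<Rightarrow> 'b set \<Rightarrow> 'b set \<Rightarrow> bool" where
  "splits V X Y \<longleftrightarrow> subspace X \<and> subspace Y \<and> X \<inter> Y = {0} \<and> V = {x + y | x y. x \<in> X \<and> y \<in> Y}"

text \<open>For subspaces this is S = (S \<inter> X) + (S \<inter> Y), that is, S is homogeneous for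
  the decomposition; uniqueness of the two parts comes from \<open>splits\<close>.\<close>

definition compat :: "'b set \<Rightarrow> 'b set \<Rightarrow> 'b set \<Rightarrow> bool" where
  "compat X Y S \<longleftrightarrow> (\<forall>s\<in>S. \<exists>x\<in>S \<inter> X. \<exists>y\<in>S \<inter> Y. s = x + y)"

text \<open>With {0} and V as members, the extremal choices made later always range over a nonempty
  family.\<close>

definition subspace_chain :: "'b set \<Rightarrow> 'b set set \<Rightarrow> bool" where
  "subspace_chain V C \<longleftrightarrow> finite C \<and> {0} \<in> C \<and> V \<in> C \<and> (\<forall>S\<in>C. subspace S \<and> S \<subseteq> V) \<and>
     (\<forall>S\<in>C. \<forall>S'\<in>C. S \<subseteq> S' \<or> S' \<subseteq> S)"

lemma subspace_set_sum:
  assumes "subspace X" "subspace Y"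
  shows "subspace {x + y | x y. x \<in> X \<and> y \<in> Y}"
proof (rule subspaceI)
  show "0 \<in> {x + y | x y. x \<in> X \<and> y \<in> Y}"
    using assms[THEN subspace_0] by force
next
  fix a b assume "a \<in> {x + y | x y. x \<in> X \<and> y \<in> Y}" "b \<in> {x + y | x y. x \<in> X \<and> y \<in> Y}"
  then obtain x y x' y' where "a = x + y" "b = x' + y'" "x \<in> X" "x' \<in> X" "y \<in> Y" "y' \<in> Y"
    by blast
  then have "a + b = (x + x') + (y + y')" "x + x' \<in> X" "y + y' \<in> Y"
    using assms by (auto intro: subspace_add)
  then show "a + b \<in> {x + y | x y. x \<in> X \<and> y \<in> Y}" by blast
next
  fix c a assume "a \<in> {x + y | x y. x \<in> X \<and> y \<in> Y}"
  then show "c *s a \<in> {x + y | x y. x \<in> X \<and> y \<in> Y}"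
    using assms by (auto simp: scale_right_distrib) (blast intro: subspace_scale)
qed

lemma splitsD:
  assumes "splits V X Y"
  shows "subspace X" "subspace Y" "X \<inter> Y = {0}" "X \<subseteq> V" "Y \<subseteq> V" "subspace V"
    "v \<in> V \<Longrightarrow> \<exists>x\<in>X. \<exists>y\<in>Y. v = x + y"
proof -
  show *: "subspace X" "subspace Y" "X \<inter> Y = {0}" "v \<in> V \<Longrightarrow> \<exists>x\<in>X. \<exists>y\<in>Y. v = x + y"
    using assms by (auto simp: splits_def)
  have "x \<in> V" if "x \<in> X" for x
    using assms that *(2)[THEN subspace_0] by (force simp: splits_def)
  then show "X \<subseteq> V" by blast
  have "y \<in> V" if "y \<in> Y" for y
    using assms that *(1)[THEN subspace_0] by (force simp: splits_def)
  then show "Y \<subseteq> V" by blast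
  show "subspace V"
    using subspace_set_sum[OF *(1,2)] assms by (simp add: splits_def)
qed

lemma splitsI:
  assumes "subspace V" "subspace X" "subspace Y" "X \<subseteq> V" "Y \<subseteq> V"
    and "\<And>x. x \<in> X \<Longrightarrow> x \<in> Y \<Longrightarrow> x = 0"
    and "\<And>v. v \<in> V \<Longrightarrow> \<exists>x\<in>X. \<exists>y\<in>Y. v = x + y"
  shows "splits V X Y"
  unfolding splits_def
proof (intro conjI)
  show "X \<inter> Y = {0}"
    using assms(2,3,6) by (auto simp: subspace_0)
  show "V = {x + y |x y. x \<in> X \<and> y \<in> Y}"
  proof
    show "V \<subseteq> {x + y |x y. x \<in> X \<and> y \<in> Y}"
      using assms(7) by blast
    show "{x + y |x y. x \<in> X \<and> y \<in> Y} \<subseteq> V"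
      using assms(4,5) subspace_add[OF assms(1)] by blast
  qed
qed (fact assms(2,3))+

lemma splits_sym: "splits V X Y \<Longrightarrow> splits V Y X"
proof (rule splitsI)
  assume s: "splits V X Y"
  note d = splitsD[OF s]
  show "subspace V" "subspace Y" "subspace X" "Y \<subseteq> V" "X \<subseteq> V" by (fact d)+
  show "x = 0" if "x \<in> Y" "x \<in> X" for x using d(3) that by blast
  show "\<exists>y\<in>Y. \<exists>x\<in>X. v = y + x" if "v \<in> V" for v
    using d(7)[OF that] by (metis add.commute)
qed

lemma compat_sym: "compat X Y S \<Longrightarrow> compat Y X S"
  unfolding compat_def by (metis add.commute)

lemma compat_whole: "splits V X Y \<Longrightarrow> compat X Y V"
proof -
  assume s: "splits V X Y"
  have "V \<inter> X = X" "V \<inter> Y = Y" using splitsD(4,5)[OF s] by blast+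
  then show ?thesis unfolding compat_def using splitsD(7)[OF s] by simp
qed

lemma compat_zero: "splits V X Y \<Longrightarrow> compat X Y {0}"
  using splitsD(1,2)[THEN subspace_0] by (auto simp: compat_def intro!: bexI[of _ 0])

lemma splits_trivial: "subspace V \<Longrightarrow> splits V V {0}"
  by (rule splitsI) (auto simp: subspace_0 intro: subspaceI)

lemma subspace_zero_set: "subspace {0}"
  by (rule subspaceI) auto

section \<open>Complements, also relative to a chain\<close>

text \<open>Zorn's lemma, applied to the subspaces between Z and V that meet K only in 0. Starting
  from a prescribed Z is what allows complements to be extended along a chain.\<close>

lemma ex_complement:
  assumes V: "subspace V" and K: "subspace K" "K \<subseteq> V"
    and Z: "subspace Z" "Z \<subseteq> V" "K \<inter> Z = {0}"
  obtains Y where "splits V K Y" "Z \<subseteq> Y"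
proof -
  let ?A = "{Y. subspace Y \<and> Z \<subseteq> Y \<and> Y \<subseteq> V \<and> K \<inter> Y = {0}}"
  have "\<exists>Y\<in>?A. \<forall>X\<in>?A. Y \<subseteq> X \<longrightarrow> X = Y"
  proof (rule subset_Zorn_nonempty)
    show "?A \<noteq> {}" using Z by blast
  next
    fix C assume C: "C \<noteq> {}" "subset.chain ?A C"
    then have sub: "C \<subseteq> ?A" and lin: "\<And>X Y. X \<in> C \<Longrightarrow> Y \<in> C \<Longrightarrow> X \<subseteq> Y \<or> Y \<subseteq> X"
      by (auto simp: subset_chain_def)
    have "subspace (\<Union>C)"
    proof (rule subspaceI)
      show "0 \<in> \<Union>C" using C(1) sub by (fastforce simp: subspace_0)
    next
      fix x y assume "x \<in> \<Union>C" "y \<in> \<Union>C"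
      then obtain X Y where "X \<in> C" "Y \<in> C" "x \<in> X" "y \<in> Y" by blast
      then obtain W where "W \<in> C" "x \<in> W" "y \<in> W" using lin by blast
      then show "x + y \<in> \<Union>C" using sub by (blast intro: subspace_add)
    next
      fix c x assume "x \<in> \<Union>C"
      then show "c *s x \<in> \<Union>C" using sub by (blast intro: subspace_scale)
    qed
    moreover have "K \<inter> \<Union>C = {0}"
    proof -
      have "K \<inter> \<Union>C = (\<Union>Y\<in>C. K \<inter> Y)" by blast
      also have "\<dots> = (\<Union>Y\<in>C. {0})" using sub by (intro SUP_cong) auto
      finally show ?thesis using C(1) by simp
    qed
    moreover have "Z \<subseteq> \<Union>C" "\<Union>C \<subseteq> V" using C(1) sub by blast+
    ultimately show "\<Union>C \<in> ?A" by simp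
  qed
  then obtain Y where YA: "Y \<in> ?A" and YM: "\<forall>X\<in>?A. Y \<subseteq> X \<longrightarrow> X = Y" by (rule bexE)
  from YA have Y: "subspace Y" "Z \<subseteq> Y" "Y \<subseteq> V" "K \<inter> Y = {0}" by simp_all
  from YM have max: "X = Y"
    if "subspace X" "Z \<subseteq> X" "X \<subseteq> V" "K \<inter> X = {0}" "Y \<subseteq> X" for X
    using that by simp
  have "\<exists>x\<in>K. \<exists>y\<in>Y. v = x + y" if v: "v \<in> V" for v
  proof (rule ccontr)
    assume no: "\<not> ?thesis"
    let ?X = "{x + y | x y. x \<in> span {v} \<and> y \<in> Y}"
    have X: "subspace ?X" by (intro subspace_set_sum subspace_span Y)
    have "Y \<subseteq> ?X" using span_zero[of "{v}"] by force
    moreover have "v \<in> ?X" using span_base[of v "{v}"] subspace_0[OF Y(1)] by force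
    moreover have "?X \<subseteq> V"
      using span_minimal[of "{v}" V] V Y(3) v by (auto intro!: subspace_add)
    moreover have "K \<inter> ?X = {0}"
    proof -
      have "k = 0" if k: "k \<in> K" "k = x + y" "x \<in> span {v}" "y \<in> Y" for k x y
      proof -
        obtain c where c: "x = c *s v" using k(3) by (auto simp: span_singleton)
        show ?thesis
        proof (cases "c = 0")
          case True
          then show ?thesis using k c Y(4) by auto
        next
          \<comment> \<open>With c \<noteq> 0 the relation can be solved for v, which would then lie
            in K + Y.\<close>
          case False
          have "inverse c *s (c *s v) = inverse c *s (k + - y)" using k(2) c by simp
          then have "v = inverse c *s k + inverse c *s (- y)"
            using False by (simp only: scale_right_distrib) simp
          moreover have "inverse c *s k \<in> K" "inverse c *s (- y) \<in> Y"
            using k K Y by (auto intro: subspace_scale subspace_neg)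
          ultimately show ?thesis using no by blast
        qed
      qed
      then show ?thesis using subspace_0[OF K(1)] subspace_0[OF X] by blast
    qed
    ultimately have "?X = Y" "v \<in> ?X" using max[OF X] Y(2) by auto
    then have "v \<in> Y" by simp
    then show False using no subspace_0[OF K(1)] by force
  qed
  then have "splits V K Y"
    using V K Y by (intro splitsI) auto
  with Y(2) show ?thesis by (rule that[rotated])
qed

lemma ex_hyperplane:
  assumes "subspace V" "subspace P" "P \<subseteq> V" "x \<in> V" "x \<notin> P"
  obtains H where "splits V (span {x}) H" "P \<subseteq> H" "x \<notin> H"
proof -
  have "x \<noteq> 0" using assms(2,5) by (auto simp: subspace_0)
  have "y = 0" if y: "y \<in> span {x}" "y \<in> P" for y
  proof -
    obtain c where c: "y = c *s x" using y(1) by (auto simp: span_singleton)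
    have "c = 0"
    proof (rule ccontr)
      assume "c \<noteq> 0"
      then have "x = inverse c *s y" using c by simp
      then show False using y(2) assms(2,5) subspace_scale by metis
    qed
    then show ?thesis using c by simp
  qed
  then have "span {x} \<inter> P = {0}"
    using assms(2) by (auto simp: subspace_0 span_zero)
  moreover have "span {x} \<subseteq> V" using assms by (intro span_minimal) auto
  ultimately obtain H where H: "splits V (span {x}) H" "P \<subseteq> H"
    using ex_complement[of V "span {x}" P] assms subspace_span by metis
  have "x \<notin> H" using splitsD(3)[OF H(1)] span_base[of x "{x}"] \<open>x \<noteq> 0\<close> by blast
  with H show ?thesis by (rule that)
qed

text \<open>Induction on the number of members: inside the largest member S, complement K \<inter> S
  compatibly with the smaller members. The result Z meets K trivially because Z \<subseteq> S, so it
  extends to a complement of K in V; enlarging the two summands does not disturb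
  compatibility.\<close>

lemma ex_chain_complement:
  assumes "finite C" and "subspace V" and "subspace K" "K \<subseteq> V"
    and "\<And>S. S \<in> C \<Longrightarrow> subspace S \<and> S \<subseteq> V"
    and "\<And>S S'. S \<in> C \<Longrightarrow> S' \<in> C \<Longrightarrow> S \<subseteq> S' \<or> S' \<subseteq> S"
  shows "\<exists>Y. splits V K Y \<and> (\<forall>S\<in>C. compat K Y S)"
  using assms
proof (induction "card C" arbitrary: C V K rule: less_induct)
  case less
  show ?case
  proof (cases "C = {}")
    case True
    then show ?thesis
      using ex_complement[OF less.prems(2-4), of "{0}"] less.prems(2,3) subspace_zero_set
      by (auto simp: subspace_0)
  next
    case False
    then obtain S where S: "S \<in> C" and "\<forall>S'\<in>C. S \<subseteq> S' \<longrightarrow> S = S'"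
      using finite_has_maximal[OF less.prems(1)] by metis
    then have S_max: "S' \<subseteq> S" if "S' \<in> C" for S'
      using less.prems(6)[OF S that] that by blast
    have sS: "subspace S" "S \<subseteq> V" using less.prems(5)[OF S] by auto
    have "\<exists>Y. splits S (K \<inter> S) Y \<and> (\<forall>S'\<in>C - {S}. compat (K \<inter> S) Y S')"
    proof (rule less.hyps)
      show "card (C - {S}) < card C" using S less.prems(1) by (meson card_Diff1_less)
    qed (use less.prems sS S_max in \<open>auto intro: subspace_inter\<close>)
    then obtain Z where Z: "splits S (K \<inter> S) Z" "\<And>S'. S' \<in> C \<Longrightarrow> compat (K \<inter> S) Z S'"
      using compat_whole by (metis Diff_iff singletonD)
    have "subspace Z" "Z \<subseteq> V" "K \<inter> Z = {0}"
      using splitsD[OF Z(1)] sS by auto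
    then obtain Y where "splits V K Y" "Z \<subseteq> Y"
      using ex_complement less.prems(2-4) by metis
    moreover have "compat K Y S'" if "S' \<in> C" for S'
      using Z(2)[OF that] \<open>Z \<subseteq> Y\<close> unfolding compat_def by blast
    ultimately show ?thesis by blast
  qed
qed

section \<open>Arms\<close>

text \<open>A linear subspace of V \<times> W, written out by its closure properties. Relations in
  place of maps treat both orientations of an arrow alike, with the outer space always on the
  left.\<close>

definition linear_relation :: "'b set \<Rightarrow> 'b set \<Rightarrow> ('b \<times> 'b) set \<Rightarrow> bool" where
  "linear_relation V W R \<longleftrightarrow> subspace V \<and> subspace W \<and> R \<subseteq> V \<times> W \<and> (0, 0) \<in> R \<and>
     (\<forall>x y x' y'. (x, y) \<in> R \<longrightarrow> (x', y') \<in> R \<longrightarrow> (x + x', y + y') \<in> R) \<and>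
     (\<forall>c x y. (x, y) \<in> R \<longrightarrow> (c *s x, c *s y) \<in> R)"

text \<open>
  The converse of \<open>R\<close> is a partial map onto \<open>V\<close>, that is, \<open>R\<close> exhibits \<open>V\<close> as a subquotient. For the
  graph of an arrow this means injective towards the root and surjective away from it.
\<close>

definition presents :: "'b set \<Rightarrow> ('b \<times> 'b) set \<Rightarrow> bool" where
  "presents V R \<longleftrightarrow> V \<subseteq> Domain R \<and> (\<forall>x x' y. (x, y) \<in> R \<longrightarrow> (x', y) \<in> R \<longrightarrow> x = x')"

lemma linear_relationD:
  assumes "linear_relation V W R"
  shows "subspace V" "subspace W" "(x, y) \<in> R \<Longrightarrow> x \<in> V" "(x, y) \<in> R \<Longrightarrow> y \<in> W" "(0, 0) \<in> R"
    "(x, y) \<in> R \<Longrightarrow> (x', y') \<in> R \<Longrightarrow> (x + x', y + y') \<in> R"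
    "(x, y) \<in> R \<Longrightarrow> (c *s x, c *s y) \<in> R"
    "(x, y) \<in> R \<Longrightarrow> (x', y') \<in> R \<Longrightarrow> (x - x', y - y') \<in> R"
proof -
  show *: "subspace V" "subspace W" "(x, y) \<in> R \<Longrightarrow> x \<in> V" "(x, y) \<in> R \<Longrightarrow> y \<in> W" "(0, 0) \<in> R"
    "(x, y) \<in> R \<Longrightarrow> (x', y') \<in> R \<Longrightarrow> (x + x', y + y') \<in> R"
    "(x, y) \<in> R \<Longrightarrow> (c *s x, c *s y) \<in> R" for x y x' y' c
    using assms unfolding linear_relation_def by blast+
  show "(x - x', y - y') \<in> R" if "(x, y) \<in> R" "(x', y') \<in> R"
    using *(6)[OF that(1) *(7)[OF that(2), of "-1"]] by (simp only: scale_minus_left scale_one) simp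
qed

lemma linear_relation_converse: "linear_relation V W R \<Longrightarrow> linear_relation W V (R\<inverse>)"
  unfolding linear_relation_def converse_iff by (elim conjE, intro conjI) blast+

lemma subspace_Image:
  assumes R: "linear_relation V W R" and S: "subspace S"
  shows "subspace (R `` S)"
proof (rule subspaceI)
  show "0 \<in> R `` S" using linear_relationD(5)[OF R] subspace_0[OF S] by blast
  show "x + y \<in> R `` S" if "x \<in> R `` S" "y \<in> R `` S" for x y
    using that linear_relationD(6)[OF R] subspace_add[OF S] by blast
  show "c *s x \<in> R `` S" if "x \<in> R `` S" for c x
    using that linear_relationD(7)[OF R] subspace_scale[OF S] by blast
qed

lemma presentsD:
  assumes "presents V R"
  shows "x \<in> V \<Longrightarrow> \<exists>y. (x, y) \<in> R" "(x, y) \<in> R \<Longrightarrow> (x', y) \<in> R \<Longrightarrow> x = x'"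
  using assms unfolding presents_def by blast+

section \<open>Transport of splittings along relations and arms\<close>

text \<open>The partial map from W onto V is defined on the image of V under R, and its kernel is
  the image of {0}. A splitting of W compatible with domain and kernel therefore induces one on the
  subquotient, which is V.\<close>

lemma splits_pullback:
  assumes R: "linear_relation V W R" and P: "presents V R" and XY: "splits W X Y"
    and V: "compat X Y (R `` V)" and ker: "compat X Y (R `` {0})"
  shows "splits V (R\<inverse> `` X) (R\<inverse> `` Y)"
proof (rule splitsI)
  note r = linear_relationD[OF R] and xy = splitsD[OF XY]
  show "subspace V" by (rule r)
  show "subspace (R\<inverse> `` X)" "subspace (R\<inverse> `` Y)"
    using subspace_Image linear_relation_converse[OF R] xy by blast+
  show "R\<inverse> `` X \<subseteq> V" "R\<inverse> `` Y \<subseteq> V" using r(3) by blast+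
  show "x = 0" if "x \<in> R\<inverse> `` X" "x \<in> R\<inverse> `` Y" for x
  proof -
    from that obtain y z where yz: "(x, y) \<in> R" "(x, z) \<in> R" "y \<in> X" "z \<in> Y" by blast
    \<comment> \<open>Two representatives of x differ by a kernel element; moving its parts to their
      own sides gives an element of X \<inter> Y.\<close>
    have "y - z \<in> R `` {0}" using r(8)[OF yz(1,2)] by auto
    then obtain u w where uw: "u \<in> X" "w \<in> Y" "(0, u) \<in> R" "(0, w) \<in> R" "y - z = u + w"
      using ker by (fastforce simp: compat_def)
    have "y - u = z + w" using uw(5) by (simp add: algebra_simps)
    moreover have "y - u \<in> X" "z + w \<in> Y"
      using yz uw xy by (auto intro: subspace_add subspace_diff)
    ultimately have "y - u = 0" using xy(3) by auto
    then show "x = 0" using presentsD(2)[OF P yz(1)] uw(3) by auto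
  qed
  show "\<exists>x\<in>R\<inverse> `` X. \<exists>y\<in>R\<inverse> `` Y. v = x + y" if v: "v \<in> V" for v
  proof -
    obtain w where w: "(v, w) \<in> R" using presentsD(1)[OF P v] by blast
    then have "w \<in> R `` V" using v by blast
    then obtain x y where xy': "x \<in> X" "y \<in> Y" "x \<in> R `` V" "y \<in> R `` V" "w = x + y"
      using V unfolding compat_def by blast
    then obtain x' y' where "(x', x) \<in> R" "(y', y) \<in> R" by blast
    moreover from this have "v = x' + y'"
      using presentsD(2)[OF P w] r(6) xy'(5) by blast
    ultimately show ?thesis using xy' by blast
  qed
qed

text \<open>The partial map sends the image of S under R back onto S, so the parts of a
  representative map to the parts of the element.\<close>

lemma compat_pullback:
  assumes R: "linear_relation V W R" and P: "presents V R"
    and S: "S \<subseteq> V" "compat X Y (R `` S)"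
  shows "compat (R\<inverse> `` X) (R\<inverse> `` Y) S"
  unfolding compat_def
proof
  fix s assume s: "s \<in> S"
  then obtain w where w: "(s, w) \<in> R" using presentsD(1)[OF P] S(1) by blast
  then have "w \<in> R `` S" using s by blast
  then obtain x y where xy: "x \<in> R `` S \<inter> X" "y \<in> R `` S \<inter> Y" "w = x + y"
    using S(2) unfolding compat_def by meson
  then obtain x' y' where x'y': "(x', x) \<in> R" "(y', y) \<in> R" "x' \<in> S" "y' \<in> S" by blast
  moreover from this have "s = x' + y'"
    using presentsD(2)[OF P w] linear_relationD(6)[OF R] xy(3) by blast
  ultimately show "\<exists>x\<in>S \<inter> R\<inverse> `` X. \<exists>y\<in>S \<inter> R\<inverse> `` Y. s = x + y" using xy by blast
qed

text \<open>
  An arm is a sequence of spaces, consecutive ones being joined by a relation; its chain is the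
  filtration that the arm induces on its last space.
\<close>

fun arm_chain :: "(nat \<Rightarrow> 'b set) \<Rightarrow> (nat \<Rightarrow> ('b \<times> 'b) set) \<Rightarrow> nat \<Rightarrow> 'b set set" where
  "arm_chain V R 0 = {{0}, V 0}"
| "arm_chain V R (Suc j) = {{0}, V (Suc j)} \<union> (\<lambda>S. R j `` S) ` arm_chain V R j"

lemma zero_whole_in_arm_chain: "{0} \<in> arm_chain V R k" "V k \<in> arm_chain V R k"
  by (cases k; simp)+

lemma subspace_chain_arm_chain:
  assumes "subspace (V 0)" and "\<And>j. j < k \<Longrightarrow> linear_relation (V j) (V (Suc j)) (R j)"
  shows "subspace_chain (V k) (arm_chain V R k)"
  using assms(2)
proof (induction k)
  case 0
  then show ?case using assms(1) subspace_zero_set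
    by (auto simp: subspace_chain_def subspace_0)
next
  case (Suc k)
  have IH: "subspace_chain (V k) (arm_chain V R k)" using Suc by simp
  have R: "linear_relation (V k) (V (Suc k)) (R k)" using Suc.prems by simp
  note r = linear_relationD[OF R]
  have *: "subspace (R k `` S)" "R k `` S \<subseteq> V (Suc k)" if "S \<in> arm_chain V R k" for S
  proof -
    have "subspace S" using IH that by (simp add: subspace_chain_def)
    then show "subspace (R k `` S)" by (rule subspace_Image[OF R])
    show "R k `` S \<subseteq> V (Suc k)" using r(4) by blast
  qed
  have mono: "R k `` S \<subseteq> R k `` S' \<or> R k `` S' \<subseteq> R k `` S"
    if "S \<in> arm_chain V R k" "S' \<in> arm_chain V R k" for S S'
  proof -
    have "S \<subseteq> S' \<or> S' \<subseteq> S" using IH that by (simp add: subspace_chain_def)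
    then show ?thesis by blast
  qed
  show ?case
    unfolding subspace_chain_def
  proof (intro conjI ballI)
    show "finite (arm_chain V R (Suc k))" using IH by (simp add: subspace_chain_def)
    show "{0} \<in> arm_chain V R (Suc k)" "V (Suc k) \<in> arm_chain V R (Suc k)" by simp_all
    show sub: "subspace S" "S \<subseteq> V (Suc k)" if "S \<in> arm_chain V R (Suc k)" for S
      using that * r(2) subspace_zero_set subspace_0[OF r(2)] by auto
    show "S \<subseteq> S' \<or> S' \<subseteq> S"
      if S: "S \<in> arm_chain V R (Suc k)" "S' \<in> arm_chain V R (Suc k)" for S S'
    proof (cases "{S, S'} \<subseteq> (\<lambda>S. R k `` S) ` arm_chain V R k")
      case True
      then have "S \<in> (\<lambda>S. R k `` S) ` arm_chain V R k" "S' \<in> (\<lambda>S. R k `` S) ` arm_chain V R k"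
        by simp_all
      then show ?thesis using mono by (elim imageE) simp
    next
      case False
      then have "{0} \<in> {S, S'} \<or> V (Suc k) \<in> {S, S'}" using S by auto
      then show ?thesis
        using sub[OF S(1)] sub[OF S(2)] by (auto dest: subspace_0)
    qed
  qed
qed

text \<open>Works outwards from the root end. The chain at \<open>Suc k\<close> contains the images
  of all members of the chain at \<open>k\<close>, in particular of {0} and \<open>V k\<close>,
  which is exactly what pulling back the splitting and its compatibility asks for.\<close>

lemma arm_splits:
  assumes "\<And>j. j < k \<Longrightarrow> linear_relation (V j) (V (Suc j)) (R j)"
    and "\<And>j. j < k \<Longrightarrow> presents (V j) (R j)"
    and "subspace (V 0)"
    and "splits (V k) X Y" and "\<And>S. S \<in> arm_chain V R k \<Longrightarrow> compat X Y S"
  shows "\<exists>U W. U k = X \<and> W k = Y \<and> (\<forall>j\<le>k. splits (V j) (U j) (W j)) \<and>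
     (\<forall>j<k. U j = (R j)\<inverse> `` U (Suc j) \<and> W j = (R j)\<inverse> `` W (Suc j))"
  using assms
proof (induction k arbitrary: X Y)
  case 0
  have "splits (V 0) X Y" by (fact 0)
  then show ?case by (intro exI[of _ "\<lambda>_. X"] exI[of _ "\<lambda>_. Y"]) simp
next
  case (Suc k)
  have R: "linear_relation (V k) (V (Suc k)) (R k)" and P: "presents (V k) (R k)"
    using Suc.prems by simp_all
  have ch: "subspace_chain (V k) (arm_chain V R k)"
    using Suc.prems by (intro subspace_chain_arm_chain) auto
  have c: "compat X Y (R k `` S)" if "S \<in> arm_chain V R k" for S
    using Suc.prems(5)[of "R k `` S"] that by simp
  have "splits (V k) ((R k)\<inverse> `` X) ((R k)\<inverse> `` Y)"
    using splits_pullback[OF R P Suc.prems(4)] c zero_whole_in_arm_chain by blast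
  moreover have "compat ((R k)\<inverse> `` X) ((R k)\<inverse> `` Y) S" if "S \<in> arm_chain V R k" for S
    using compat_pullback[OF R P _ c[OF that]] ch that by (auto simp: subspace_chain_def)
  ultimately have "\<exists>U W. U k = (R k)\<inverse> `` X \<and> W k = (R k)\<inverse> `` Y \<and>
      (\<forall>j\<le>k. splits (V j) (U j) (W j)) \<and>
      (\<forall>j<k. U j = (R j)\<inverse> `` U (Suc j) \<and> W j = (R j)\<inverse> `` W (Suc j))"
    by (intro Suc.IH) (simp_all add: Suc.prems)
  then obtain U W where UW: "U k = (R k)\<inverse> `` X" "W k = (R k)\<inverse> `` Y"
     "\<And>j. j \<le> k \<Longrightarrow> splits (V j) (U j) (W j)"
     "\<And>j. j < k \<Longrightarrow> U j = (R j)\<inverse> `` U (Suc j) \<and> W j = (R j)\<inverse> `` W (Suc j)"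
    by (elim exE conjE) simp
  have "splits (V j) ((U(Suc k := X)) j) ((W(Suc k := Y)) j)" if "j \<le> Suc k" for j
    using that UW(3)[of j] Suc.prems(4) by (cases "j = Suc k") auto
  moreover have "(U(Suc k := X)) j = (R j)\<inverse> `` ((U(Suc k := X)) (Suc j)) \<and>
      (W(Suc k := Y)) j = (R j)\<inverse> `` ((W(Suc k := Y)) (Suc j))" if "j < Suc k" for j
    using that UW(1,2) UW(4)[of j] by (cases "j = k") auto
  ultimately show ?case
    by (intro exI[of _ "U(Suc k := X)"] exI[of _ "W(Suc k := Y)"] conjI allI impI) simp_all
qed

section \<open>A chain and two subspaces\<close>

definition frame :: "'b set \<Rightarrow> 'b \<Rightarrow> 'b \<Rightarrow> bool" where
  "frame V a b \<longleftrightarrow> V = span {a, b} \<and> (\<forall>s t. s *s a + t *s b = 0 \<longrightarrow> s *s a = 0 \<and> t *s b = 0)"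

lemma in_span_pair: "v \<in> span {a, b} \<longleftrightarrow> (\<exists>s t. v = s *s a + t *s b)"
proof -
  have "v \<in> span {a, b} \<longleftrightarrow> (\<exists>s t. v - s *s a = t *s b)"
    by (auto simp: span_insert span_singleton)
  then show ?thesis by (simp add: algebra_simps)
qed

lemma in_span_single: "v \<in> span {a} \<longleftrightarrow> (\<exists>s. v = s *s a)"
  by (auto simp: span_singleton)

lemma frame_line: "V = span {x} \<Longrightarrow> frame V x 0" "V = span {x} \<Longrightarrow> frame V 0 x"
  by (auto simp: frame_def in_span_pair in_span_single set_eq_iff)

lemma span_single_eq_zero: "span {x} = {0} \<longleftrightarrow> x = 0"
  using span_base[of x "{x}"] by auto

text \<open>Modular law: the X-part of an element of S lies in S, hence so does the
  remainder.\<close>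

lemma compat_left:
  assumes "splits V X Y" "subspace S" "S \<subseteq> V" "X \<subseteq> S"
  shows "compat X Y S"
  unfolding compat_def
proof
  fix s assume s: "s \<in> S"
  then obtain x y where xy: "x \<in> X" "y \<in> Y" "s = x + y"
    using splitsD(7)[OF assms(1)] assms(3) by blast
  have "s - x \<in> S" using s xy(1) assms by (intro subspace_diff) auto
  then have "y \<in> S" using xy(3) by simp
  then show "\<exists>x\<in>S \<inter> X. \<exists>y\<in>S \<inter> Y. s = x + y" using xy assms(4) by blast
qed

lemma compat_right:
  assumes "splits V X Y" "subspace S" "S \<subseteq> V" "Y \<subseteq> S"
  shows "compat X Y S"
  using compat_left[OF splits_sym] compat_sym assms by blast

lemma compat_subset_right:
  assumes "splits V X Y" "subspace S" "S \<subseteq> Y"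
  shows "compat X Y S"
  using splitsD(1)[OF assms(1), THEN subspace_0] subspace_0[OF assms(2)] assms(3)
  by (force simp: compat_def)

section \<open>Extremal members of a chain and the indecomposable configurations\<close>

lemma chain_cut:
  assumes C: "subspace_chain V C" and "x \<noteq> 0"
  obtains P where "P \<in> C" "x \<notin> P" "\<And>S. S \<in> C \<Longrightarrow> x \<notin> S \<Longrightarrow> S \<subseteq> P"
proof -
  let ?D = "{S \<in> C. x \<notin> S}"
  have "finite ?D" "?D \<noteq> {}" using assms by (auto simp: subspace_chain_def)
  from finite_has_maximal[OF this]
  obtain P where P: "P \<in> ?D" "\<forall>S\<in>?D. P \<subseteq> S \<longrightarrow> P = S"
    by (rule bexE)
  have "S \<subseteq> P" if "S \<in> C" "x \<notin> S" for S
  proof -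
    have "S \<subseteq> P \<or> P \<subseteq> S" using that P(1) C by (simp add: subspace_chain_def)
    then show ?thesis using that P(2) by blast
  qed
  with P(1) show ?thesis by (intro that) auto
qed

lemma chain_least:
  assumes C: "subspace_chain V C" and "\<Phi> V"
  obtains P where "P \<in> C" "\<Phi> P" "\<And>S. S \<in> C \<Longrightarrow> \<Phi> S \<Longrightarrow> P \<subseteq> S"
proof -
  let ?D = "{S \<in> C. \<Phi> S}"
  have "finite ?D" "?D \<noteq> {}" using assms by (auto simp: subspace_chain_def)
  from finite_has_minimal[OF this]
  obtain P where P: "P \<in> ?D" "\<forall>S\<in>?D. S \<subseteq> P \<longrightarrow> P = S"
    by (rule bexE)
  have "P \<subseteq> S" if "S \<in> C" "\<Phi> S" for S
  proof -
    have "S \<subseteq> P \<or> P \<subseteq> S" using that P(1) C by (simp add: subspace_chain_def)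
    then show ?thesis using that P(2) by blast
  qed
  with P(1) show ?thesis by (intro that) auto
qed

lemma chain_greatest:
  assumes C: "subspace_chain V C" and "\<Phi> {0}"
  obtains P where "P \<in> C" "\<Phi> P" "\<And>S. S \<in> C \<Longrightarrow> \<Phi> S \<Longrightarrow> S \<subseteq> P"
proof -
  let ?D = "{S \<in> C. \<Phi> S}"
  have "finite ?D" "?D \<noteq> {}" using assms by (auto simp: subspace_chain_def)
  from finite_has_maximal[OF this]
  obtain P where P: "P \<in> ?D" "\<forall>S\<in>?D. P \<subseteq> S \<longrightarrow> P = S"
    by (rule bexE)
  have "S \<subseteq> P" if "S \<in> C" "\<Phi> S" for S
  proof -
    have "S \<subseteq> P \<or> P \<subseteq> S" using that P(1) C by (simp add: subspace_chain_def)
    then show ?thesis using that P(2) by blast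
  qed
  with P(1) show ?thesis by (intro that) auto
qed

text \<open>A hyperplane H through P and off x complements the line of x. Members containing x
  contain that line, the others lie in P \<subseteq> H; so all are compatible and H must
  vanish.\<close>

lemma line_of_no_splitting:
  assumes V: "subspace V"
    and no: "\<And>X Y. splits V X Y \<Longrightarrow> (\<And>S. S \<in> \<S> \<Longrightarrow> compat X Y S) \<Longrightarrow> X = {0} \<or> Y = {0}"
    and \<S>: "\<And>S. S \<in> \<S> \<Longrightarrow> subspace S \<and> S \<subseteq> V"
    and P: "subspace P" "P \<subseteq> V" "x \<in> V" "x \<notin> P"
    and dich: "\<And>S. S \<in> \<S> \<Longrightarrow> x \<in> S \<or> S \<subseteq> P"
  shows "x \<noteq> 0 \<and> V = span {x}"
proof -
  have x: "x \<noteq> 0" using P by (auto simp: subspace_0)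
  obtain H where H: "splits V (span {x}) H" "P \<subseteq> H"
    using ex_hyperplane[OF V P] by metis
  have "compat (span {x}) H S" if S: "S \<in> \<S>" for S
  proof (cases "x \<in> S")
    case True
    then have "span {x} \<subseteq> S" using \<S>[OF S] by (intro span_minimal) auto
    then show ?thesis using compat_left[OF H(1)] \<S>[OF S] by blast
  next
    case False
    then show ?thesis using dich[OF S] compat_subset_right[OF H(1)] \<S>[OF S] H(2) by blast
  qed
  then have "span {x} = {0} \<or> H = {0}" using no[OF H(1)] by blast
  then have "H = {0}" using x by (simp add: span_single_eq_zero)
  then have "V = span {x}" using splitsD(4,7)[OF H(1)] by force
  with x show ?thesis by blast
qed

text \<open>If A and B meet, or do not span V, a line splits off compatibly with everything.
  Otherwise V is their direct sum. Then either the least nonzero chain member meets A or B and again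
  a line splits off, or it contains some a + b with nonzero a in A and b in B, and the plane of a
  and b splits off and is all of V.\<close>

lemma chain_two_subspaces_indecomposable:
  assumes V: "subspace V" "V \<noteq> {0}" and C: "subspace_chain V C"
    and A: "subspace A" "A \<subseteq> V" and B: "subspace B" "B \<subseteq> V"
    and no: "\<And>X Y. splits V X Y \<Longrightarrow> (\<And>S. S \<in> insert A (insert B C) \<Longrightarrow> compat X Y S) \<Longrightarrow>
      X = {0} \<or> Y = {0}"
  shows "(\<exists>x. x \<noteq> 0 \<and> V = span {x}) \<or>
    (\<exists>a b. frame V a b \<and> a \<noteq> 0 \<and> b \<noteq> 0 \<and> A = span {a} \<and> B = span {b} \<and> span {a + b} \<in> C)"
proof -
  have sub: "subspace S" "S \<subseteq> V" if "S \<in> insert A (insert B C)" for S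
    using that C A B by (auto simp: subspace_chain_def)
  have line: "\<exists>x. x \<noteq> 0 \<and> V = span {x}"
    if "subspace P" "P \<subseteq> V" "x \<in> V" "x \<notin> P" "\<And>S. S \<in> insert A (insert B C) \<Longrightarrow> x \<in> S \<or> S \<subseteq> P" for P x
  proof (intro exI, rule line_of_no_splitting)
    show "X = {0} \<or> Y = {0}"
      if "splits V X Y" "\<And>S. S \<in> insert A (insert B C) \<Longrightarrow> compat X Y S" for X Y
      using that by (rule no)
    show "subspace S \<and> S \<subseteq> V" if "S \<in> insert A (insert B C)" for S
      using sub[OF that] by blast
  qed (fact V(1) that)+
  consider "A \<inter> B \<noteq> {0}" | "span (A \<union> B) \<noteq> V" | "A \<inter> B = {0}" "span (A \<union> B) = V" by blast
  then show ?thesis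
  proof cases
    \<comment> \<open>A common vector lies in A and in B, so only the chain needs a cut.\<close>
    case 1
    then obtain x where x: "x \<noteq> 0" "x \<in> A" "x \<in> B"
      using subspace_0[OF A(1)] subspace_0[OF B(1)] by blast
    obtain P where P: "P \<in> C" "x \<notin> P" "\<And>S. S \<in> C \<Longrightarrow> x \<notin> S \<Longrightarrow> S \<subseteq> P"
      using chain_cut[OF C x(1)] by metis
    have "\<exists>x. x \<noteq> 0 \<and> V = span {x}"
    proof (rule line[of P x])
      show "subspace P" "P \<subseteq> V" using sub P(1) by auto
      show "x \<in> V" using x(2) A(2) by blast
      show "x \<notin> P" by (fact P(2))
      show "x \<in> S \<or> S \<subseteq> P" if "S \<in> insert A (insert B C)" for S
        using that x(2,3) P(3) by blast
    qed
    then show ?thesis ..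
  next
    \<comment> \<open>S' is the first member that completes A + B to V, and P the last that does
      not. For x in S' outside A + B + P, each chain member contains S' and thus x, or lies in P; A
      and B lie in A + B + P anyway.\<close>
    case 2
    obtain S' where S': "S' \<in> C" "span (A \<union> B \<union> S') = V"
      and S'_least: "\<And>S. S \<in> C \<Longrightarrow> span (A \<union> B \<union> S) = V \<Longrightarrow> S' \<subseteq> S"
    proof (rule chain_least[OF C, of "\<lambda>S. span (A \<union> B \<union> S) = V"])
      have "A \<union> B \<union> V = V" using A(2) B(2) by blast
      then show "span (A \<union> B \<union> V) = V" using V(1) span_eq_iff by metis
    qed blast
    obtain P where P: "P \<in> C" "span (A \<union> B \<union> P) \<noteq> V"
      and P_greatest: "\<And>S. S \<in> C \<Longrightarrow> span (A \<union> B \<union> S) \<noteq> V \<Longrightarrow> S \<subseteq> P"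
    proof (rule chain_greatest[OF C, of "\<lambda>S. span (A \<union> B \<union> S) \<noteq> V"])
      have "A \<union> B \<union> {0} = A \<union> B" using subspace_0[OF A(1)] by blast
      then show "span (A \<union> B \<union> {0}) \<noteq> V" using 2 by metis
    qed blast
    let ?P = "span (A \<union> B \<union> P)"
    have PV: "?P \<subseteq> V" using A(2) B(2) sub(2)[of P] P(1) V(1) by (intro span_minimal) auto
    have ABP: "A \<union> B \<union> P \<subseteq> ?P" by (rule span_superset)
    have "\<not> S' \<subseteq> ?P"
    proof
      assume "S' \<subseteq> ?P"
      then have "span (A \<union> B \<union> S') \<subseteq> ?P" using ABP by (intro span_minimal) auto
      then show False using S'(2) P(2) PV by blast
    qed
    then obtain x where x: "x \<in> S'" "x \<notin> ?P" by blast
    have "\<exists>x. x \<noteq> 0 \<and> V = span {x}"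
    proof (rule line[of ?P x])
      show "x \<in> V" using x(1) S'(1) sub(2) by blast
      show "x \<in> S \<or> S \<subseteq> ?P" if "S \<in> insert A (insert B C)" for S
      proof (cases "S \<in> C")
        case True
        then show ?thesis using S'_least[of S] P_greatest[of S] x ABP by blast
      next
        case False
        then show ?thesis using that ABP by blast
      qed
    qed (use PV x in auto)
    then show ?thesis ..
  next
    case 3
    have sum: "\<exists>x\<in>A. \<exists>y\<in>B. v = x + y" if "v \<in> V" for v
    proof -
      have "span (A \<union> B) \<subseteq> {x + y | x y. x \<in> A \<and> y \<in> B}"
        using subspace_0[OF A(1)] subspace_0[OF B(1)] subspace_set_sum[OF A(1) B(1)]
        by (intro span_minimal) force+
      then show ?thesis using that 3(2) by blast
    qed
    obtain S\<^sub>1 where S\<^sub>1: "S\<^sub>1 \<in> C" "S\<^sub>1 \<noteq> {0}"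
      and S\<^sub>1_least: "\<And>S. S \<in> C \<Longrightarrow> S \<noteq> {0} \<Longrightarrow> S\<^sub>1 \<subseteq> S"
      using chain_least[OF C, of "\<lambda>S. S \<noteq> {0}"] V(2) by metis
    show ?thesis
    proof (cases "S\<^sub>1 \<inter> A = {0} \<and> S\<^sub>1 \<inter> B = {0}")
      case False
      then obtain x where x: "x \<noteq> 0" "x \<in> S\<^sub>1" "x \<in> A \<or> x \<in> B"
        using sub(1)[THEN subspace_0] S\<^sub>1(1) by blast
      have *: "x \<in> S \<or> S \<subseteq> P" if "S \<in> C" "subspace P" for S P
        using S\<^sub>1_least[of S] that x(2) subspace_0[of P] by blast
      \<comment> \<open>Every nonzero chain member contains x, so whichever of A and B misses x can
        serve as the subspace P.\<close>
      have "\<exists>x. x \<noteq> 0 \<and> V = span {x}"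
      proof (cases "x \<in> A")
        case True
        then have "x \<notin> B" using 3(1) x(1) by blast
        show ?thesis
        proof (rule line[of B x])
          show "x \<in> S \<or> S \<subseteq> B" if "S \<in> insert A (insert B C)" for S
            using that *[of S B] B(1) True by blast
        qed (use A B True \<open>x \<notin> B\<close> in auto)
      next
        case False
        then have "x \<in> B" using x(3) by blast
        show ?thesis
        proof (rule line[of A x])
          show "x \<in> S \<or> S \<subseteq> A" if "S \<in> insert A (insert B C)" for S
            using that *[of S A] A(1) \<open>x \<in> B\<close> by blast
        qed (use A B False \<open>x \<in> B\<close> in auto)
      qed
      then show ?thesis ..
    next
      case True
      obtain v where v: "v \<in> S\<^sub>1" "v \<noteq> 0"
        using S\<^sub>1(2) subspace_0[OF sub(1)[of S\<^sub>1]] S\<^sub>1(1) by blast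
      have "v \<in> V" using v(1) S\<^sub>1(1) sub(2)[of S\<^sub>1] by blast
      obtain a b where ab: "a \<in> A" "b \<in> B" "v = a + b"
        using sum[OF \<open>v \<in> V\<close>] by blast
      have noA: "y = 0" if "y \<in> S\<^sub>1" "y \<in> A" for y using True that by blast
      have noB: "y = 0" if "y \<in> S\<^sub>1" "y \<in> B" for y using True that by blast
      have "a \<noteq> 0"
      proof
        assume "a = 0"
        then have "v = b" using ab(3) by simp
        then show False using noB v ab(2) by simp
      qed
      have "b \<noteq> 0"
      proof
        assume "b = 0"
        then have "v = a" using ab(3) by simp
        then show False using noA v ab(1) by simp
      qed
      have a: "a \<noteq> 0" "a \<notin> S\<^sub>1" and b: "b \<noteq> 0"
        using \<open>a \<noteq> 0\<close> \<open>b \<noteq> 0\<close> noA ab(1) by blast+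
      \<comment> \<open>P is the last chain member without a. It contains v = a + b, so a hyperplane
        through P and off a also avoids b.\<close>
      obtain P where P: "P \<in> C" "a \<notin> P" "\<And>S. S \<in> C \<Longrightarrow> a \<notin> S \<Longrightarrow> S \<subseteq> P"
        using chain_cut[OF C a(1)] by metis
      have vP: "v \<in> P" using P(3)[OF S\<^sub>1(1) a(2)] v(1) by blast
      have sP: "subspace P" "P \<subseteq> V" using sub P(1) by auto
      have aV: "a \<in> V" and bV: "b \<in> V" and vV: "v \<in> V" using ab A B vP sP by auto
      obtain H where H: "splits V (span {a}) H" "P \<subseteq> H" "a \<notin> H"
        using ex_hyperplane[OF V(1) sP aV P(2)] by metis
      have sH: "subspace H" "H \<subseteq> V" using splitsD[OF H(1)] by auto
      have vH: "v \<in> H" using vP H(2) by blast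
      have bva: "b = v - a" "a = v - b" using ab(3) by auto
      have bH: "b \<notin> H" using bva(2) H(3) subspace_diff[OF sH(1) vH] by metis
      have scale_notin: "t = 0" if "t *s x \<in> H" "x \<notin> H" for t x
      proof (rule ccontr)
        assume "t \<noteq> 0"
        then have "x = inverse t *s (t *s x)" by simp
        then show False using that subspace_scale[OF sH(1)] by metis
      qed
      \<comment> \<open>H cuts A and B in complements of the lines of a and b; the sum of these is a
        complement of the plane.\<close>
      let ?X = "span {a, b}" and ?Y = "{x + y | x y. x \<in> A \<inter> H \<and> y \<in> B \<inter> H}"
      have sY: "subspace ?Y" using A B sH by (intro subspace_set_sum subspace_inter)
      have YH: "?Y \<subseteq> H" using sH by (auto intro: subspace_add)
      have AY: "A \<inter> H \<subseteq> ?Y" and BY: "B \<inter> H \<subseteq> ?Y"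
        using subspace_0[OF A(1)] subspace_0[OF B(1)] subspace_0[OF sH(1)] by force+
      have noAB: "u = 0 \<and> w = 0" if "u = w" "u \<in> A" "w \<in> B" for u w
        using that 3(1) by blast
      have decH: "\<exists>s. \<exists>h\<in>H. w = s *s a + h" if "w \<in> V" for w
        using splitsD(7)[OF H(1) that] unfolding Bex_def in_span_single by blast
      have decA: "\<exists>s. \<exists>h\<in>A \<inter> H. \<alpha> = s *s a + h" if \<alpha>: "\<alpha> \<in> A" for \<alpha>
      proof -
        obtain s h where sh: "h \<in> H" "\<alpha> = s *s a + h"
          using decH[of \<alpha>] \<alpha> A(2) by blast
        have "\<alpha> - s *s a \<in> A" using \<alpha> ab A(1) by (intro subspace_diff subspace_scale) auto
        then have "h \<in> A" using sh(2) by simp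
        then show ?thesis using sh by blast
      qed
      have decB: "\<exists>s. \<exists>h\<in>B \<inter> H. \<beta> = s *s b + h" if \<beta>: "\<beta> \<in> B" for \<beta>
      proof -
        obtain s h where sh: "h \<in> H" "\<beta> = s *s a + h"
          using decH[of \<beta>] \<beta> B(2) by blast
        \<comment> \<open>Substitute a = v - b; the multiple of v is absorbed by H.\<close>
        have eq: "\<beta> = (- s) *s b + (h + s *s v)"
          using sh(2) by (simp add: ab(3) scale_right_distrib)
        have "\<beta> - (- s) *s b \<in> B" using \<beta> ab B(1) by (intro subspace_diff subspace_scale) auto
        then have "h + s *s v \<in> B" using eq by (metis add_diff_cancel_left')
        moreover have "h + s *s v \<in> H" using sh vH sH by (intro subspace_add subspace_scale) auto
        ultimately show ?thesis using eq by blast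
      qed
      have split: "splits V ?X ?Y"
      proof (rule splitsI)
        show "?X \<subseteq> V" using aV bV V(1) by (intro span_minimal) auto
        show "?Y \<subseteq> V" using YH sH by blast
        show "x = 0" if x: "x \<in> ?X" "x \<in> ?Y" for x
        proof -
          obtain s t where "x = s *s a + t *s b" using x(1) unfolding in_span_pair by blast
          moreover obtain \<alpha> \<beta> where "x = \<alpha> + \<beta>" "\<alpha> \<in> A \<inter> H" "\<beta> \<in> B \<inter> H" using x(2) by blast
          ultimately have *: "x = s *s a + t *s b" "x = \<alpha> + \<beta>" "\<alpha> \<in> A \<inter> H" "\<beta> \<in> B \<inter> H"
            by blast+
          have "s *s a - \<alpha> = \<beta> - t *s b" using *(1,2) by (simp add: algebra_simps)
          moreover have "s *s a - \<alpha> \<in> A" "\<beta> - t *s b \<in> B"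
            using * ab A B by (auto intro!: subspace_diff subspace_scale)
          ultimately have "s *s a - \<alpha> = 0 \<and> \<beta> - t *s b = 0" by (rule noAB)
          then have "s *s a \<in> H" "t *s b \<in> H" using *(3,4) by auto
          then have "s = 0" "t = 0" using scale_notin H(3) bH by auto
          then show ?thesis using *(1) by simp
        qed
        show "\<exists>x\<in>?X. \<exists>y\<in>?Y. w = x + y" if w: "w \<in> V" for w
        proof -
          obtain \<alpha> \<beta> where *: "\<alpha> \<in> A" "\<beta> \<in> B" "w = \<alpha> + \<beta>" using sum[OF w] by blast
          obtain s h where "h \<in> A \<inter> H" "\<alpha> = s *s a + h" using decA[OF *(1)] by blast
          moreover obtain t k where "k \<in> B \<inter> H" "\<beta> = t *s b + k" using decB[OF *(2)] by blast
          moreover from calculation have "w = (s *s a + t *s b) + (h + k)" using * by simp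
          moreover have "s *s a + t *s b \<in> ?X" by (auto simp: in_span_pair)
          ultimately show ?thesis by blast
        qed
      qed (use V(1) sY in auto)
      \<comment> \<open>Elements of P and the summand \<open>?Y\<close> lie in H, and the plane
        meets H only in the line of v.\<close>
      have decP: "\<exists>t. \<exists>y\<in>?Y. p = t *s v + y" if p: "p \<in> P" for p
      proof -
        obtain x y where xy: "x \<in> ?X" "y \<in> ?Y" "p = x + y"
          using splitsD(7)[OF split] p sP(2) by blast
        obtain s t where st: "x = s *s a + t *s b" using xy(1) by (auto simp: in_span_pair)
        have "p - y - t *s v \<in> H"
          using p H(2) xy(2) YH vH sH(1) by (intro subspace_diff subspace_scale) auto
        moreover have "p - y - t *s v = (s - t) *s a"
          using xy(3) st by (simp add: ab(3) algebra_simps)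
        ultimately have "s - t = 0" using scale_notin H(3) by metis
        then have "p = t *s v + y" using xy(3) st by (simp add: ab(3) algebra_simps)
        then show ?thesis using xy(2) by blast
      qed
      have "compat ?X ?Y S" if S: "S \<in> insert A (insert B C)" for S
      proof -
        have sS: "subspace S" "S \<subseteq> V" using sub[OF S] by auto
        consider "S = A" | "S = B" | "S \<in> C" "a \<in> S" | "S \<in> C" "a \<notin> S" using S by blast
        then show ?thesis
        proof cases
          case 1
          show ?thesis
            unfolding compat_def 1
          proof
            fix p assume "p \<in> A"
            then obtain s h where sh: "h \<in> A \<inter> H" "p = s *s a + h" using decA by blast
            have "s *s a \<in> ?X" by (intro span_scale span_base) simp
            moreover have "s *s a \<in> A" using ab A by (intro subspace_scale) auto
            ultimately show "\<exists>x\<in>A \<inter> ?X. \<exists>y\<in>A \<inter> ?Y. p = x + y" using sh AY by blast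
          qed
        next
          case 2
          show ?thesis
            unfolding compat_def 2
          proof
            fix p assume "p \<in> B"
            then obtain s h where sh: "h \<in> B \<inter> H" "p = s *s b + h" using decB by blast
            have "s *s b \<in> ?X" by (intro span_scale span_base) simp
            moreover have "s *s b \<in> B" using ab B by (intro subspace_scale) auto
            ultimately show "\<exists>x\<in>B \<inter> ?X. \<exists>y\<in>B \<inter> ?Y. p = x + y" using sh BY by blast
          qed
        next
          \<comment> \<open>Such an S contains the least nonzero member, hence v, hence b and the
            whole plane.\<close>
          case c: 3
          have "S\<^sub>1 \<subseteq> S" using S\<^sub>1_least[OF c(1)] c(2) a(1) by blast
          then have "v - a \<in> S" using c(2) v(1) sS(1) by (intro subspace_diff) auto
          then have "b \<in> S" using bva(1) by simp
          then have "?X \<subseteq> S" using c sS by (intro span_minimal) auto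
          then show ?thesis using compat_left[OF split sS] by blast
        next
          \<comment> \<open>Here S \<subseteq> P, so the plane part of each element is a multiple of
            v, which lies in S unless S is zero.\<close>
          case c: 4
          show ?thesis
          proof (cases "S = {0}")
            case True
            then show ?thesis using compat_zero[OF split] by simp
          next
            case False
            then have "v \<in> S" using S\<^sub>1_least[OF c(1)] v(1) by blast
            show ?thesis
              unfolding compat_def
            proof
              fix p assume p: "p \<in> S"
              then obtain t y where ty: "y \<in> ?Y" "p = t *s v + y" using decP P(3)[OF c] by blast
              have tv: "t *s v \<in> S" using \<open>v \<in> S\<close> sS(1) by (rule subspace_scale[rotated])
              have "p - t *s v \<in> S" using p tv sS(1) by (intro subspace_diff)
              then have "y \<in> S" using ty(2) by simp
              moreover have "t *s v \<in> ?X"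
                unfolding ab(3) by (intro span_scale span_add span_base) auto
              ultimately show "\<exists>x\<in>S \<inter> ?X. \<exists>y\<in>S \<inter> ?Y. p = x + y" using ty tv by blast
            qed
          qed
        qed
      qed
      then have "?X = {0} \<or> ?Y = {0}" using no[OF split] by blast
      moreover have "?X \<noteq> {0}" using span_base[of a "{a, b}"] a(1) by auto
      ultimately have Y: "?Y = {0}" by blast
      have "A = span {a}"
      proof
        show "A \<subseteq> span {a}" using decA AY Y by (fastforce simp: in_span_single)
        show "span {a} \<subseteq> A" using ab A by (intro span_minimal) auto
      qed
      moreover have "B = span {b}"
      proof
        show "B \<subseteq> span {b}" using decB BY Y by (fastforce simp: in_span_single)
        show "span {b} \<subseteq> B" using ab B by (intro span_minimal) auto
      qed
      moreover have "P = span {a + b}"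
      proof
        show "P \<subseteq> span {a + b}"
        proof
          fix p assume "p \<in> P"
          from decP[OF this, unfolded Y] show "p \<in> span {a + b}"
            by (simp add: in_span_single ab(3))
        qed
        show "span {a + b} \<subseteq> P" using vP sP ab(3) by (intro span_minimal) auto
      qed
      moreover have "frame V a b"
        unfolding frame_def
      proof (intro conjI allI impI)
        have "V \<subseteq> ?X"
        proof
          fix w assume "w \<in> V"
          from splitsD(7)[OF split this, unfolded Y] show "w \<in> ?X" by simp
        qed
        then show "V = ?X" using splitsD(4)[OF split] by blast
        fix s t assume "s *s a + t *s b = 0"
        then have "s *s a = (- t) *s b" by (simp add: eq_neg_iff_add_eq_0)
        moreover have "s *s a \<in> A" "(- t) *s b \<in> B"
          by (rule subspace_scale, fact A B, fact ab)+
        ultimately have "s *s a = 0 \<and> (- t) *s b = 0" by (rule noAB)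
        then show "s *s a = 0" "t *s b = 0" by auto
      qed
      ultimately show ?thesis using a(1) b P(1) by blast
    qed
  qed
qed

section \<open>Bases along an arm\<close>

text \<open>
  The space \<open>V\<close> lies one step further from the root than \<open>W\<close>, and the flag \<open>d\<close> says that the arrow
  points from \<open>V\<close> to \<open>W\<close>.
\<close>

definition edge :: "bool \<Rightarrow> ('b \<Rightarrow> 'b) \<Rightarrow> 'b set \<Rightarrow> 'b set \<Rightarrow> bool" where
  "edge d f V W \<longleftrightarrow> subspace V \<and> subspace W \<and>
     (if d then linear_between scale V scale W f else linear_between scale W scale V f)"

text \<open>The graph of f for an arrow towards the root and the converse graph otherwise, so that
  the outer space comes first in both cases.\<close>

definition edge_rel :: "bool \<Rightarrow> ('b \<Rightarrow> 'b) \<Rightarrow> 'b set \<Rightarrow> 'b set \<Rightarrow> ('b \<times> 'b) set" where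
  "edge_rel d f V W = (if d then {(x, f x) | x. x \<in> V} else {(f y, y) | y. y \<in> W})"

definition edge_stable :: "bool \<Rightarrow> ('b \<Rightarrow> 'b) \<Rightarrow> 'b set \<Rightarrow> 'b set \<Rightarrow> bool" where
  "edge_stable d f U U' \<longleftrightarrow> (if d then f ` U \<subseteq> U' else f ` U' \<subseteq> U)"

text \<open>A zero vector stands for a missing tree vertex. As a source it imposes no condition; as
  a target it says that f kills the vector at the source.\<close>

definition edge_ok :: "bool \<Rightarrow> ('b \<Rightarrow> 'b) \<Rightarrow> 'b \<Rightarrow> 'b \<Rightarrow> bool" where
  "edge_ok d f x y \<longleftrightarrow> (if d then x \<noteq> 0 \<longrightarrow> f x = y else y \<noteq> 0 \<longrightarrow> f y = x)"

lemma linear_betweenD: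
  assumes "linear_between scale V scale W f" "subspace V"
  shows "x \<in> V \<Longrightarrow> f x \<in> W" "x \<in> V \<Longrightarrow> y \<in> V \<Longrightarrow> f (x + y) = f x + f y"
    "x \<in> V \<Longrightarrow> f (c *s x) = c *s f x" "f 0 = 0"
proof -
  show *: "x \<in> V \<Longrightarrow> f x \<in> W" "x \<in> V \<Longrightarrow> y \<in> V \<Longrightarrow> f (x + y) = f x + f y"
    "x \<in> V \<Longrightarrow> f (c *s x) = c *s f x" for x y c
    using assms(1) by (auto simp: linear_between_def)
  show "f 0 = 0"
    using *(3)[OF subspace_0[OF assms(2)], of 0] by simp
qed

lemma edge_zero:
  assumes "edge d f V W"
  shows "f 0 = 0"
  using assms linear_betweenD(4) unfolding edge_def by (metis (full_types))

lemma linear_relation_edge_rel: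
  assumes "edge d f V W"
  shows "linear_relation V W (edge_rel d f V W)"
proof -
  have sub: "subspace V" "subspace W" using assms by (auto simp: edge_def)
  have *: "linear_relation V W {(x, f x) | x. x \<in> V}"
    if "linear_between scale V scale W f" "subspace V" "subspace W" for V W
  proof -
    note l = linear_betweenD[OF that(1,2)]
    have "\<exists>z. x + y = z \<and> f x + f y = f z \<and> z \<in> V" if "x \<in> V" "y \<in> V" for x y
      using that l(2) subspace_add[OF \<open>subspace V\<close>] by metis
    moreover have "\<exists>z. c *s x = z \<and> c *s f x = f z \<and> z \<in> V" if "x \<in> V" for c x
      using that l(3) subspace_scale[OF \<open>subspace V\<close>] by metis
    ultimately show ?thesis
      unfolding linear_relation_def using that(2,3) subspace_0[OF that(2)] l(1,4) by auto
  qed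
  show ?thesis
  proof (cases d)
    case True
    then show ?thesis using *[of V W] assms by (simp add: edge_def edge_rel_def)
  next
    case False
    then have "linear_relation W V {(x, f x) | x. x \<in> W}"
      using *[of W V] assms by (simp add: edge_def)
    moreover have "{(x, f x) | x. x \<in> W}\<inverse> = edge_rel d f V W"
      using False by (auto simp: edge_rel_def)
    ultimately show ?thesis using linear_relation_converse by fastforce
  qed
qed

lemma edge_stable_pullback:
  assumes "edge d f V W" "U' \<subseteq> W"
  shows "edge_stable d f ((edge_rel d f V W)\<inverse> `` U') U'"
  using assms by (auto simp: edge_stable_def edge_rel_def)

lemma presents_edge_rel_iff:
  assumes "edge d f V W"
  shows "presents V (edge_rel d f V W) \<longleftrightarrow> (if d then \<forall>x\<in>V. f x = 0 \<longrightarrow> x = 0 else V \<subseteq> f ` W)"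
proof (cases d)
  case True
  then have l: "linear_between scale V scale W f" "subspace V" using assms by (auto simp: edge_def)
  note l' = linear_betweenD[OF l]
  have "x = y" if 0: "\<forall>x\<in>V. f x = 0 \<longrightarrow> x = 0" and xy: "x \<in> V" "y \<in> V" "f x = f y" for x y
  proof -
    have "f (x + (-1) *s y) = f x + (-1) *s f y"
      using l'(2,3) xy subspace_scale[OF l(2)] by metis
    then have "f (x + (-1) *s y) = 0" using xy(3) by simp
    moreover have "x + (-1) *s y \<in> V"
      using xy(1,2) l(2) by (intro subspace_add subspace_scale)
    ultimately have "x + (-1) *s y = 0" using 0 by blast
    then show ?thesis by simp
  qed
  note inj = this
  have rel: "(u, y) \<in> edge_rel d f V W \<longleftrightarrow> u \<in> V \<and> y = f u" for u y
    using True by (auto simp: edge_rel_def)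
  have "presents V (edge_rel d f V W) \<longleftrightarrow> (\<forall>x\<in>V. \<forall>y\<in>V. f x = f y \<longrightarrow> x = y)"
    unfolding presents_def rel Domain_iff subset_iff by metis
  also have "\<dots> \<longleftrightarrow> (\<forall>x\<in>V. f x = 0 \<longrightarrow> x = 0)"
    using inj l'(4) subspace_0[OF l(2)] by metis
  finally show ?thesis using True by simp
next
  case False
  then have "Domain (edge_rel d f V W) = f ` W"
    by (auto simp: edge_rel_def)
  then show ?thesis using False by (auto simp: presents_def edge_rel_def)
qed

section \<open>Adapted generators, for one step and for a whole arm\<close>

text \<open>An inward arrow is injective into \<open>span {y}\<close>, an outward one maps
  \<open>span {y}\<close> onto V; so V is a line or zero. The value x = 0 records that the row ends
  here, and the last conjunct keeps the support of the row connected to the root.\<close>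

lemma thin_step:
  assumes e: "edge d f V W" and p: "presents V (edge_rel d f V W)" and W: "W = span {y}"
  shows "\<exists>x. V = span {x} \<and> edge_ok d f x y \<and> (x \<noteq> 0 \<longrightarrow> y \<noteq> 0)"
proof (cases d)
  case True
  then have l: "linear_between scale V scale W f" "subspace V" using e by (auto simp: edge_def)
  note l' = linear_betweenD[OF l]
  have inj: "x = x'" if "x \<in> V" "x' \<in> V" "f x = f x'" for x x'
    using presentsD(2)[OF p, of x "f x" x'] that True by (simp add: edge_rel_def)
  show ?thesis
  proof (cases "V = {0}")
    case True
    then show ?thesis using \<open>d\<close> by (intro exI[of _ 0]) (simp add: edge_ok_def)
  next
    case False
    then obtain x\<^sub>0 where x\<^sub>0: "x\<^sub>0 \<in> V" "x\<^sub>0 \<noteq> 0" using subspace_0[OF l(2)] by blast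
    obtain c where c: "f x\<^sub>0 = c *s y" using l'(1)[OF x\<^sub>0(1)] W by (auto simp: in_span_single)
    have "f x\<^sub>0 \<noteq> 0" using inj[OF x\<^sub>0(1) subspace_0[OF l(2)]] x\<^sub>0(2) l'(4) by auto
    then have "c \<noteq> 0" "y \<noteq> 0" using c by auto
    \<comment> \<open>Rescaled so that f x is y itself: the arrows of a tree module carry
      coefficient 1.\<close>
    define x where "x = inverse c *s x\<^sub>0"
    have x: "x \<in> V" "f x = y"
      using x\<^sub>0(1) c \<open>c \<noteq> 0\<close> l'(3) subspace_scale[OF l(2)] by (auto simp: x_def)
    have "v \<in> span {x}" if v: "v \<in> V" for v
    proof -
      obtain t where "f v = t *s y" using l'(1)[OF v] W by (auto simp: in_span_single)
      then have "f v = f (t *s x)" using l'(3)[OF x(1)] x(2) by simp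
      then have "v = t *s x" using inj v x(1) subspace_scale[OF l(2)] by metis
      then show ?thesis by (auto simp: in_span_single)
    qed
    then have "V = span {x}" using span_minimal[of "{x}" V] x(1) l(2) by blast
    then show ?thesis using x(2) \<open>y \<noteq> 0\<close> \<open>d\<close> by (auto simp: edge_ok_def)
  qed
next
  case False
  then have l: "linear_between scale W scale V f" "subspace W" using e by (auto simp: edge_def)
  note l' = linear_betweenD[OF l]
  have yW: "y \<in> W" using W span_base by blast
  have "V \<subseteq> f ` W" using p False presents_edge_rel_iff[OF e] by simp
  then have "V = f ` W" using l'(1) by blast
  also have "\<dots> = span {f y}"
    using l'(3)[OF yW] W by (auto simp: span_singleton image_image)
  finally have "V = span {f y}" .
  then show ?thesis using False l'(4) by (intro exI[of _ "f y"]) (auto simp: edge_ok_def)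
qed

lemma scaled_in_span_eq_zero:
  assumes "t *s x \<in> span {y}" "x \<notin> span {y}"
  shows "t = 0"
proof (rule ccontr)
  assume "t \<noteq> 0"
  then have "x = inverse t *s (t *s x)" by simp
  then show False using assms span_scale by metis
qed

lemma frameD:
  assumes "frame V a b"
  shows "V = span {a, b}" "s *s a + t *s b = 0 \<Longrightarrow> s *s a = 0" "s *s a + t *s b = 0 \<Longrightarrow> t *s b = 0"
    "a \<in> V" "b \<in> V" "subspace V" "v \<in> V \<Longrightarrow> \<exists>s t. v = s *s a + t *s b"
    "b \<noteq> 0 \<Longrightarrow> b \<notin> span {a}" "a \<noteq> 0 \<Longrightarrow> a \<notin> span {b}"
proof -
  show *: "V = span {a, b}" "s *s a + t *s b = 0 \<Longrightarrow> s *s a = 0" "s *s a + t *s b = 0 \<Longrightarrow> t *s b = 0" for s t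
    using assms by (auto simp: frame_def)
  show "a \<in> V" "b \<in> V" "subspace V" unfolding *(1) by (auto intro: span_base)
  show "v \<in> V \<Longrightarrow> \<exists>s t. v = s *s a + t *s b" unfolding *(1) in_span_pair .
  show "b \<notin> span {a}" if "b \<noteq> 0"
  proof
    assume "b \<in> span {a}"
    then obtain s where "b = s *s a" by (auto simp: in_span_single)
    then have eq: "(- s) *s a + 1 *s b = 0" by simp
    show False using *(3)[OF eq] that by simp
  qed
  show "a \<notin> span {b}" if "a \<noteq> 0"
  proof
    assume "a \<in> span {b}"
    then obtain s where "a = s *s b" by (auto simp: in_span_single)
    then have eq: "1 *s a + (- s) *s b = 0" by simp
    show False using *(2)[OF eq] that by simp
  qed
qed

text \<open>Membership of the line of \<open>e\<^sub>1\<close> in the image chain keeps the rows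
  apart. For an inward arrow it puts \<open>e\<^sub>1\<close> into the image of f, so V is a line
  over \<open>e\<^sub>1\<close> or a plane over both vectors. For an outward arrow it confines the
  kernel to the line of \<open>e\<^sub>1\<close>, so that this row may end while the row of
  \<open>e\<^sub>2\<close> goes on.\<close>

lemma thick_step:
  assumes e: "edge d f V W" and p: "presents V (edge_rel d f V W)"
    and fr: "frame W e\<^sub>1 e\<^sub>2" and nz: "e\<^sub>1 \<noteq> 0" "e\<^sub>2 \<noteq> 0" and C: "subspace_chain V C"
    and mem: "span {e\<^sub>1} \<in> (\<lambda>S. edge_rel d f V W `` S) ` C"
  shows "(\<exists>x\<^sub>1 x\<^sub>2. frame V x\<^sub>1 x\<^sub>2 \<and> x\<^sub>1 \<noteq> 0 \<and> x\<^sub>2 \<noteq> 0 \<and> edge_ok d f x\<^sub>1 e\<^sub>1 \<and> edge_ok d f x\<^sub>2 e\<^sub>2 \<and>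
             span {x\<^sub>1} \<in> C) \<or>
         (\<exists>x. V = span {x} \<and>
           (edge_ok d f x e\<^sub>1 \<and> edge_ok d f 0 e\<^sub>2 \<or> edge_ok d f 0 e\<^sub>1 \<and> edge_ok d f x e\<^sub>2))"
proof -
  note fr' = frameD[OF fr]
  obtain S where S: "S \<in> C" "span {e\<^sub>1} = edge_rel d f V W `` S" using mem by blast
  have sS: "subspace S" "S \<subseteq> V" using S(1) C by (auto simp: subspace_chain_def)
  have e\<^sub>1S: "e\<^sub>1 \<in> edge_rel d f V W `` S" unfolding S(2)[symmetric] by (rule span_base) simp
  show ?thesis
  proof (cases d)
    case True
    then have l: "linear_between scale V scale W f" "subspace V" using e by (auto simp: edge_def)
    note l' = linear_betweenD[OF l]
    have inj: "x = x'" if "x \<in> V" "x' \<in> V" "f x = f x'" for x x'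
      using presentsD(2)[OF p, of x "f x" x'] that True by (simp add: edge_rel_def)
    obtain x\<^sub>1 where x\<^sub>1: "x\<^sub>1 \<in> S" "f x\<^sub>1 = e\<^sub>1" "x\<^sub>1 \<in> V"
      using e\<^sub>1S True sS(2) by (auto simp: edge_rel_def)
    have lin: "f (s *s x + t *s y) = s *s f x + t *s f y" if "x \<in> V" "y \<in> V" for s t x y
      using l'(2,3) that subspace_scale[OF l(2)] by metis
    have S_span: "S = span {x\<^sub>1}"
    proof
      show "span {x\<^sub>1} \<subseteq> S" using x\<^sub>1(1) sS(1) by (intro span_minimal) auto
      show "S \<subseteq> span {x\<^sub>1}"
      proof
        fix x assume x: "x \<in> S"
        then have "f x \<in> span {e\<^sub>1}" unfolding S(2) using True sS(2) by (auto simp: edge_rel_def)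
        then obtain s where "f x = s *s e\<^sub>1" by (auto simp: in_span_single)
        then have "f x = f (s *s x\<^sub>1)" using l'(3) x\<^sub>1 by simp
        then have "x = s *s x\<^sub>1" using inj x sS(2) subspace_scale[OF l(2) x\<^sub>1(3)] by blast
        then show "x \<in> span {x\<^sub>1}" by (auto simp: in_span_single)
      qed
    qed
    show ?thesis
    proof (cases "e\<^sub>2 \<in> f ` V")
      case e2: True
      then obtain x\<^sub>2 where x\<^sub>2: "x\<^sub>2 \<in> V" "f x\<^sub>2 = e\<^sub>2" by blast
      have "v \<in> span {x\<^sub>1, x\<^sub>2}" if v: "v \<in> V" for v
      proof -
        obtain s t where "f v = s *s e\<^sub>1 + t *s e\<^sub>2" using fr'(7)[OF l'(1)[OF v]] by blast
        then have "f v = f (s *s x\<^sub>1 + t *s x\<^sub>2)" using lin x\<^sub>1 x\<^sub>2 by simp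
        moreover have "s *s x\<^sub>1 + t *s x\<^sub>2 \<in> V"
          using x\<^sub>1 x\<^sub>2 l(2) by (intro subspace_add subspace_scale)
        ultimately have "v = s *s x\<^sub>1 + t *s x\<^sub>2" using inj v by blast
        then show ?thesis by (auto simp: in_span_pair)
      qed
      moreover have "span {x\<^sub>1, x\<^sub>2} \<subseteq> V" using x\<^sub>1 x\<^sub>2 l(2) by (intro span_minimal) auto
      ultimately have V: "V = span {x\<^sub>1, x\<^sub>2}" by blast
      have "s = 0 \<and> t = 0" if "s *s x\<^sub>1 + t *s x\<^sub>2 = 0" for s t
      proof -
        have "s *s e\<^sub>1 + t *s e\<^sub>2 = 0" using lin[OF x\<^sub>1(3) x\<^sub>2(1), of s t] that x\<^sub>1 x\<^sub>2 l'(4) by simp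
        then show ?thesis using fr'(2,3)[of s t] nz by simp
      qed
      then have "frame V x\<^sub>1 x\<^sub>2" using V by (auto simp: frame_def)
      moreover have "x\<^sub>1 \<noteq> 0" "x\<^sub>2 \<noteq> 0" using x\<^sub>1(2) x\<^sub>2(2) nz l'(4) by auto
      moreover have "edge_ok d f x\<^sub>1 e\<^sub>1" "edge_ok d f x\<^sub>2 e\<^sub>2"
        using x\<^sub>1 x\<^sub>2 True by (auto simp: edge_ok_def)
      ultimately show ?thesis using S_span S(1) by metis
    next
      case e2: False
      have "v \<in> span {x\<^sub>1}" if v: "v \<in> V" for v
      proof -
        obtain s t where st: "f v = s *s e\<^sub>1 + t *s e\<^sub>2" using fr'(7)[OF l'(1)[OF v]] by blast
        \<comment> \<open>A nonzero t would put \<open>e\<^sub>2\<close> into the image of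
          f.\<close>
        have "t = 0"
        proof (rule ccontr)
          assume t: "t \<noteq> 0"
          have "f (inverse t *s v + (- inverse t * s) *s x\<^sub>1) = inverse t *s f v + (- inverse t * s) *s e\<^sub>1"
            using lin[OF v x\<^sub>1(3), of "inverse t" "- inverse t * s"] x\<^sub>1(2) by simp
          also have "\<dots> = e\<^sub>2" using t unfolding st by (simp add: scale_right_distrib)
          finally show False
            using e2 v x\<^sub>1(3) subspace_add[OF l(2)] subspace_scale[OF l(2)] by (metis image_eqI)
        qed
        then have "f v = f (s *s x\<^sub>1)" using st l'(3) x\<^sub>1 by simp
        then have "v = s *s x\<^sub>1" using inj v subspace_scale[OF l(2) x\<^sub>1(3)] by blast
        then show ?thesis by (auto simp: in_span_single)
      qed
      then have "V = span {x\<^sub>1}" using span_minimal[of "{x\<^sub>1}" V] x\<^sub>1(3) l(2) by blast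
      then show ?thesis using True x\<^sub>1(2) by (auto simp: edge_ok_def)
    qed
  next
    case False
    then have l: "linear_between scale W scale V f" "subspace W" using e by (auto simp: edge_def)
    note l' = linear_betweenD[OF l]
    have lin: "f (s *s e\<^sub>1 + t *s e\<^sub>2) = s *s f e\<^sub>1 + t *s f e\<^sub>2" for s t
      using l'(2,3) fr'(4,5) subspace_scale[OF l(2)] by metis
    \<comment> \<open>For an outward arrow the image of S under the relation is the preimage of S
      under f.\<close>
    have mem_span: "y \<in> span {e\<^sub>1} \<longleftrightarrow> y \<in> W \<and> f y \<in> S" for y
      unfolding S(2) using False by (auto simp: edge_rel_def)
    have fe\<^sub>1: "f e\<^sub>1 \<in> S" using mem_span[of e\<^sub>1] span_base[of e\<^sub>1 "{e\<^sub>1}"] by blast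
    have "f e\<^sub>2 \<notin> S" using mem_span[of e\<^sub>2] fr'(5) fr'(8)[OF nz(2)] by blast
    then have fe\<^sub>2: "f e\<^sub>2 \<noteq> 0" using subspace_0[OF sS(1)] by auto
    have "V \<subseteq> f ` W" using p False presents_edge_rel_iff[OF e] by simp
    then have V: "V = f ` W" using l'(1) by blast
    have V': "V = span {f e\<^sub>1, f e\<^sub>2}"
    proof
      show "V \<subseteq> span {f e\<^sub>1, f e\<^sub>2}"
      proof
        fix v assume "v \<in> V"
        then obtain w where w: "w \<in> W" "v = f w" using V by blast
        obtain s t where "w = s *s e\<^sub>1 + t *s e\<^sub>2" using fr'(7)[OF w(1)] by blast
        then show "v \<in> span {f e\<^sub>1, f e\<^sub>2}" using w(2) lin by (auto simp: in_span_pair)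
      qed
      show "span {f e\<^sub>1, f e\<^sub>2} \<subseteq> V"
        using l'(1) fr'(4,5) e by (intro span_minimal) (auto simp: edge_def)
    qed
    show ?thesis
    proof (cases "f e\<^sub>1 = 0")
      case True
      then have "V = span {f e\<^sub>2}" using V' by (simp add: span_insert_0)
      then show ?thesis using False True by (auto simp: edge_ok_def)
    next
      case e1: False
      have "s = 0 \<and> t = 0" if "s *s f e\<^sub>1 + t *s f e\<^sub>2 = 0" for s t
      proof -
        have "f (s *s e\<^sub>1 + t *s e\<^sub>2) = 0" using that lin by simp
        moreover have "s *s e\<^sub>1 + t *s e\<^sub>2 \<in> W"
          using fr'(4,5) l(2) by (intro subspace_add subspace_scale)
        ultimately have "s *s e\<^sub>1 + t *s e\<^sub>2 \<in> span {e\<^sub>1}"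
          using mem_span subspace_0[OF sS(1)] by simp
        moreover have "s *s e\<^sub>1 \<in> span {e\<^sub>1}" by (auto simp: in_span_single)
        ultimately have "t *s e\<^sub>2 \<in> span {e\<^sub>1}" using span_diff by (metis add_diff_cancel_left')
        then have "t = 0" using fr'(8)[OF nz(2)] by (rule scaled_in_span_eq_zero)
        then show ?thesis using that e1 by simp
      qed
      then have "frame V (f e\<^sub>1) (f e\<^sub>2)" using V' by (auto simp: frame_def)
      moreover have "S = span {f e\<^sub>1}"
      proof
        show "span {f e\<^sub>1} \<subseteq> S" using fe\<^sub>1 sS(1) by (intro span_minimal) auto
        show "S \<subseteq> span {f e\<^sub>1}"
        proof
          fix x assume x: "x \<in> S"
          then obtain y where y: "y \<in> W" "x = f y" using V sS(2) by blast
          then have "y \<in> span {e\<^sub>1}" using mem_span x by blast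
          then obtain s where "y = s *s e\<^sub>1" by (auto simp: in_span_single)
          then have "x = s *s f e\<^sub>1" using y(2) l'(3)[OF fr'(4)] by simp
          then show "x \<in> span {f e\<^sub>1}" by (auto simp: in_span_single)
        qed
      qed
      moreover have "edge_ok d f (f e\<^sub>1) e\<^sub>1" "edge_ok d f (f e\<^sub>2) e\<^sub>2"
        using False by (auto simp: edge_ok_def)
      ultimately show ?thesis using e1 fe\<^sub>2 S(1) by metis
    qed
  qed
qed

lemma thin_arm:
  assumes "\<And>j. j < k \<Longrightarrow> edge (d j) (f j) (V j) (V (Suc j))"
    and "\<And>j. j < k \<Longrightarrow> presents (V j) (edge_rel (d j) (f j) (V j) (V (Suc j)))"
    and "V k = span {x}"
  shows "\<exists>a. a k = x \<and> (\<forall>j\<le>k. V j = span {a j}) \<and>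
    (\<forall>j<k. edge_ok (d j) (f j) (a j) (a (Suc j)) \<and> (a j \<noteq> 0 \<longrightarrow> a (Suc j) \<noteq> 0))"
  using assms
proof (induction k arbitrary: x)
  case 0
  then show ?case by (intro exI[of _ "\<lambda>_. x"]) simp
next
  case (Suc k)
  obtain y where y: "V k = span {y}" "edge_ok (d k) (f k) y x" "y \<noteq> 0 \<longrightarrow> x \<noteq> 0"
    using thin_step[OF Suc.prems(1)[of k] Suc.prems(2)[of k] Suc.prems(3)] by auto
  have "\<exists>a. a k = y \<and> (\<forall>j\<le>k. V j = span {a j}) \<and>
    (\<forall>j<k. edge_ok (d j) (f j) (a j) (a (Suc j)) \<and> (a j \<noteq> 0 \<longrightarrow> a (Suc j) \<noteq> 0))"
    by (rule Suc.IH) (simp_all add: Suc.prems y(1))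
  then obtain a where a: "a k = y" "\<forall>j\<le>k. V j = span {a j}"
    "\<forall>j<k. edge_ok (d j) (f j) (a j) (a (Suc j)) \<and> (a j \<noteq> 0 \<longrightarrow> a (Suc j) \<noteq> 0)" by blast
  then show ?case
    using y Suc.prems(3)
    by (intro exI[of _ "a(Suc k := x)"]) (auto simp: le_Suc_eq less_Suc_eq)
qed

text \<open>Both rows are carried along while the space is a plane; once it is at most a line, one
  row is continued by zero and the other by \<open>thin_arm\<close>.\<close>

lemma thick_arm:
  assumes "\<And>j. j < k \<Longrightarrow> edge (d j) (f j) (V j) (V (Suc j))"
    and "\<And>j. j < k \<Longrightarrow> presents (V j) (edge_rel (d j) (f j) (V j) (V (Suc j)))"
    and "subspace (V 0)"
    and "frame (V k) e\<^sub>1 e\<^sub>2" "e\<^sub>1 \<noteq> 0" "e\<^sub>2 \<noteq> 0"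
    and "span {e\<^sub>1} \<in> arm_chain V (\<lambda>j. edge_rel (d j) (f j) (V j) (V (Suc j))) k"
  shows "\<exists>a b. a k = e\<^sub>1 \<and> b k = e\<^sub>2 \<and> (\<forall>j\<le>k. frame (V j) (a j) (b j)) \<and>
    (\<forall>j<k. edge_ok (d j) (f j) (a j) (a (Suc j)) \<and> (a j \<noteq> 0 \<longrightarrow> a (Suc j) \<noteq> 0) \<and>
           edge_ok (d j) (f j) (b j) (b (Suc j)) \<and> (b j \<noteq> 0 \<longrightarrow> b (Suc j) \<noteq> 0))"
  using assms
proof (induction k arbitrary: e\<^sub>1 e\<^sub>2)
  case 0
  \<comment> \<open>A void case: at the outer end the chain consists of {0} and the whole plane,
    neither of which is the line of \<open>e\<^sub>1\<close>.\<close>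
  have "span {e\<^sub>1} \<noteq> {0}" using "0"(5) by (simp add: span_single_eq_zero)
  then have "span {e\<^sub>1} = V 0" using "0"(7) by simp
  then show ?case using frameD(5)[OF "0"(4)] frameD(8)[OF "0"(4,6)] by simp
next
  case (Suc k)
  let ?R = "\<lambda>j. edge_rel (d j) (f j) (V j) (V (Suc j))"
  have ch: "subspace_chain (V k) (arm_chain V ?R k)"
    using Suc.prems(1,3) linear_relation_edge_rel by (intro subspace_chain_arm_chain) auto
  have "span {e\<^sub>1} \<noteq> {0}" using Suc.prems(5) by (simp add: span_single_eq_zero)
  moreover have "span {e\<^sub>1} \<noteq> V (Suc k)"
    using frameD(5)[OF Suc.prems(4)] frameD(8)[OF Suc.prems(4,6)] by auto
  ultimately have mem: "span {e\<^sub>1} \<in> (\<lambda>S. ?R k `` S) ` arm_chain V ?R k"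
    using Suc.prems(7) by simp
  consider
    x\<^sub>1 x\<^sub>2 where "frame (V k) x\<^sub>1 x\<^sub>2" "x\<^sub>1 \<noteq> 0" "x\<^sub>2 \<noteq> 0" "edge_ok (d k) (f k) x\<^sub>1 e\<^sub>1" "edge_ok (d k) (f k) x\<^sub>2 e\<^sub>2"
      "span {x\<^sub>1} \<in> arm_chain V ?R k"
  | x where "V k = span {x}" "edge_ok (d k) (f k) x e\<^sub>1" "edge_ok (d k) (f k) 0 e\<^sub>2"
  | x where "V k = span {x}" "edge_ok (d k) (f k) 0 e\<^sub>1" "edge_ok (d k) (f k) x e\<^sub>2"
    using thick_step[OF Suc.prems(1)[of k] Suc.prems(2)[of k] Suc.prems(4-6) ch mem] by blast
  then show ?case
  proof cases
    case 1
    have "\<exists>a b. a k = x\<^sub>1 \<and> b k = x\<^sub>2 \<and> (\<forall>j\<le>k. frame (V j) (a j) (b j)) \<and>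
      (\<forall>j<k. edge_ok (d j) (f j) (a j) (a (Suc j)) \<and> (a j \<noteq> 0 \<longrightarrow> a (Suc j) \<noteq> 0) \<and>
             edge_ok (d j) (f j) (b j) (b (Suc j)) \<and> (b j \<noteq> 0 \<longrightarrow> b (Suc j) \<noteq> 0))"
      by (rule Suc.IH) (simp_all add: Suc.prems(1-3) 1)
    then obtain a b where ab: "a k = x\<^sub>1" "b k = x\<^sub>2" "\<forall>j\<le>k. frame (V j) (a j) (b j)"
      "\<forall>j<k. edge_ok (d j) (f j) (a j) (a (Suc j)) \<and> (a j \<noteq> 0 \<longrightarrow> a (Suc j) \<noteq> 0) \<and>
             edge_ok (d j) (f j) (b j) (b (Suc j)) \<and> (b j \<noteq> 0 \<longrightarrow> b (Suc j) \<noteq> 0)" by blast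
    then show ?thesis
      using 1 Suc.prems(4-6)
      by (intro exI[of _ "a(Suc k := e\<^sub>1)"] exI[of _ "b(Suc k := e\<^sub>2)"])
        (auto simp: le_Suc_eq less_Suc_eq)
  next
    case 2
    obtain a where a: "a k = x" "\<forall>j\<le>k. V j = span {a j}"
      "\<forall>j<k. edge_ok (d j) (f j) (a j) (a (Suc j)) \<and> (a j \<noteq> 0 \<longrightarrow> a (Suc j) \<noteq> 0)"
      using thin_arm[of k d f V x] Suc.prems(1,2) 2(1) less_SucI by blast
    have "edge_ok (d j) (f j) 0 0" for j by (simp add: edge_ok_def)
    then show ?thesis
      using a 2 Suc.prems(4-6) frame_line(1)
      by (intro exI[of _ "a(Suc k := e\<^sub>1)"] exI[of _ "(\<lambda>_. 0)(Suc k := e\<^sub>2)"])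
        (auto simp: le_Suc_eq less_Suc_eq)
  next
    case 3
    obtain a where a: "a k = x" "\<forall>j\<le>k. V j = span {a j}"
      "\<forall>j<k. edge_ok (d j) (f j) (a j) (a (Suc j)) \<and> (a j \<noteq> 0 \<longrightarrow> a (Suc j) \<noteq> 0)"
      using thin_arm[of k d f V x] Suc.prems(1,2) 3(1) less_SucI by blast
    have "edge_ok (d j) (f j) 0 0" for j by (simp add: edge_ok_def)
    then show ?thesis
      using a 3 Suc.prems(4-6) frame_line(2)
      by (intro exI[of _ "(\<lambda>_. 0)(Suc k := e\<^sub>1)"] exI[of _ "a(Suc k := e\<^sub>2)"])
        (auto simp: le_Suc_eq less_Suc_eq)
  qed
qed

end

section \<open>Representations of the Dynkin diagram\<close>

text \<open>The neighbour on the side of the branch vertex. The branch vertex is its own parent,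
  which makes the closure condition on row \<open>b\<close> in \<open>row_system\<close> trivial
  there.\<close>

definition dynkin_D_parent :: "nat \<Rightarrow> nat \<Rightarrow> nat" where
  "dynkin_D_parent n i = (if i < n - 2 then Suc i else n - 2)"

context ambient_space
begin

lemma edge_stable_whole: "edge d f V W \<Longrightarrow> edge_stable d f V W"
  by (auto simp: edge_stable_def edge_def linear_between_def split: if_splits)

lemma edge_stable_zero: "edge d f V W \<Longrightarrow> edge_stable d f {0} {0}"
  by (auto simp: edge_stable_def dest: edge_zero)

lemma splits_zero_whole: "subspace V \<Longrightarrow> splits V {0} V"
  using splits_trivial splits_sym by blast

section \<open>Failure of injectivity or surjectivity, and the short arms\<close>

text \<open>Failure means a nonzero kernel for an inward arrow, a proper image for an outward one. X
  is that kernel, or a complement of that image: it can be continued by zero on the root side, while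
  Y is continued by everything.\<close>

lemma not_presents_splits:
  assumes e: "edge d f V W" and np: "\<not> presents V (edge_rel d f V W)" and C: "subspace_chain V C"
  shows "\<exists>X Y. X \<noteq> {0} \<and> splits V X Y \<and> (\<forall>S\<in>C. compat X Y S) \<and>
    edge_stable d f X {0} \<and> edge_stable d f Y W"
proof -
  have sV: "subspace V" and sW: "subspace W" using e by (auto simp: edge_def)
  have compl: "\<exists>Y. splits V K Y \<and> (\<forall>S\<in>C. compat K Y S)" if "subspace K" "K \<subseteq> V" for K
    using C that sV by (intro ex_chain_complement) (auto simp: subspace_chain_def)
  show ?thesis
  proof (cases d)
    case True
    then have l: "linear_between scale V scale W f" using e by (auto simp: edge_def)
    note l' = linear_betweenD[OF l sV]
    let ?K = "{x \<in> V. f x = 0}"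
    have "subspace ?K"
      using l' sV by (intro subspaceI) (auto simp: subspace_0 subspace_add subspace_scale)
    then obtain Y where Y: "splits V ?K Y" "\<forall>S\<in>C. compat ?K Y S" using compl[of ?K] by auto
    have "?K \<noteq> {0}" using np True presents_edge_rel_iff[OF e] by auto
    moreover have "edge_stable d f ?K {0}" using True by (auto simp: edge_stable_def)
    moreover have "edge_stable d f Y W" using True l'(1) splitsD(5)[OF Y(1)] by (auto simp: edge_stable_def)
    ultimately show ?thesis using Y by (intro exI[of _ ?K] exI[of _ Y] conjI)
  next
    case False
    then have l: "linear_between scale W scale V f" using e by (auto simp: edge_def)
    note l' = linear_betweenD[OF l sW]
    have sI: "subspace (f ` W)"
    proof (rule subspaceI)
      show "0 \<in> f ` W" using l'(4) subspace_0[OF sW] by (metis image_eqI)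
      show "x + y \<in> f ` W" if "x \<in> f ` W" "y \<in> f ` W" for x y
        using that l'(2) subspace_add[OF sW] by (metis (no_types, lifting) image_iff)
      show "c *s x \<in> f ` W" if "x \<in> f ` W" for c x
        using that l'(3) subspace_scale[OF sW] by (metis (no_types, lifting) image_iff)
    qed
    moreover have "f ` W \<subseteq> V" using l'(1) by blast
    ultimately obtain Y where Y: "splits V (f ` W) Y" "\<forall>S\<in>C. compat (f ` W) Y S"
      using compl[of "f ` W"] by auto
    have "Y \<noteq> {0}"
    proof
      assume "Y = {0}"
      then have "V \<subseteq> f ` W" using splitsD(7)[OF Y(1)] by auto
      then show False using np False presents_edge_rel_iff[OF e] by simp
    qed
    moreover have "edge_stable d f Y {0}"
      using False l'(4) splitsD(2)[OF Y(1)] by (auto simp: edge_stable_def subspace_0)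
    moreover have "edge_stable d f (f ` W) W" using False by (auto simp: edge_stable_def)
    moreover have "splits V Y (f ` W)" using Y(1) by (rule splits_sym)
    moreover have "\<forall>S\<in>C. compat Y (f ` W) S" using Y(2) compat_sym by blast
    ultimately show ?thesis by (intro exI[of _ Y] exI[of _ "f ` W"] conjI)
  qed
qed

text \<open>The subspaces A and B of the overview. For an arm of length one, no other subspace
  besides {0} and W enters the induced chain.\<close>

definition edge_subspace :: "bool \<Rightarrow> ('b \<Rightarrow> 'b) \<Rightarrow> 'b set \<Rightarrow> 'b set \<Rightarrow> 'b set" where
  "edge_subspace d f V W = (if d then f ` V else {y \<in> W. f y = 0})"

lemma edge_rel_Image:
  assumes e: "edge d f V W"
  shows "edge_rel d f V W `` V = (if d then edge_subspace d f V W else W)"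
    "edge_rel d f V W `` {0} = (if d then {0} else edge_subspace d f V W)"
proof -
  have "0 \<in> V" using e subspace_0 by (auto simp: edge_def)
  then show "edge_rel d f V W `` V = (if d then edge_subspace d f V W else W)"
    "edge_rel d f V W `` {0} = (if d then {0} else edge_subspace d f V W)"
    using e edge_zero[OF e]
    by (auto simp: edge_rel_def edge_subspace_def edge_def linear_between_def)
qed

lemma subspace_edge_subspace:
  assumes "edge d f V W"
  shows "subspace (edge_subspace d f V W)" "edge_subspace d f V W \<subseteq> W"
proof -
  note R = linear_relation_edge_rel[OF assms]
  have "edge_subspace d f V W = edge_rel d f V W `` V \<or> edge_subspace d f V W = edge_rel d f V W `` {0}"
    using edge_rel_Image[OF assms] by simp
  then show "subspace (edge_subspace d f V W)" "edge_subspace d f V W \<subseteq> W"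
    using subspace_Image[OF R] linear_relationD(1,4)[OF R] subspace_zero_set by auto
qed

lemma leaf_splits:
  assumes e: "edge d f V W" and p: "presents V (edge_rel d f V W)"
    and s: "splits W X Y" and c: "compat X Y (edge_subspace d f V W)"
  shows "splits V ((edge_rel d f V W)\<inverse> `` X) ((edge_rel d f V W)\<inverse> `` Y)"
  using splits_pullback[OF linear_relation_edge_rel[OF e] p s] c compat_whole[OF s] compat_zero[OF s]
    edge_rel_Image[OF e] by (cases d) simp_all

text \<open>An inward arrow identifies the leaf with the line of b; an outward one kills this line,
  and the leaf is spanned by the image of a. The generator y of the line is left free so that a
  vector with changed sign can be hit exactly.\<close>

lemma leaf_line:
  assumes e: "edge d f V W" and p: "presents V (edge_rel d f V W)"
    and fr: "frame W a b" and a: "a \<noteq> 0" and b: "b \<noteq> 0"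
    and B: "edge_subspace d f V W = span {b}" and y: "span {y} = span {b}"
  shows "if d then \<exists>z. z \<noteq> 0 \<and> V = span {z} \<and> f z = y else V = span {f a} \<and> f a \<noteq> 0 \<and> f b = 0"
proof (cases d)
  case True
  have l: "linear_between scale V scale W f" "subspace V" using e True by (auto simp: edge_def)
  have img: "f ` V = span {y}" using B y True by (simp add: edge_subspace_def)
  \<comment> \<open>With W shrunk to the image line, the one-row step applies and normalises the
    generator of V.\<close>
  then have e': "edge d f V (span {y})" using l True by (auto simp: edge_def linear_between_def)
  have "edge_rel d f V (span {y}) = edge_rel d f V W" using True by (simp add: edge_rel_def)
  then obtain z where z: "V = span {z}" "edge_ok d f z y" "z \<noteq> 0 \<longrightarrow> y \<noteq> 0"
    using thin_step[OF e' _ refl] p by metis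
  have "z \<noteq> 0"
  proof
    assume "z = 0"
    then have "V = {0}" using z(1) by simp
    then have "span {b} = {0}" using img y linear_betweenD(4)[OF l] by simp
    then show False using b by (simp add: span_single_eq_zero)
  qed
  then show ?thesis using z True by (auto simp: edge_ok_def)
next
  case False
  have l: "linear_between scale W scale V f" "subspace W" using e False by (auto simp: edge_def)
  note l' = linear_betweenD[OF l] and fr' = frameD[OF fr]
  have ker: "y \<in> span {b} \<longleftrightarrow> y \<in> W \<and> f y = 0" for y
    using B False by (auto simp: edge_subspace_def)
  have fb: "f b = 0" using ker[of b] span_base[of b "{b}"] by blast
  have fa: "f a \<noteq> 0" using ker[of a] fr'(4) fr'(9)[OF a] by blast
  have lin: "f (s *s a + t *s b) = s *s f a" for s t
  proof -
    have "f (s *s a + t *s b) = f (s *s a) + f (t *s b)"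
      using l'(2) fr'(4,5) subspace_scale[OF l(2)] by blast
    then show ?thesis using l'(3) fr'(4,5) fb by simp
  qed
  have "V \<subseteq> span {f a}"
  proof
    fix v assume "v \<in> V"
    then obtain w where w: "w \<in> W" "v = f w" using p False presents_edge_rel_iff[OF e] by auto
    obtain s t where "w = s *s a + t *s b" using fr'(7)[OF w(1)] by blast
    then show "v \<in> span {f a}" using w(2) lin by (auto simp: in_span_single)
  qed
  moreover have "span {f a} \<subseteq> V"
    using l'(1)[OF fr'(4)] e by (intro span_minimal) (auto simp: edge_def)
  ultimately show ?thesis using False fa fb by auto
qed

text \<open>
  Two rows of basis vectors \<open>a i\<close> and \<open>b i\<close>, where a zero vector means that the row does not reach
  \<open>i\<close>. With \<open>ex\<close> the row \<open>b\<close> is nonempty and joined to row \<open>a\<close> through the vertex \<open>n - 1\<close>.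
\<close>

definition row_system ::
  "nat \<Rightarrow> (nat \<Rightarrow> 'b set) \<Rightarrow> (nat \<Rightarrow> bool) \<Rightarrow> (nat \<Rightarrow> 'b \<Rightarrow> 'b) \<Rightarrow> (nat \<Rightarrow> 'b) \<Rightarrow> (nat \<Rightarrow> 'b) \<Rightarrow> nat \<Rightarrow> bool \<Rightarrow> bool"
  where
  "row_system n V d f a b k ex \<longleftrightarrow> k \<in> {1..n} \<and> a k \<noteq> 0 \<and>
     (\<forall>i\<in>{1..n}. frame (V i) (a i) (b i)) \<and>
     (\<forall>i\<in>{1..n}. a i \<noteq> 0 \<and> i \<noteq> k \<longrightarrow> i \<noteq> n - 2 \<and> a (dynkin_D_parent n i) \<noteq> 0) \<and>
     (k \<noteq> n - 2 \<longrightarrow> a (dynkin_D_parent n k) = 0) \<and>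
     (\<forall>i\<in>{1..n}. b i \<noteq> 0 \<longrightarrow> b (dynkin_D_parent n i) \<noteq> 0) \<and>
     (if ex then k = n - 2 \<and> b (n - 2) \<noteq> 0 \<and> a (n - 1) \<noteq> 0 \<and> b (n - 1) = 0 else \<forall>i\<in>{1..n}. b i = 0) \<and>
     (\<forall>i\<in>{1..n}. i \<noteq> n - 2 \<longrightarrow>
       (if ex \<and> i = n - 1
        then if d i then f i (a i) = a (n - 2) + b (n - 2) else f i (a (n - 2)) = a i \<and> f i (b (n - 2)) = a i
        else edge_ok (d i) (f i) (a i) (a (dynkin_D_parent n i)) \<and>
             edge_ok (d i) (f i) (b i) (b (dynkin_D_parent n i))))"

end

text \<open>
  The Dynkin diagram is rooted at the branch vertex \<open>n - 2\<close>. The extra vertex 0 with the zero space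
  lets the long arm start at index 0.
\<close>

locale dynkin_D_data = ambient_space scale
  for scale :: "'a::field \<Rightarrow> 'b::ab_group_add \<Rightarrow> 'b" (infixr "*s" 75) +
  fixes n :: nat and V :: "nat \<Rightarrow> 'b set" and d :: "nat \<Rightarrow> bool" and f :: "nat \<Rightarrow> 'b \<Rightarrow> 'b"
  assumes n: "4 \<le> n"
    and zero: "V 0 = {0}" "d 0" "f 0 = (\<lambda>_. 0)"
    and edge: "\<And>i. i \<in> {1..n} \<Longrightarrow> i \<noteq> n - 2 \<Longrightarrow> edge (d i) (f i) (V i) (V (dynkin_D_parent n i))"
    and nonzero: "\<exists>i\<in>{1..n}. V i \<noteq> {0}"
    and indec: "\<And>U W. (\<And>i. i \<in> {1..n} \<Longrightarrow> splits (V i) (U i) (W i)) \<Longrightarrow>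
      (\<And>i. i \<in> {1..n} \<Longrightarrow> i \<noteq> n - 2 \<Longrightarrow> edge_stable (d i) (f i) (U i) (U (dynkin_D_parent n i))) \<Longrightarrow>
      (\<And>i. i \<in> {1..n} \<Longrightarrow> i \<noteq> n - 2 \<Longrightarrow> edge_stable (d i) (f i) (W i) (W (dynkin_D_parent n i))) \<Longrightarrow>
      (\<forall>i\<in>{1..n}. U i = {0}) \<or> (\<forall>i\<in>{1..n}. W i = {0})"
begin

abbreviation "R i \<equiv> edge_rel (d i) (f i) (V i) (V (Suc i))"

lemma leaf_vertex:
  assumes "i = n - 1 \<or> i = n"
  shows "i \<in> {1..n}" "i \<noteq> n - 2" "dynkin_D_parent n i = n - 2"
  using assms n by (auto simp: dynkin_D_parent_def)

lemma subspace_V: "i \<le> n \<Longrightarrow> subspace (V i)"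
proof -
  assume i: "i \<le> n"
  consider "i = 0" | "i \<in> {1..n}" "i \<noteq> n - 2" | "i = n - 2" using i by force
  then show ?thesis
  proof cases
    case 1
    then show ?thesis using zero(1) subspace_zero_set by simp
  next
    case 2
    then show ?thesis using edge[of i] by (simp add: edge_def)
  next
    case 3
    then show ?thesis using edge[of n] leaf_vertex[of n] by (simp add: edge_def)
  qed
qed

lemma edge_arm:
  assumes "i < n - 2"
  shows "edge (d i) (f i) (V i) (V (Suc i))"
proof (cases "i = 0")
  case True
  then show ?thesis
    using zero n subspace_V[of 0] subspace_V[of 1] subspace_0[OF subspace_V[of 1]]
    by (simp add: edge_def linear_between_def)
next
  case False
  then show ?thesis using edge[of i] assms by (simp add: dynkin_D_parent_def)
qed

lemma edge_leaf:
  assumes "i = n - 1 \<or> i = n"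
  shows "edge (d i) (f i) (V i) (V (n - 2))"
  using edge[of i] leaf_vertex[OF assms] by simp

lemma vertex_cases:
  assumes "i \<in> {1..n}"
  obtains "i < n - 2" | "i = n - 2" | "i = n - 1 \<or> i = n"
  using assms by force

lemma chain_arm: "k \<le> n - 2 \<Longrightarrow> subspace_chain (V k) (arm_chain V R k)"
  using subspace_V[of 0] edge_arm linear_relation_edge_rel by (intro subspace_chain_arm_chain) auto

lemma split_arm:
  assumes k: "k \<le> n - 2" and p: "\<And>j. j < k \<Longrightarrow> presents (V j) (R j)"
    and s: "splits (V k) X Y" "\<And>S. S \<in> arm_chain V R k \<Longrightarrow> compat X Y S"
  shows "\<exists>U W. U k = X \<and> W k = Y \<and> (\<forall>j\<le>k. splits (V j) (U j) (W j)) \<and>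
     (\<forall>j<k. edge_stable (d j) (f j) (U j) (U (Suc j)) \<and> edge_stable (d j) (f j) (W j) (W (Suc j)))"
proof -
  have e: "edge (d j) (f j) (V j) (V (Suc j))" if "j < k" for j using edge_arm that k by simp
  have "\<exists>U W. U k = X \<and> W k = Y \<and> (\<forall>j\<le>k. splits (V j) (U j) (W j)) \<and>
     (\<forall>j<k. U j = (R j)\<inverse> `` U (Suc j) \<and> W j = (R j)\<inverse> `` W (Suc j))"
    by (rule arm_splits) (use e linear_relation_edge_rel p s subspace_V[of 0] in auto)
  then obtain U W where UW: "U k = X" "W k = Y" "\<forall>j\<le>k. splits (V j) (U j) (W j)"
    "\<forall>j<k. U j = (R j)\<inverse> `` U (Suc j) \<and> W j = (R j)\<inverse> `` W (Suc j)" by blast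
  have "edge_stable (d j) (f j) (U j) (U (Suc j)) \<and> edge_stable (d j) (f j) (W j) (W (Suc j))"
    if j: "j < k" for j
  proof -
    have "splits (V (Suc j)) (U (Suc j)) (W (Suc j))" using UW(3) j by simp
    then have "U (Suc j) \<subseteq> V (Suc j)" "W (Suc j) \<subseteq> V (Suc j)" by (auto dest: splitsD(4,5))
    then show ?thesis
      using edge_stable_pullback[OF e[OF j]] UW(4) j by metis
  qed
  then show ?thesis using UW(1-3) by blast
qed

section \<open>Splitting off an outer piece\<close>

text \<open>The splitting at \<open>k\<close> is continued outwards by pullback; everywhere else the
  first summand is continued by {0} and the second by the full spaces. This decomposes the whole
  representation.\<close>

lemma cut_arm:
  assumes k: "1 \<le> k" "k < n - 2" and p: "\<And>j. j < k \<Longrightarrow> presents (V j) (R j)"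
    and s: "splits (V k) X Y" "\<And>S. S \<in> arm_chain V R k \<Longrightarrow> compat X Y S"
    and stX: "edge_stable (d k) (f k) X {0}" and stY: "edge_stable (d k) (f k) Y (V (Suc k))"
  shows "X = {0} \<or> Y = {0} \<and> (\<forall>j\<in>{k<..n}. V j = {0})"
proof -
  obtain U W where UW: "U k = X" "W k = Y" "\<And>j. j \<le> k \<Longrightarrow> splits (V j) (U j) (W j)"
    "\<And>j. j < k \<Longrightarrow> edge_stable (d j) (f j) (U j) (U (Suc j))"
    "\<And>j. j < k \<Longrightarrow> edge_stable (d j) (f j) (W j) (W (Suc j))"
    using split_arm[OF less_imp_le[OF k(2)] p s] by auto
  define U' where "U' j = (if j \<le> k then U j else {0})" for j
  define W' where "W' j = (if j \<le> k then W j else V j)" for j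
  have "(\<forall>i\<in>{1..n}. U' i = {0}) \<or> (\<forall>i\<in>{1..n}. W' i = {0})"
  proof (rule indec)
    fix i assume i: "i \<in> {1..n}"
    show "splits (V i) (U' i) (W' i)"
      using UW(3)[of i] splits_zero_whole[OF subspace_V[of i]] i by (simp add: U'_def W'_def)
    assume ne: "i \<noteq> n - 2"
    consider "i < k" "dynkin_D_parent n i = Suc i" | "i = k" "dynkin_D_parent n i = Suc k"
      | "\<not> i \<le> k" "\<not> dynkin_D_parent n i \<le> k"
    proof -
      have "i < k \<and> dynkin_D_parent n i = Suc i \<or> i = k \<and> dynkin_D_parent n i = Suc k \<or>
          \<not> i \<le> k \<and> \<not> dynkin_D_parent n i \<le> k"
        using k by (auto simp: dynkin_D_parent_def)
      then show thesis using that by blast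
    qed
    then show "edge_stable (d i) (f i) (U' i) (U' (dynkin_D_parent n i))"
      "edge_stable (d i) (f i) (W' i) (W' (dynkin_D_parent n i))"
      using UW stX stY edge_stable_whole[OF edge[OF i ne]] edge_stable_zero[OF edge[OF i ne]]
      by (cases; simp add: U'_def W'_def)+
  qed
  then show ?thesis
  proof
    assume "\<forall>i\<in>{1..n}. U' i = {0}"
    from this[rule_format, of k] show ?thesis using k UW(1) by (simp add: U'_def)
  next
    assume *: "\<forall>i\<in>{1..n}. W' i = {0}"
    have "Y = {0}" using *[rule_format, of k] k UW(2) by (simp add: W'_def)
    moreover have "V j = {0}" if "j \<in> {k<..n}" for j
      using *[rule_format, of j] that by (simp add: W'_def)
    ultimately show ?thesis by blast
  qed
qed

lemma cut_leaf:
  assumes k: "k = n - 1 \<or> k = n" and s: "splits (V k) X Y"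
    and stX: "edge_stable (d k) (f k) X {0}" and stY: "edge_stable (d k) (f k) Y (V (n - 2))"
  shows "X = {0} \<or> Y = {0} \<and> (\<forall>j\<in>{1..n} - {k}. V j = {0})"
proof -
  define U' where "U' j = (if j = k then X else {0})" for j
  define W' where "W' j = (if j = k then Y else V j)" for j
  have kn: "k \<in> {1..n}" using k n by auto
  have "(\<forall>i\<in>{1..n}. U' i = {0}) \<or> (\<forall>i\<in>{1..n}. W' i = {0})"
  proof (rule indec)
    fix i assume i: "i \<in> {1..n}"
    show "splits (V i) (U' i) (W' i)"
      using s splits_zero_whole[OF subspace_V[of i]] i by (simp add: U'_def W'_def)
    assume ne: "i \<noteq> n - 2"
    have "dynkin_D_parent n i \<noteq> k" "i = k \<Longrightarrow> dynkin_D_parent n i = n - 2"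
      using k n ne by (auto simp: dynkin_D_parent_def)
    then show "edge_stable (d i) (f i) (U' i) (U' (dynkin_D_parent n i))"
      "edge_stable (d i) (f i) (W' i) (W' (dynkin_D_parent n i))"
      using stX stY edge_stable_whole[OF edge[OF i ne]] edge_stable_zero[OF edge[OF i ne]]
      by (cases "i = k"; simp add: U'_def W'_def)+
  qed
  then show ?thesis
  proof
    assume "\<forall>i\<in>{1..n}. U' i = {0}"
    from this[rule_format, OF kn] show ?thesis by (simp add: U'_def)
  next
    assume *: "\<forall>i\<in>{1..n}. W' i = {0}"
    have "Y = {0}" using *[rule_format, of k] kn by (simp add: W'_def)
    moreover have "V j = {0}" if "j \<in> {1..n} - {k}" for j
      using *[rule_format, of j] that by (simp add: W'_def)
    ultimately show ?thesis by blast
  qed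
qed

text \<open>At the outermost failure i, all edges farther out behave well, so the summand found
  there extends over the outer part of the arm and splits off. Then every space on the root side of
  i is zero, against \<open>V k \<noteq> {0}\<close>.\<close>

lemma presents_arm:
  assumes k: "k \<le> n - 2" "V k \<noteq> {0}"
  shows "i < k \<Longrightarrow> presents (V i) (R i)"
proof (induction i rule: less_induct)
  case (less i)
  then have i: "i < n - 2" using k by simp
  note e = edge_arm[OF i]
  show ?case
  proof (cases "i = 0")
    case True
    then show ?thesis using presents_edge_rel_iff[OF e] zero by simp
  next
    case False
    show ?thesis
    proof (rule ccontr)
      assume "\<not> ?thesis"
      then obtain X Y where XY: "X \<noteq> {0}" "splits (V i) X Y" "\<forall>S\<in>arm_chain V R i. compat X Y S"
        "edge_stable (d i) (f i) X {0}" "edge_stable (d i) (f i) Y (V (Suc i))"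
        using not_presents_splits[OF e _ chain_arm[of i]] i by auto
      have "\<And>j. j < i \<Longrightarrow> presents (V j) (R j)" using less by simp
      then have "\<forall>j\<in>{i<..n}. V j = {0}" using cut_arm[of i X Y] XY False i by auto
      then show False using k less.prems by auto
    qed
  qed
qed

lemma presents_leaf:
  assumes k: "k = n - 1 \<or> k = n" and c: "V (n - 2) \<noteq> {0}"
  shows "presents (V k) (edge_rel (d k) (f k) (V k) (V (n - 2)))"
proof (rule ccontr)
  assume np: "\<not> ?thesis"
  have "subspace_chain (V k) {{0}, V k}"
    using subspace_V[of k] subspace_zero_set k by (auto simp: subspace_chain_def subspace_0)
  with np have "\<exists>X Y. X \<noteq> {0} \<and> splits (V k) X Y \<and> (\<forall>S\<in>{{0}, V k}. compat X Y S) \<and>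
      edge_stable (d k) (f k) X {0} \<and> edge_stable (d k) (f k) Y (V (n - 2))"
    by (rule not_presents_splits[OF edge_leaf[OF k]])
  then obtain X Y where XY: "X \<noteq> {0}" "splits (V k) X Y"
        "edge_stable (d k) (f k) X {0}" "edge_stable (d k) (f k) Y (V (n - 2))"
    by (elim exE conjE)
  then have "\<forall>j\<in>{1..n} - {k}. V j = {0}" using cut_leaf[OF k] by blast
  moreover have "n - 2 \<in> {1..n} - {k}" using k n by auto
  ultimately show False using c by blast
qed

text \<open>Compatibility with the chain and the two leaf subspaces is what allows a splitting of
  the branch space to be pulled back along all three arms, where it decomposes the whole
  representation.\<close>

lemma center_no_splitting:
  assumes c: "V (n - 2) \<noteq> {0}" and s: "splits (V (n - 2)) X Y"
    and comp: "\<And>S. S \<in> insert (edge_subspace (d (n - 1)) (f (n - 1)) (V (n - 1)) (V (n - 2)))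
      (insert (edge_subspace (d n) (f n) (V n) (V (n - 2))) (arm_chain V R (n - 2))) \<Longrightarrow> compat X Y S"
  shows "X = {0} \<or> Y = {0}"
proof -
  let ?c = "n - 2"
  obtain U W where UW: "U ?c = X" "W ?c = Y" "\<And>j. j \<le> ?c \<Longrightarrow> splits (V j) (U j) (W j)"
    "\<And>j. j < ?c \<Longrightarrow> edge_stable (d j) (f j) (U j) (U (Suc j))"
    "\<And>j. j < ?c \<Longrightarrow> edge_stable (d j) (f j) (W j) (W (Suc j))"
    using split_arm[OF order_refl presents_arm[OF order_refl c] s comp] by auto
  let ?L = "\<lambda>j. edge_rel (d j) (f j) (V j) (V ?c)"
  define U' where "U' j = (if j \<le> ?c then U j else (?L j)\<inverse> `` X)" for j
  define W' where "W' j = (if j \<le> ?c then W j else (?L j)\<inverse> `` Y)" for j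
  have sub: "X \<subseteq> V ?c" "Y \<subseteq> V ?c" using splitsD[OF s] by auto
  have "(\<forall>i\<in>{1..n}. U' i = {0}) \<or> (\<forall>i\<in>{1..n}. W' i = {0})"
  proof (rule indec)
    fix i assume i: "i \<in> {1..n}"
    show "splits (V i) (U' i) (W' i)"
    proof (cases "i \<le> ?c")
      case True
      then show ?thesis using UW(3) by (simp add: U'_def W'_def)
    next
      case False
      then have l: "i = n - 1 \<or> i = n" using i by auto
      then have "compat X Y (edge_subspace (d i) (f i) (V i) (V ?c))" using comp by blast
      then have "splits (V i) ((?L i)\<inverse> `` X) ((?L i)\<inverse> `` Y)"
        by (rule leaf_splits[OF edge_leaf[OF l] presents_leaf[OF l c] s])
      then show ?thesis using False by (simp add: U'_def W'_def)
    qed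
    assume ne: "i \<noteq> ?c"
    consider "i < ?c" | "i = n - 1 \<or> i = n" "\<not> i \<le> ?c" using i ne by force
    then have "edge_stable (d i) (f i) (U' i) (U' (dynkin_D_parent n i)) \<and>
      edge_stable (d i) (f i) (W' i) (W' (dynkin_D_parent n i))"
    proof cases
      case 1
      then show ?thesis using UW(4,5) by (simp add: U'_def W'_def dynkin_D_parent_def)
    next
      case 2
      have "U' (dynkin_D_parent n i) = X" "W' (dynkin_D_parent n i) = Y"
        using UW(1,2) leaf_vertex[OF 2(1)] by (auto simp: U'_def W'_def)
      then show ?thesis
        using edge_stable_pullback[OF edge_leaf[OF 2(1)]] sub 2(2) by (simp add: U'_def W'_def)
    qed
    then show "edge_stable (d i) (f i) (U' i) (U' (dynkin_D_parent n i))"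
      "edge_stable (d i) (f i) (W' i) (W' (dynkin_D_parent n i))" by simp_all
  qed
  moreover have "?c \<in> {1..n}" "U' ?c = X" "W' ?c = Y" using UW(1,2) n by (auto simp: U'_def W'_def)
  ultimately show ?thesis by metis
qed

section \<open>The two rows of an indecomposable representation\<close>

text \<open>Both extra subspaces are taken to be the whole space; the plane alternative then itself
  says that this space is a line.\<close>

lemma line_of_chain:
  assumes k: "subspace (V k)" "V k \<noteq> {0}" and C: "subspace_chain (V k) C"
    and no: "\<And>X Y. splits (V k) X Y \<Longrightarrow> (\<And>S. S \<in> C \<Longrightarrow> compat X Y S) \<Longrightarrow> X = {0} \<or> Y = {0}"
  shows "\<exists>x. x \<noteq> 0 \<and> V k = span {x}"
proof -
  have "(\<exists>x. x \<noteq> 0 \<and> V k = span {x}) \<or>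
    (\<exists>a b. frame (V k) a b \<and> a \<noteq> 0 \<and> b \<noteq> 0 \<and> V k = span {a} \<and> V k = span {b} \<and> span {a + b} \<in> C)"
  proof (rule chain_two_subspaces_indecomposable[OF k C k(1) order_refl k(1) order_refl])
    show "X = {0} \<or> Y = {0}"
      if "splits (V k) X Y" "\<And>S. S \<in> insert (V k) (insert (V k) C) \<Longrightarrow> compat X Y S" for X Y
      using that by (intro no) auto
  qed
  then show ?thesis by blast
qed

lemma row_system_line:
  assumes k: "k \<in> {1..n}" "x \<noteq> 0" "V k = span {x}"
    and c: "k \<noteq> n - 2 \<Longrightarrow> V (dynkin_D_parent n k) = {0}"
    and a: "a k = x" "\<And>i. i \<in> {1..n} \<Longrightarrow> V i = span {a i}"
      "\<And>i. i \<in> {1..n} \<Longrightarrow> i \<noteq> k \<Longrightarrow> a i \<noteq> 0 \<Longrightarrow> i \<noteq> n - 2 \<and> a (dynkin_D_parent n i) \<noteq> 0"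
      "\<And>i. i \<in> {1..n} \<Longrightarrow> i \<noteq> n - 2 \<Longrightarrow> edge_ok (d i) (f i) (a i) (a (dynkin_D_parent n i))"
  shows "row_system n V d f a (\<lambda>_. 0) k False"
proof -
  have "a (dynkin_D_parent n k) = 0" if "k \<noteq> n - 2"
  proof -
    have "dynkin_D_parent n k \<in> {1..n}" using k n by (auto simp: dynkin_D_parent_def)
    then show ?thesis using a(2) c[OF that] span_single_eq_zero by metis
  qed
  moreover have "edge_ok (d i) (f i) 0 0" for i by (simp add: edge_ok_def)
  ultimately show ?thesis
    using k a by (simp add: row_system_def frame_line)
qed

lemma thin_main_arm:
  assumes "k \<le> n - 2" "V k \<noteq> {0}" "V k = span {x}"
  obtains a where "a k = x" "\<And>j. j \<le> k \<Longrightarrow> V j = span {a j}"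
    "\<And>j. j < k \<Longrightarrow> edge_ok (d j) (f j) (a j) (a (Suc j))" "\<And>j. j < k \<Longrightarrow> a j \<noteq> 0 \<Longrightarrow> a (Suc j) \<noteq> 0"
proof -
  have "\<exists>a. a k = x \<and> (\<forall>j\<le>k. V j = span {a j}) \<and>
    (\<forall>j<k. edge_ok (d j) (f j) (a j) (a (Suc j)) \<and> (a j \<noteq> 0 \<longrightarrow> a (Suc j) \<noteq> 0))"
    by (rule thin_arm) (use assms edge_arm presents_arm[OF assms(1,2)] in auto)
  then show ?thesis using that by blast
qed

text \<open>With zero at the branch vertex the support lies on the long arm or on a single leaf. The
  root is the nonzero vertex nearest to the branch vertex: its neighbour on that side has the zero
  space, so stability across that edge is automatic and every compatible splitting decomposes the
  representation.\<close>

lemma row_system_small: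
  assumes c: "V (n - 2) = {0}"
  shows "\<exists>a b k ex. row_system n V d f a b k ex"
proof (cases "\<exists>k. 1 \<le> k \<and> k < n - 2 \<and> V k \<noteq> {0}")
  case True
  define k where "k = (GREATEST k. 1 \<le> k \<and> k < n - 2 \<and> V k \<noteq> {0})"
  have k: "1 \<le> k" "k < n - 2" "V k \<noteq> {0}"
    using GreatestI_ex_nat[of "\<lambda>k. 1 \<le> k \<and> k < n - 2 \<and> V k \<noteq> {0}" "n - 2"] True
    unfolding k_def by auto
  have above: "V j = {0}" if "k < j" "j \<le> n - 2" for j
  proof (rule ccontr)
    assume "V j \<noteq> {0}"
    then have "1 \<le> j \<and> j < n - 2 \<and> V j \<noteq> {0}" using that k c by (cases "j = n - 2") auto
    then have "j \<le> k"
      unfolding k_def by (rule Greatest_le_nat[where b = "n - 2"]) auto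
    then show False using that by simp
  qed
  have sk: "subspace (V k)" using subspace_V k by simp
  note p = presents_arm[OF less_imp_le[OF k(2)] k(3)]
  have V_Suc: "V (Suc k) = {0}" using above[of "Suc k"] k by simp
  have e: "edge (d k) (f k) (V k) {0}" using edge_arm[OF k(2)] V_Suc by simp
  have cut: "X = {0} \<or> Y = {0} \<and> (\<forall>j\<in>{k<..n}. V j = {0})"
    if s: "splits (V k) X Y" "\<And>S. S \<in> arm_chain V R k \<Longrightarrow> compat X Y S" for X Y
  proof (rule cut_arm[OF k(1,2) p s])
    have "0 \<in> X" "0 \<in> Y" "X \<subseteq> V k" "Y \<subseteq> V k"
      using splitsD[OF s(1)] subspace_0 by auto
    then show "edge_stable (d k) (f k) X {0}" "edge_stable (d k) (f k) Y (V (Suc k))"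
      unfolding V_Suc using e edge_zero[OF e]
      by (auto simp: edge_stable_def edge_def linear_between_def split: if_splits)
  qed
  have "X = {0} \<or> Y = {0}"
    if "splits (V k) X Y" "\<And>S. S \<in> arm_chain V R k \<Longrightarrow> compat X Y S" for X Y
    using cut[OF that] by blast
  from line_of_chain[OF sk k(3) chain_arm[OF less_imp_le[OF k(2)]] this]
  obtain x where x: "x \<noteq> 0" "V k = span {x}" by auto
  \<comment> \<open>The trivial splitting, cut at k, shows that nothing lives beyond k, the two
    leaves included.\<close>
  have "V j = {0}" if "k < j" "j \<le> n" for j
  proof -
    have s: "splits (V k) (V k) {0}" by (rule splits_trivial[OF sk])
    have "compat (V k) {0} S" if "S \<in> arm_chain V R k" for S
      using chain_arm[of k] that k s
      by (intro compat_right) (auto simp: subspace_chain_def subspace_0)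
    from cut[OF s this] show ?thesis using k(3) that by auto
  qed
  note beyond = this
  obtain a where a: "a k = x" "\<And>j. j \<le> k \<Longrightarrow> V j = span {a j}"
    "\<And>j. j < k \<Longrightarrow> edge_ok (d j) (f j) (a j) (a (Suc j))" "\<And>j. j < k \<Longrightarrow> a j \<noteq> 0 \<Longrightarrow> a (Suc j) \<noteq> 0"
    using thin_main_arm[OF less_imp_le[OF k(2)] k(3) x(2)] by blast
  define a' where "a' j = (if j \<le> k then a j else 0)" for j
  have "row_system n V d f a' (\<lambda>_. 0) k False"
  proof (rule row_system_line)
    show "k \<in> {1..n}" using k by simp
    show "x \<noteq> 0" "V k = span {x}" by (fact x)+
    show "V (dynkin_D_parent n k) = {0}" using V_Suc k by (simp add: dynkin_D_parent_def)
    show "a' k = x" using a by (simp add: a'_def)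
    fix i assume i: "i \<in> {1..n}"
    show "V i = span {a' i}" using a(2)[of i] beyond[of i] i by (simp add: a'_def)
    show "i \<noteq> n - 2 \<and> a' (dynkin_D_parent n i) \<noteq> 0" if "i \<noteq> k" "a' i \<noteq> 0"
      using that a(4)[of i] k by (auto simp: a'_def dynkin_D_parent_def split: if_splits)
    show "edge_ok (d i) (f i) (a' i) (a' (dynkin_D_parent n i))" if "i \<noteq> n - 2"
    proof (cases "i < k")
      case True
      then show ?thesis using a(3)[of i] k by (simp add: a'_def dynkin_D_parent_def)
    next
      case False
      then have *: "a' (dynkin_D_parent n i) = 0" "V (dynkin_D_parent n i) = {0}" "i \<noteq> k \<Longrightarrow> a' i = 0"
        using k i above[of "Suc i"] c by (auto simp: a'_def dynkin_D_parent_def)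
      have "edge (d i) (f i) (V i) {0}" using edge[OF i that] *(2) by simp
      moreover have "a' i \<in> V i"
        using a(2)[of i] beyond[of i] i span_base[of "a i" "{a i}"] by (simp add: a'_def)
      ultimately show ?thesis
        using *(1) by (auto simp: edge_ok_def edge_def linear_between_def)
    qed
  qed
  then show ?thesis by blast
next
  \<comment> \<open>The long arm is zero as well, so some leaf is nonzero and serves as
    root.\<close>
  case False
  obtain i where i: "i \<in> {1..n}" "V i \<noteq> {0}" using nonzero by blast
  have l: "i = n - 1 \<or> i = n"
    using i(1)
  proof (cases rule: vertex_cases)
    case 1
    then show ?thesis using False i by auto
  next
    case 2
    then show ?thesis using c i(2) by simp
  qed
  have si: "subspace (V i)" using subspace_V i by simp
  have e: "edge (d i) (f i) (V i) {0}" using edge_leaf[OF l] c by simp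
  have cut: "X = {0} \<or> Y = {0} \<and> (\<forall>j\<in>{1..n} - {i}. V j = {0})" if s: "splits (V i) X Y" for X Y
  proof (rule cut_leaf[OF l s])
    have "0 \<in> X" "0 \<in> Y" "X \<subseteq> V i" "Y \<subseteq> V i"
      using splitsD[OF s(1)] subspace_0 by auto
    then show "edge_stable (d i) (f i) X {0}" "edge_stable (d i) (f i) Y (V (n - 2))"
      unfolding c using e edge_zero[OF e]
      by (auto simp: edge_stable_def edge_def linear_between_def split: if_splits)
  qed
  have ch: "subspace_chain (V i) {{0}, V i}"
    using si subspace_zero_set by (auto simp: subspace_chain_def subspace_0)
  have "X = {0} \<or> Y = {0}"
    if "splits (V i) X Y" "\<And>S. S \<in> {{0}, V i} \<Longrightarrow> compat X Y S" for X Y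
    using cut[OF that(1)] by blast
  from line_of_chain[OF si i(2) ch this]
  obtain x where x: "x \<noteq> 0" "V i = span {x}" by auto
  have others: "V j = {0}" if "j \<in> {1..n}" "j \<noteq> i" for j
    using cut[OF splits_trivial[OF si]] i(2) that by blast
  have "row_system n V d f (\<lambda>j. if j = i then x else 0) (\<lambda>_. 0) i False"
  proof (rule row_system_line)
    show "V (dynkin_D_parent n i) = {0}" using c leaf_vertex[OF l] by simp
    fix j assume j: "j \<in> {1..n}"
    show "V j = span {if j = i then x else 0}" using others[OF j] x by simp
    show "edge_ok (d j) (f j) (if j = i then x else 0) (if dynkin_D_parent n j = i then x else 0)"
      if "j \<noteq> n - 2"
    proof -
      have "dynkin_D_parent n j \<noteq> i" using l n by (auto simp: dynkin_D_parent_def)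
      moreover have "edge_ok (d i) (f i) x 0"
        using e x span_base[of x "{x}"] by (auto simp: edge_ok_def edge_def linear_between_def)
      ultimately show ?thesis by (auto simp: edge_ok_def)
    qed
  qed (use i x in auto)
  then show ?thesis by blast
qed

lemma row_system_big:
  assumes c: "V (n - 2) \<noteq> {0}"
  shows "\<exists>a b k ex. row_system n V d f a b k ex"
proof -
  let ?c = "n - 2"
  let ?A = "\<lambda>i. edge_subspace (d i) (f i) (V i) (V ?c)"
  have cn: "?c \<le> n" "?c \<in> {1..n}" using n by auto
  have l1: "n - 1 = n - 1 \<or> n - 1 = n" and l2: "n = n - 1 \<or> n = n" by simp_all
  note e1 = edge_leaf[OF l1] and e2 = edge_leaf[OF l2]
  note p1 = presents_leaf[OF l1 c] and p2 = presents_leaf[OF l2 c]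
  have par: "dynkin_D_parent n (n - 1) = ?c" "dynkin_D_parent n n = ?c"
    "\<And>i. i < ?c \<Longrightarrow> dynkin_D_parent n i = Suc i"
    using leaf_vertex(3)[OF l1] leaf_vertex(3)[OF l2] by (auto simp: dynkin_D_parent_def)
  have ne: "n - 1 \<noteq> ?c" "n \<noteq> ?c" "n - 1 \<noteq> n" "\<not> n - 1 \<le> ?c" "\<not> n \<le> ?c" using n by auto
  have "(\<exists>x. x \<noteq> 0 \<and> V ?c = span {x}) \<or>
    (\<exists>a b. frame (V ?c) a b \<and> a \<noteq> 0 \<and> b \<noteq> 0 \<and> ?A (n - 1) = span {a} \<and> ?A n = span {b} \<and>
      span {a + b} \<in> arm_chain V R ?c)"
    using subspace_V[OF cn(1)] c chain_arm[OF order_refl] subspace_edge_subspace[OF e1]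
      subspace_edge_subspace[OF e2]
    by (rule chain_two_subspaces_indecomposable) (rule center_no_splitting[OF c])
  then show ?thesis
  proof (elim disjE exE conjE)
    fix x assume x: "x \<noteq> 0" "V ?c = span {x}"
    obtain a where a: "a ?c = x" "\<And>j. j \<le> ?c \<Longrightarrow> V j = span {a j}"
      "\<And>j. j < ?c \<Longrightarrow> edge_ok (d j) (f j) (a j) (a (Suc j))"
      "\<And>j. j < ?c \<Longrightarrow> a j \<noteq> 0 \<Longrightarrow> a (Suc j) \<noteq> 0"
      using thin_main_arm[OF order_refl c x(2)] by blast
    obtain y where y: "V (n - 1) = span {y}" "edge_ok (d (n - 1)) (f (n - 1)) y x"
      using thin_step[OF e1 p1 x(2)] by blast
    obtain z where z: "V n = span {z}" "edge_ok (d n) (f n) z x"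
      using thin_step[OF e2 p2 x(2)] by blast
    define a' where "a' j = (if j \<le> ?c then a j else if j = n - 1 then y else z)" for j
    have a': "a' (n - 1) = y" "a' n = z" "a' ?c = x" "\<And>j. j \<le> ?c \<Longrightarrow> a' j = a j"
      using ne a(1) by (simp_all add: a'_def)
    have "row_system n V d f a' (\<lambda>_. 0) ?c False"
    proof (rule row_system_line)
      fix i assume i: "i \<in> {1..n}"
      show "V i = span {a' i}" using i
        by (cases rule: vertex_cases) (use a(2)[of i] a' y z in auto)
      show "edge_ok (d i) (f i) (a' i) (a' (dynkin_D_parent n i))" if "i \<noteq> ?c" using i
        by (cases rule: vertex_cases) (use that a(3)[of i] a' y z par in auto)
      show "i \<noteq> ?c \<and> a' (dynkin_D_parent n i) \<noteq> 0" if "i \<noteq> ?c" "a' i \<noteq> 0" using i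
        by (cases rule: vertex_cases) (use that a(4)[of i] a' x par in auto)
    qed (use x a' cn in auto)
    then show ?thesis by blast
  next
    fix a\<^sub>0 b\<^sub>0 assume fr: "frame (V ?c) a\<^sub>0 b\<^sub>0" and nz: "a\<^sub>0 \<noteq> 0" "b\<^sub>0 \<noteq> 0"
      and A: "?A (n - 1) = span {a\<^sub>0}" and B: "?A n = span {b\<^sub>0}"
      and mem: "span {a\<^sub>0 + b\<^sub>0} \<in> arm_chain V R ?c"
    define e\<^sub>1 where "e\<^sub>1 = a\<^sub>0 + b\<^sub>0"
    \<comment> \<open>The sign fits the leaf \<open>n - 1\<close> with coefficient 1: the generator
      \<open>a\<^sub>0\<close> of its line is \<open>e\<^sub>1 + e\<^sub>2\<close> for an inward
      arrow, and \<open>e\<^sub>1 - e\<^sub>2\<close>, which is in the kernel, for an outward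
      one.\<close>
    define e\<^sub>2 where "e\<^sub>2 = (if d (n - 1) then - b\<^sub>0 else b\<^sub>0)"
    note fr' = frameD[OF fr]
    have "e\<^sub>1 \<noteq> 0"
    proof
      assume "e\<^sub>1 = 0"
      then have "1 *s a\<^sub>0 + 1 *s b\<^sub>0 = 0" by (simp add: e\<^sub>1_def)
      then show False using fr'(2)[of 1 1] nz by simp
    qed
    have "e\<^sub>2 \<noteq> 0" using nz by (simp add: e\<^sub>2_def)
    have span_e\<^sub>2: "span {e\<^sub>2} = span {b\<^sub>0}"
    proof -
      have "span {- b\<^sub>0} = span {b\<^sub>0}"
      proof -
        have "- (- b\<^sub>0) \<in> span {- b\<^sub>0}" "- b\<^sub>0 \<in> span {b\<^sub>0}"
          by (intro span_neg span_base, simp)+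
        then show ?thesis by (simp add: span_eq)
      qed
      then show ?thesis by (simp add: e\<^sub>2_def)
    qed
    have fre: "frame (V ?c) e\<^sub>1 e\<^sub>2"
      unfolding frame_def
    proof (intro conjI allI impI)
      \<comment> \<open>A sign with square 1 covers both orientations in one computation.\<close>
      define \<epsilon> :: 'a where "\<epsilon> = (if d (n - 1) then - 1 else 1)"
      have e\<^sub>2: "e\<^sub>2 = \<epsilon> *s b\<^sub>0" and \<epsilon>: "\<epsilon> * \<epsilon> = 1" by (auto simp: e\<^sub>2_def \<epsilon>_def)
      have comb: "s *s e\<^sub>1 + t *s e\<^sub>2 = s *s a\<^sub>0 + (s + t * \<epsilon>) *s b\<^sub>0" for s t
        by (simp add: e\<^sub>1_def e\<^sub>2 algebra_simps)
      show "V ?c = span {e\<^sub>1, e\<^sub>2}"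
      proof
        show "V ?c \<subseteq> span {e\<^sub>1, e\<^sub>2}"
        proof
          fix v assume "v \<in> V ?c"
          then obtain s t where st: "v = s *s a\<^sub>0 + t *s b\<^sub>0" using fr'(7) by blast
          have "s + ((t - s) * \<epsilon>) * \<epsilon> = t" using \<epsilon> by (simp add: mult.assoc)
          then have "v = s *s e\<^sub>1 + ((t - s) * \<epsilon>) *s e\<^sub>2" unfolding comb st by simp
          then show "v \<in> span {e\<^sub>1, e\<^sub>2}" unfolding in_span_pair by blast
        qed
        have "e\<^sub>1 \<in> V ?c" unfolding e\<^sub>1_def by (rule subspace_add) (fact fr')+
        moreover have "e\<^sub>2 \<in> V ?c" unfolding e\<^sub>2 by (rule subspace_scale) (fact fr')+
        ultimately show "span {e\<^sub>1, e\<^sub>2} \<subseteq> V ?c" using fr'(6) by (intro span_minimal) auto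
      qed
      fix s t assume "s *s e\<^sub>1 + t *s e\<^sub>2 = 0"
      then have "s *s a\<^sub>0 + (s + t * \<epsilon>) *s b\<^sub>0 = 0" unfolding comb .
      from fr'(2)[OF this] fr'(3)[OF this] have "s = 0" "s + t * \<epsilon> = 0" using nz by simp_all
      then have "s = 0" "t = 0" using \<epsilon> by auto
      then show "s *s e\<^sub>1 = 0" "t *s e\<^sub>2 = 0" by simp_all
    qed
    have "\<exists>a b. a ?c = e\<^sub>1 \<and> b ?c = e\<^sub>2 \<and> (\<forall>j\<le>?c. frame (V j) (a j) (b j)) \<and>
      (\<forall>j<?c. edge_ok (d j) (f j) (a j) (a (Suc j)) \<and> (a j \<noteq> 0 \<longrightarrow> a (Suc j) \<noteq> 0) \<and>
             edge_ok (d j) (f j) (b j) (b (Suc j)) \<and> (b j \<noteq> 0 \<longrightarrow> b (Suc j) \<noteq> 0))"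
      using edge_arm presents_arm[OF order_refl c] subspace_V[of 0] fre \<open>e\<^sub>1 \<noteq> 0\<close> \<open>e\<^sub>2 \<noteq> 0\<close> mem
      unfolding e\<^sub>1_def[symmetric] by (intro thick_arm) auto
    then obtain a b where ab: "a ?c = e\<^sub>1" "b ?c = e\<^sub>2" "\<And>j. j \<le> ?c \<Longrightarrow> frame (V j) (a j) (b j)"
      "\<And>j. j < ?c \<Longrightarrow> edge_ok (d j) (f j) (a j) (a (Suc j))" "\<And>j. j < ?c \<Longrightarrow> a j \<noteq> 0 \<Longrightarrow> a (Suc j) \<noteq> 0"
      "\<And>j. j < ?c \<Longrightarrow> edge_ok (d j) (f j) (b j) (b (Suc j))" "\<And>j. j < ?c \<Longrightarrow> b j \<noteq> 0 \<Longrightarrow> b (Suc j) \<noteq> 0"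
      by (elim exE conjE) simp
    \<comment> \<open>\<open>leaf_line\<close> concerns the leaf belonging to the second vector of a
      frame; for \<open>n - 1\<close> the two vectors trade places.\<close>
    have fr_sym: "frame (V ?c) b\<^sub>0 a\<^sub>0"
    proof -
      have "s *s b\<^sub>0 = 0 \<and> t *s a\<^sub>0 = 0" if "s *s b\<^sub>0 + t *s a\<^sub>0 = 0" for s t
      proof -
        have "t *s a\<^sub>0 + s *s b\<^sub>0 = 0" using that by (simp only: add.commute)
        from fr'(2,3)[OF this] show ?thesis by blast
      qed
      then show ?thesis using fr'(1) unfolding frame_def by (metis insert_commute)
    qed
    obtain z where z: "z \<noteq> 0" "V (n - 1) = span {z}"
      "if d (n - 1) then f (n - 1) z = e\<^sub>1 + e\<^sub>2 else f (n - 1) e\<^sub>1 = z \<and> f (n - 1) e\<^sub>2 = z"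
    proof (cases "d (n - 1)")
      case True
      then have "e\<^sub>1 + e\<^sub>2 = a\<^sub>0" by (simp add: e\<^sub>1_def e\<^sub>2_def)
      then show ?thesis
        using leaf_line[OF e1 p1 fr_sym nz(2,1) A refl] True that by auto
    next
      case False
      have l: "linear_between scale (V ?c) scale (V (n - 1)) (f (n - 1))" using e1 False by (simp add: edge_def)
      have *: "V (n - 1) = span {f (n - 1) b\<^sub>0}" "f (n - 1) b\<^sub>0 \<noteq> 0" "f (n - 1) a\<^sub>0 = 0"
        using leaf_line[OF e1 p1 fr_sym nz(2,1) A refl] False by simp_all
      then have "f (n - 1) e\<^sub>1 = f (n - 1) b\<^sub>0"
        using linear_betweenD(2)[OF l fr'(6,4,5)] by (simp add: e\<^sub>1_def)
      then show ?thesis using * False that[of "f (n - 1) b\<^sub>0"] by (simp add: e\<^sub>2_def)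
    qed
    \<comment> \<open>At the vertex \<open>n\<close> one row stops: an inward arrow has the line of
      \<open>e\<^sub>2\<close> as its image, an outward one kills that line.\<close>
    obtain u w where uw: "frame (V n) u w" "edge_ok (d n) (f n) u e\<^sub>1" "edge_ok (d n) (f n) w e\<^sub>2"
    proof (cases "d n")
      case True
      then obtain w where "w \<noteq> 0" "V n = span {w}" "f n w = e\<^sub>2"
        using leaf_line[OF e2 p2 fr nz B span_e\<^sub>2] by auto
      then show ?thesis using that[of 0 w] True by (simp add: frame_line edge_ok_def)
    next
      case False
      have l: "linear_between scale (V ?c) scale (V n) (f n)" using e2 False by (simp add: edge_def)
      note l' = linear_betweenD[OF l fr'(6)]
      have *: "V n = span {f n a\<^sub>0}" "f n b\<^sub>0 = 0"
        using leaf_line[OF e2 p2 fr nz B refl] False by simp_all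
      have "f n e\<^sub>1 = f n a\<^sub>0" using l'(2)[OF fr'(4,5)] *(2) by (simp add: e\<^sub>1_def)
      moreover have "f n e\<^sub>2 = 0" using l'(3)[OF fr'(5), of "-1"] *(2) by (simp add: e\<^sub>2_def)
      ultimately show ?thesis
        using that[of "f n a\<^sub>0" 0] *(1) False by (simp add: frame_line edge_ok_def)
    qed
    define a' where "a' j = (if j \<le> ?c then a j else if j = n - 1 then z else u)" for j
    define b' where "b' j = (if j \<le> ?c then b j else if j = n - 1 then 0 else w)" for j
    have a': "a' (n - 1) = z" "a' n = u" "a' ?c = e\<^sub>1" "\<And>j. j \<le> ?c \<Longrightarrow> a' j = a j"
      using ne ab(1) by (simp_all add: a'_def)
    have b': "b' (n - 1) = 0" "b' n = w" "b' ?c = e\<^sub>2" "\<And>j. j \<le> ?c \<Longrightarrow> b' j = b j"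
      using ne ab(2) by (simp_all add: b'_def)
    have "row_system n V d f a' b' ?c True"
      unfolding row_system_def
    proof (intro conjI ballI impI)
      show "a' ?c \<noteq> 0" using a' \<open>e\<^sub>1 \<noteq> 0\<close> by simp
      show "if True then ?c = ?c \<and> b' ?c \<noteq> 0 \<and> a' (n - 1) \<noteq> 0 \<and> b' (n - 1) = 0
          else \<forall>i\<in>{1..n}. b' i = 0"
        using a' b' z \<open>e\<^sub>2 \<noteq> 0\<close> by simp
      fix i assume i: "i \<in> {1..n}"
      show "frame (V i) (a' i) (b' i)" using i
        by (cases rule: vertex_cases) (use ab(3)[of i] a' b' z uw frame_line in auto)
      show "a' (dynkin_D_parent n i) \<noteq> 0" if "a' i \<noteq> 0 \<and> i \<noteq> ?c" using i
        by (cases rule: vertex_cases) (use that ab(5)[of i] a' \<open>e\<^sub>1 \<noteq> 0\<close> par in auto)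
      show "b' (dynkin_D_parent n i) \<noteq> 0" if "b' i \<noteq> 0" using i
        by (cases rule: vertex_cases)
          (use that ab(7)[of i] b' \<open>e\<^sub>2 \<noteq> 0\<close> par in \<open>auto simp: dynkin_D_parent_def\<close>)
      show "if True \<and> i = n - 1
        then if d i then f i (a' i) = a' ?c + b' ?c else f i (a' ?c) = a' i \<and> f i (b' ?c) = a' i
        else edge_ok (d i) (f i) (a' i) (a' (dynkin_D_parent n i)) \<and>
             edge_ok (d i) (f i) (b' i) (b' (dynkin_D_parent n i))" if "i \<noteq> ?c"
        using i
      proof (cases rule: vertex_cases)
        case 1
        then have "i \<noteq> n - 1" by simp
        then show ?thesis using 1 ab(4,6)[of i] a' b' par by simp
      next
        case 2
        then show ?thesis using that by simp
      next
        case 3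
        then show ?thesis using a' b' z(3) uw par ne by auto
      qed
    qed (use cn in auto)
    then show ?thesis by blast
  qed
qed

theorem ex_row_system: "\<exists>a b k ex. row_system n V d f a b k ex"
  using row_system_small row_system_big by blast

end

section \<open>Rooted quivers and tree modules\<close>

text \<open>Each arrow is named by its end farther from the root, so that the parent function alone
  fixes the underlying tree and \<open>up\<close> only the orientations.\<close>

definition rooted_quiver :: "'v set \<Rightarrow> 'v \<Rightarrow> ('v \<Rightarrow> 'v) \<Rightarrow> ('v \<Rightarrow> bool) \<Rightarrow> ('v, 'v) pre_digraph" where
  "rooted_quiver N r p up = \<lparr> verts = N, arcs = N - {r},
     tail = (\<lambda>x. if up x then x else p x), head = (\<lambda>x. if up x then p x else x) \<rparr>"

text \<open>\<open>rk\<close> need not be the distance to the root; any function that drops from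
  each vertex to its parent supports the inductions.\<close>

locale rooted_parent =
  fixes N :: "'v set" and r :: 'v and p :: "'v \<Rightarrow> 'v" and up :: "'v \<Rightarrow> bool" and rk :: "'v \<Rightarrow> nat"
  assumes finite_N: "finite N" and root: "r \<in> N"
    and parent: "\<And>x. x \<in> N \<Longrightarrow> x \<noteq> r \<Longrightarrow> p x \<in> N \<and> rk (p x) < rk x"
begin

abbreviation "T \<equiv> rooted_quiver N r p up"

text \<open>Movement towards the root, whether the arrow is traversed forwards or backwards.\<close>

definition ascending :: "'v \<times> bool \<Rightarrow> bool" where
  "ascending s \<longleftrightarrow> snd s = up (fst s)"

lemma rooted_quiver_simps [simp]: "verts T = N" "arcs T = N - {r}"
  "tail T = (\<lambda>x. if up x then x else p x)" "head T = (\<lambda>x. if up x then p x else x)"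
  by (simp_all add: rooted_quiver_def)

lemma step_ends:
  "step_from T s = (if ascending s then fst s else p (fst s))"
  "step_to T s = (if ascending s then p (fst s) else fst s)"
  by (auto simp: step_from_def step_to_def ascending_def)

lemma fin_digraph_T: "fin_digraph T"
  by unfold_locales (use parent finite_N in auto)

section \<open>Reduced walks in a rooted quiver\<close>

text \<open>After moving down to a vertex, the only way up is the arrow just used, which a reduced
  walk may not take back. So a walk that starts downwards keeps going down.\<close>

lemma descending_walk:
  assumes "undirected_walk T u (s # q) v" "reduced_walk (s # q)" "\<not> ascending s"
  shows "rk u < rk v \<and> \<not> ascending (last (s # q))"
  using assms
proof (induction q arbitrary: u s)
  case Nil
  then have "fst s \<in> N" "fst s \<noteq> r" "u = p (fst s)" "v = fst s" by (auto simp: step_ends)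
  then show ?case using parent Nil by simp
next
  case (Cons t q)
  then have s: "fst s \<in> N" "fst s \<noteq> r" "u = p (fst s)" and t: "undirected_walk T (fst s) (t # q) v"
    by (auto simp: step_ends)
  have red: "reduced_walk (t # q)" "\<not> (fst s = fst t \<and> snd s \<noteq> snd t)"
    using Cons.prems(2) by (auto simp: reduced_walk_def)
  have "\<not> ascending t"
  proof
    assume a: "ascending t"
    then have "fst t = fst s" using t by (simp add: step_ends)
    then show False using red(2) a Cons.prems(3) by (auto simp: ascending_def)
  qed
  then have "rk (fst s) < rk v \<and> \<not> ascending (last (t # q))"
    using Cons.IH[OF t red(1)] by blast
  moreover have "rk u < rk (fst s)" using parent s by simp
  ultimately show ?case by simp
qed

text \<open>No descent can come before a final ascent, so such a walk ascends throughout.\<close>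

lemma ascending_walk:
  assumes "undirected_walk T u (s # q) v" "reduced_walk (s # q)" "ascending (last (s # q))"
  shows "rk v < rk u"
  using assms
proof (induction q arbitrary: u s)
  case Nil
  then show ?case using parent by (auto simp: step_ends)
next
  case (Cons t q)
  have "ascending s" using descending_walk[OF Cons.prems(1,2)] Cons.prems(3) by blast
  then have s: "fst s \<in> N" "fst s \<noteq> r" "u = fst s" and t: "undirected_walk T (p (fst s)) (t # q) v"
    using Cons.prems(1) by (auto simp: step_ends)
  have "rk v < rk (p (fst s))"
    using Cons.IH[OF t] Cons.prems(2,3) by (auto simp: reduced_walk_def)
  then show ?case using parent[OF s(1,2)] s(3) by simp
qed

lemma undirected_walk_snoc:
  assumes "undirected_walk T u (q @ [t]) v"
  shows "fst t \<in> N - {r} \<and> undirected_walk T u q (step_from T t) \<and> step_to T t = v"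
  using assms
proof (induction q arbitrary: u)
  case Nil
  then show ?case using parent by (auto simp: step_ends)
next
  case (Cons s q)
  then show ?case by auto
qed

text \<open>A nonempty closed reduced walk at u would start upwards and end downwards, so its first
  and last steps both use the arrow named by u. Removing them leaves a shorter closed reduced walk
  at the parent, empty by induction, and the two removed steps form a backtrack.\<close>

lemma closed_reduced_walk_empty:
  assumes "undirected_walk T u w u" "reduced_walk w"
  shows "w = []"
  using assms
proof (induction "length w" arbitrary: u w rule: less_induct)
  case less
  show ?case
  proof (rule ccontr)
    assume "w \<noteq> []"
    then obtain s q where w: "w = s # q" by (cases w) auto
    have asc: "ascending s" using descending_walk less.prems unfolding w by blast
    have desc: "\<not> ascending (last w)" using ascending_walk less.prems unfolding w by blast
    have "q \<noteq> []" using asc desc w by auto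
    then obtain q' t where q: "q = q' @ [t]" by (metis rev_exhaust)
    have s: "u = fst s" "undirected_walk T (p u) (q' @ [t]) u"
      using less.prems(1) asc unfolding w q by (auto simp: step_ends)
    have t: "\<not> ascending t" using desc unfolding w q by simp
    then have "u = fst t" "undirected_walk T (p u) q' (p u)"
      using undirected_walk_snoc[OF s(2)] by (auto simp: step_ends)
    moreover have "reduced_walk q'"
      using less.prems(2) unfolding w q reduced_walk_def by (auto simp: successively_Cons successively_append_iff)
    ultimately have "q' = []" using less.hyps[of q' "p u"] unfolding w q by simp
    then have "\<not> (fst s = fst t \<and> snd s \<noteq> snd t)"
      using less.prems(2) unfolding w q by (simp add: reduced_walk_def)
    then show False using s(1) \<open>u = fst t\<close> asc t by (auto simp: ascending_def)
  qed
qed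

lemma tree_quiver_T: "tree_quiver T"
proof -
  let ?S = "(arcs_ends T)\<^sup>s"
  have step: "(x, p x) \<in> ?S" "(p x, x) \<in> ?S" if "x \<in> N" "x \<noteq> r" for x
  proof -
    have "(tail T x, head T x) \<in> arcs_ends T"
      using that by (force simp: arcs_ends_def arc_to_ends_def)
    then have "(x, p x) \<in> arcs_ends T \<or> (p x, x) \<in> arcs_ends T" by (auto split: if_splits)
    then show "(x, p x) \<in> ?S" "(p x, x) \<in> ?S" by (auto simp: symcl_def)
  qed
  have reach: "(x, r) \<in> rtrancl_on N ?S \<and> (r, x) \<in> rtrancl_on N ?S" if "x \<in> N" for x
    using that
  proof (induction "rk x" arbitrary: x rule: less_induct)
    case less
    show ?case
    proof (cases "x = r")
      case True
      then show ?thesis using root by simp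
    next
      case False
      then have "p x \<in> N" "rk (p x) < rk x" using parent less.prems by auto
      then have "(p x, r) \<in> rtrancl_on N ?S" "(r, p x) \<in> rtrancl_on N ?S" using less.hyps by auto
      then show ?thesis
        using step[OF less.prems False] less.prems
        by (auto intro: converse_rtrancl_on_into_rtrancl_on rtrancl_on_into_rtrancl_on)
    qed
  qed
  have "connected T"
    unfolding connected_conv rooted_quiver_simps(1)
  proof (intro conjI ballI)
    show "N \<noteq> {}" using root by blast
    show "(u, v) \<in> rtrancl_on N ?S" if "u \<in> N" "v \<in> N" for u v
      using reach[OF that(1)] reach[OF that(2)] rtrancl_on_trans by metis
  qed
  then show ?thesis
    using fin_digraph_T closed_reduced_walk_empty by (auto simp: tree_quiver_def)
qed

end

section \<open>From an adapted basis to a tree module\<close>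

lemma sum_fun_apply: "(\<Sum>i\<in>I. f i) x = (\<Sum>i\<in>I. (f i :: 'v \<Rightarrow> 'k::comm_monoid_add) x)"
  by (induction I rule: infinite_finite_induct) simp_all

lemma span_basis_vec:
  assumes "finite N"
  shows "module.span fun_scale (basis_vec ` N :: ('v \<Rightarrow> 'k::field) set) = {\<phi>. \<forall>m. m \<notin> N \<longrightarrow> \<phi> m = 0}"
proof -
  interpret vector_space "fun_scale :: 'k \<Rightarrow> ('v \<Rightarrow> 'k) \<Rightarrow> 'v \<Rightarrow> 'k"
    by (rule vector_space_fun_scale)
  show ?thesis
  proof
    show "span (basis_vec ` N :: ('v \<Rightarrow> 'k) set) \<subseteq> {\<phi>. \<forall>m. m \<notin> N \<longrightarrow> \<phi> m = 0}"
      by (intro span_minimal subspaceI) (auto simp: basis_vec_def fun_scale_def)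
    show "{\<phi>. \<forall>m. m \<notin> N \<longrightarrow> \<phi> m = 0} \<subseteq> span (basis_vec ` N :: ('v \<Rightarrow> 'k) set)"
    proof
      fix \<phi> :: "'v \<Rightarrow> 'k" assume \<phi>: "\<phi> \<in> {\<phi>. \<forall>m. m \<notin> N \<longrightarrow> \<phi> m = 0}"
      have "\<phi> x = (\<Sum>m\<in>N. fun_scale (\<phi> m) (basis_vec m)) x" for x
      proof -
        have "(\<Sum>m\<in>N. fun_scale (\<phi> m) (basis_vec m)) x = (\<Sum>m\<in>N. if x = m then \<phi> m else 0)"
          unfolding sum_fun_apply by (intro sum.cong) (auto simp: fun_scale_def basis_vec_def)
        also have "\<dots> = \<phi> x" using assms \<phi> by auto
        finally show ?thesis ..
      qed
      then have "\<phi> = (\<Sum>m\<in>N. fun_scale (\<phi> m) (basis_vec m))" by blast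
      also have "\<dots> \<in> span (basis_vec ` N)" by (intro span_sum span_scale span_base) auto
      finally show "\<phi> \<in> span (basis_vec ` N)" .
    qed
  qed
qed

context ambient_space
begin

lemma linear_between_sum:
  assumes l: "linear_between scale V scale W f" and V: "subspace V" and I: "finite I"
    and x: "\<And>i. i \<in> I \<Longrightarrow> x i \<in> V"
  shows "f (\<Sum>i\<in>I. t i *s x i) = (\<Sum>i\<in>I. t i *s f (x i))"
  using I x
proof (induction I rule: finite_induct)
  case empty
  then show ?case using linear_betweenD(4)[OF l V] by simp
next
  case (insert i I)
  have "(\<Sum>i\<in>I. t i *s x i) \<in> V" using insert.prems V by (intro subspace_sum subspace_scale) auto
  then show ?case
    using insert linear_betweenD(2,3)[OF l V] subspace_scale[OF V] by simp
qed

text \<open>Reduces the isomorphism to a basis w of M, indexed by the vertices of T, on which the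
  arrows act as in the tree module. The natural map \<psi> leads from coefficient functions to M;
  since the isomorphism is asked for in the other direction, its inverse h at each vertex is
  taken.\<close>

lemma isomorphic_reps_tree_rep:
  fixes Q :: "('w, 'e) pre_digraph" and M :: "('w, 'e, 'a, 'b) quiver_rep"
    and T :: "('v, 'f) pre_digraph" and w :: "'v \<Rightarrow> 'b"
  assumes Q: "wf_digraph Q" and M: "quiver_representation Q M" and scale: "rep_scale M = scale"
    and T: "fin_digraph T" and mor: "quiver_morphism T Q F\<^sub>0 F\<^sub>1"
    and mem: "\<And>m. m \<in> verts T \<Longrightarrow> w m \<in> rep_space M (F\<^sub>0 m)"
    and gen: "\<And>q x. q \<in> verts Q \<Longrightarrow> x \<in> rep_space M q \<Longrightarrow>
      \<exists>\<phi>. x = (\<Sum>m\<in>{m \<in> verts T. F\<^sub>0 m = q}. \<phi> m *s w m)"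
    and indep: "\<And>q \<phi> m. q \<in> verts Q \<Longrightarrow> (\<Sum>m\<in>{m \<in> verts T. F\<^sub>0 m = q}. \<phi> m *s w m) = 0 \<Longrightarrow>
      m \<in> verts T \<Longrightarrow> F\<^sub>0 m = q \<Longrightarrow> \<phi> m = 0"
    and act: "\<And>\<gamma> m. \<gamma> \<in> arcs Q \<Longrightarrow> m \<in> verts T \<Longrightarrow> F\<^sub>0 m = tail Q \<gamma> \<Longrightarrow>
      rep_map M \<gamma> (w m) = (\<Sum>a | a \<in> arcs T \<and> tail T a = m \<and> F\<^sub>1 a = \<gamma>. w (head T a))"
  shows "isomorphic_reps Q M (tree_rep T F\<^sub>0 F\<^sub>1 :: ('w, 'e, 'a, 'v \<Rightarrow> 'a) quiver_rep)"
proof -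
  interpret Q: wf_digraph Q by (rule Q)
  interpret T: fin_digraph T by (rule T)
  interpret fs: vector_space "fun_scale :: 'a \<Rightarrow> ('v \<Rightarrow> 'a) \<Rightarrow> 'v \<Rightarrow> 'a"
    by (rule vector_space_fun_scale)
  let ?N = "\<lambda>q. {m \<in> verts T. F\<^sub>0 m = q}"
  let ?TR = "tree_rep T F\<^sub>0 F\<^sub>1 :: ('w, 'e, 'a, 'v \<Rightarrow> 'a) quiver_rep"
  let ?S = "rep_space ?TR"
  define \<psi> where "\<psi> \<phi> = (\<Sum>m\<in>verts T. \<phi> m *s w m)" for \<phi>
  interpret psi: Vector_Spaces.linear "fun_scale :: 'a \<Rightarrow> ('v \<Rightarrow> 'a) \<Rightarrow> 'v \<Rightarrow> 'a" scale \<psi>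
    by unfold_locales
      (simp_all add: \<psi>_def fun_scale_def scale_left_distrib sum.distrib scale_sum_right)
  have TR: "quiver_representation Q ?TR" by (rule quiver_representation_tree_rep[OF T mor])
  have finN: "finite (?N q)" for q by simp
  have S: "?S q = {\<phi>. \<forall>m. m \<notin> ?N q \<longrightarrow> \<phi> m = 0}" for q
    using span_basis_vec[OF finN[of q]] by (simp add: tree_rep_def)
  have memN: "w m \<in> rep_space M q" if "m \<in> ?N q" for m q
    using mem[of m] that by simp
  have sub: "subspace (rep_space M q)" if "q \<in> verts Q" for q
    using M that by (simp add: quiver_representation_def scale)
  have lin: "linear_between scale (rep_space M (tail Q \<gamma>)) scale (rep_space M (head Q \<gamma>)) (rep_map M \<gamma>)"
    if "\<gamma> \<in> arcs Q" for \<gamma>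
    using M that by (simp add: quiver_representation_def scale)
  have \<psi>_S: "\<psi> \<phi> = (\<Sum>m\<in>?N q. \<phi> m *s w m)" if "\<phi> \<in> ?S q" for \<phi> q
    unfolding \<psi>_def using that by (intro sum.mono_neutral_right) (auto simp: S)
  have \<psi>_mem: "\<psi> \<phi> \<in> rep_space M q" if "q \<in> verts Q" "\<phi> \<in> ?S q" for \<phi> q
    unfolding \<psi>_S[OF that(2)] using sub[OF that(1)] mem by (intro subspace_sum subspace_scale) auto
  have S_add: "\<phi> + \<phi>' \<in> ?S q" if "\<phi> \<in> ?S q" "\<phi>' \<in> ?S q" for \<phi> \<phi>' q
    using that by (simp add: S)
  have S_scale: "fun_scale c \<phi> \<in> ?S q" if "\<phi> \<in> ?S q" for c \<phi> q
    using that by (simp add: S fun_scale_def)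
  have inj: "inj_on \<psi> (?S q)" if q: "q \<in> verts Q" for q
  proof (rule inj_onI)
    fix \<phi> \<phi>' assume *: "\<phi> \<in> ?S q" "\<phi>' \<in> ?S q" "\<psi> \<phi> = \<psi> \<phi>'"
    have "\<phi> - \<phi>' \<in> ?S q" using *(1,2) by (simp add: S)
    moreover have "\<psi> (\<phi> - \<phi>') = 0" using *(3) by (simp add: psi.diff)
    ultimately have "(\<Sum>m\<in>?N q. (\<phi> - \<phi>') m *s w m) = 0" using \<psi>_S by metis
    then have "(\<phi> - \<phi>') m = 0" if "m \<in> ?N q" for m using indep[OF q] that by blast
    then have "\<phi> m = \<phi>' m" for m using *(1,2) by (cases "m \<in> ?N q") (auto simp: S)
    then show "\<phi> = \<phi>'" by blast
  qed
  have img: "\<psi> ` ?S q = rep_space M q" if q: "q \<in> verts Q" for q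
  proof
    show "\<psi> ` ?S q \<subseteq> rep_space M q" using \<psi>_mem[OF q] by blast
    show "rep_space M q \<subseteq> \<psi> ` ?S q"
    proof
      fix x assume "x \<in> rep_space M q"
      then obtain \<phi> where \<phi>: "x = (\<Sum>m\<in>?N q. \<phi> m *s w m)" using gen[OF q] by blast
      let ?\<phi> = "\<lambda>m. if m \<in> ?N q then \<phi> m else 0"
      have "?\<phi> \<in> ?S q" by (simp add: S)
      moreover from \<psi>_S[OF this] have "\<psi> ?\<phi> = x" unfolding \<phi> by simp
      ultimately show "x \<in> \<psi> ` ?S q" by blast
    qed
  qed
  define h where "h q = the_inv_into (?S q) \<psi>" for q
  have h_\<psi>: "h q (\<psi> \<phi>) = \<phi>" if "q \<in> verts Q" "\<phi> \<in> ?S q" for q \<phi>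
    unfolding h_def by (rule the_inv_into_f_f[OF inj[OF that(1)] that(2)])
  have \<psi>_obtain: "\<exists>\<phi>\<in>?S q. x = \<psi> \<phi>" if "q \<in> verts Q" "x \<in> rep_space M q" for q x
    using img[OF that(1)] that(2) by blast
  have "linear_between scale (rep_space M q) (rep_scale ?TR) (?S q) (h q)" if q: "q \<in> verts Q" for q
    unfolding linear_between_def
  proof (intro conjI ballI allI)
    fix x assume "x \<in> rep_space M q"
    then obtain \<phi> where \<phi>: "\<phi> \<in> ?S q" "x = \<psi> \<phi>" using \<psi>_obtain[OF q] by blast
    show "h q x \<in> ?S q" using \<phi> h_\<psi>[OF q] by simp
    show "h q (c *s x) = rep_scale ?TR c (h q x)" for c
      using h_\<psi>[OF q \<phi>(1)] h_\<psi>[OF q S_scale[OF \<phi>(1)], of c] unfolding \<phi>(2)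
      by (simp add: psi.scale tree_rep_def)
    fix y assume "y \<in> rep_space M q"
    then obtain \<phi>' where \<phi>': "\<phi>' \<in> ?S q" "y = \<psi> \<phi>'" using \<psi>_obtain[OF q] by blast
    show "h q (x + y) = h q x + h q y"
      using h_\<psi>[OF q \<phi>(1)] h_\<psi>[OF q \<phi>'(1)] h_\<psi>[OF q S_add[OF \<phi>(1) \<phi>'(1)]] unfolding \<phi>(2) \<phi>'(2)
      by (simp add: psi.add)
  qed
  moreover have "bij_betw (h q) (rep_space M q) (?S q)" if q: "q \<in> verts Q" for q
  proof -
    have "bij_betw \<psi> (?S q) (rep_space M q)" using inj[OF q] img[OF q] by (simp add: bij_betw_def)
    then show ?thesis unfolding h_def by (rule bij_betw_the_inv_into)
  qed
  moreover have "h (head Q \<gamma>) (rep_map M \<gamma> x) = rep_map ?TR \<gamma> (h (tail Q \<gamma>) x)"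
    if \<gamma>: "\<gamma> \<in> arcs Q" and x: "x \<in> rep_space M (tail Q \<gamma>)" for \<gamma> x
  proof -
    have tv: "tail Q \<gamma> \<in> verts Q" and hv: "head Q \<gamma> \<in> verts Q" using \<gamma> by auto
    obtain \<phi> where \<phi>: "\<phi> \<in> ?S (tail Q \<gamma>)" "x = \<psi> \<phi>" using \<psi>_obtain[OF tv x] by blast
    have \<psi>_basis: "\<psi> (basis_vec m) = w m" if "m \<in> verts T" for m
    proof -
      have "\<psi> (basis_vec m) = (\<Sum>m'\<in>verts T. if m' = m then w m' else 0)"
        unfolding \<psi>_def basis_vec_def by (intro sum.cong) auto
      then show ?thesis using that by simp
    qed
    \<comment> \<open>Equivariance is verified for \<psi>, where it is a computation with sums, and
      carries over to the inverse.\<close>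
    have "\<psi> (rep_map ?TR \<gamma> \<phi>) =
        (\<Sum>m\<in>verts T. \<phi> m *s (\<Sum>a | a \<in> arcs T \<and> tail T a = m \<and> F\<^sub>1 a = \<gamma>. w (head T a)))"
      by (simp add: tree_rep_def psi.sum psi.scale \<psi>_basis)
    also have "\<dots> = (\<Sum>m\<in>?N (tail Q \<gamma>). \<phi> m *s (\<Sum>a | a \<in> arcs T \<and> tail T a = m \<and> F\<^sub>1 a = \<gamma>. w (head T a)))"
      using \<phi>(1) by (intro sum.mono_neutral_right) (auto simp: S)
    also have "\<dots> = (\<Sum>m\<in>?N (tail Q \<gamma>). \<phi> m *s rep_map M \<gamma> (w m))"
      using act[OF \<gamma>] by (intro sum.cong) auto
    also have "\<dots> = rep_map M \<gamma> (\<Sum>m\<in>?N (tail Q \<gamma>). \<phi> m *s w m)"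
      by (rule linear_between_sum[OF lin[OF \<gamma>] sub[OF tv] finN, symmetric]) (rule memN)
    finally have "rep_map M \<gamma> x = \<psi> (rep_map ?TR \<gamma> \<phi>)" using \<phi> \<psi>_S by simp
    moreover have "rep_map ?TR \<gamma> \<phi> \<in> ?S (head Q \<gamma>)"
      using TR \<gamma> \<phi>(1) by (auto simp: quiver_representation_def linear_between_def)
    ultimately show ?thesis using h_\<psi>[OF hv] h_\<psi>[OF tv \<phi>(1)] \<phi>(2) by simp
  qed
  ultimately show ?thesis
    unfolding isomorphic_reps_def scale by (intro exI[of _ h]) blast
qed

end

section \<open>The tree of a pair of rows\<close>

text \<open>
  The vertices \<open>2 * i\<close> and \<open>2 * i + 1\<close> of the tree encode the row entries \<open>a i\<close> and \<open>b i\<close>. Each arrow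
  is labelled by its end further from the root \<open>2 * k\<close>; if both rows occur, \<open>2 * (n - 2) + 1\<close> is
  reached from the root through \<open>2 * (n - 1)\<close>.
\<close>

locale row_data = ambient_space scale
  for scale :: "'a::field \<Rightarrow> 'b::ab_group_add \<Rightarrow> 'b" (infixr "*s" 75) +
  fixes n :: nat and V :: "nat \<Rightarrow> 'b set" and d :: "nat \<Rightarrow> bool" and f :: "nat \<Rightarrow> 'b \<Rightarrow> 'b"
    and a b :: "nat \<Rightarrow> 'b" and k :: nat and ex :: bool
  assumes n: "4 \<le> n" and rows: "row_system n V d f a b k ex"
begin

definition w :: "nat \<Rightarrow> 'b" where
  "w x = (if even x then a (x div 2) else b (x div 2))"

definition N :: "nat set" where
  "N = {x. x div 2 \<in> {1..n} \<and> w x \<noteq> 0}"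

definition joint :: nat where
  "joint = 2 * (n - 2) + 1"

definition label :: "nat \<Rightarrow> nat" where
  "label x = (if x = joint then n - 1 else x div 2)"

definition p :: "nat \<Rightarrow> nat" where
  "p x = (if x = joint then 2 * (n - 1) else 2 * dynkin_D_parent n (x div 2) + x mod 2)"

text \<open>The parent of the joint is the copy of the leaf \<open>n - 1\<close>, whereas in the
  diagram the leaf has the branch vertex as parent; hence the negation.\<close>

definition up :: "nat \<Rightarrow> bool" where
  "up x = (if x = joint then \<not> d (n - 1) else d (x div 2))"

definition depth :: "nat \<Rightarrow> nat" where
  "depth i = (if i \<le> n - 2 then n - 2 - i else 1)"

text \<open>The weight 2 on row \<open>b\<close> puts the joint, of depth 0, above its parent, the
  copy of \<open>n - 1\<close> of depth 1. Along a single row the depth decides.\<close>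

definition rk :: "nat \<Rightarrow> nat" where
  "rk x = depth (x div 2) + 2 * (x mod 2)"

lemma in_N: "x \<in> N \<longleftrightarrow> x div 2 \<in> {1..n} \<and> w x \<noteq> 0"
  by (simp add: N_def)

lemma w_simps [simp]: "w (2 * i) = a i" "w (Suc (2 * i)) = b i"
  by (simp_all add: w_def)

lemma row_cases:
  fixes x :: nat
  obtains i where "x = 2 * i" | i where "x = 2 * i + 1"
  by (metis oddE evenE)

lemma rowsD:
  shows "k \<in> {1..n}" "a k \<noteq> 0"
    "\<And>i. i \<in> {1..n} \<Longrightarrow> frame (V i) (a i) (b i)"
    "\<And>i. i \<in> {1..n} \<Longrightarrow> a i \<noteq> 0 \<Longrightarrow> i \<noteq> k \<Longrightarrow> i \<noteq> n - 2 \<and> a (dynkin_D_parent n i) \<noteq> 0"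
    "k \<noteq> n - 2 \<Longrightarrow> a (dynkin_D_parent n k) = 0"
    "\<And>i. i \<in> {1..n} \<Longrightarrow> b i \<noteq> 0 \<Longrightarrow> b (dynkin_D_parent n i) \<noteq> 0"
    "ex \<Longrightarrow> k = n - 2 \<and> b (n - 2) \<noteq> 0 \<and> a (n - 1) \<noteq> 0 \<and> b (n - 1) = 0"
    "\<And>i. \<not> ex \<Longrightarrow> i \<in> {1..n} \<Longrightarrow> b i = 0"
    "\<And>i. i \<in> {1..n} \<Longrightarrow> i \<noteq> n - 2 \<Longrightarrow> \<not> (ex \<and> i = n - 1) \<Longrightarrow>
      edge_ok (d i) (f i) (a i) (a (dynkin_D_parent n i)) \<and> edge_ok (d i) (f i) (b i) (b (dynkin_D_parent n i))"
    "ex \<Longrightarrow> if d (n - 1) then f (n - 1) (a (n - 1)) = a (n - 2) + b (n - 2)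
      else f (n - 1) (a (n - 2)) = a (n - 1) \<and> f (n - 1) (b (n - 2)) = a (n - 1)"
proof -
  have n1: "n - 1 \<in> {1..n}" "n - 1 \<noteq> n - 2" using n by auto
  show "k \<in> {1..n}" "a k \<noteq> 0"
    "\<And>i. i \<in> {1..n} \<Longrightarrow> frame (V i) (a i) (b i)"
    "\<And>i. i \<in> {1..n} \<Longrightarrow> a i \<noteq> 0 \<Longrightarrow> i \<noteq> k \<Longrightarrow> i \<noteq> n - 2 \<and> a (dynkin_D_parent n i) \<noteq> 0"
    "k \<noteq> n - 2 \<Longrightarrow> a (dynkin_D_parent n k) = 0"
    "\<And>i. i \<in> {1..n} \<Longrightarrow> b i \<noteq> 0 \<Longrightarrow> b (dynkin_D_parent n i) \<noteq> 0"
    "ex \<Longrightarrow> k = n - 2 \<and> b (n - 2) \<noteq> 0 \<and> a (n - 1) \<noteq> 0 \<and> b (n - 1) = 0"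
    "\<And>i. \<not> ex \<Longrightarrow> i \<in> {1..n} \<Longrightarrow> b i = 0"
    using rows by (simp_all add: row_system_def)
  have *: "\<forall>i\<in>{1..n}. i \<noteq> n - 2 \<longrightarrow>
       (if ex \<and> i = n - 1
        then if d i then f i (a i) = a (n - 2) + b (n - 2) else f i (a (n - 2)) = a i \<and> f i (b (n - 2)) = a i
        else edge_ok (d i) (f i) (a i) (a (dynkin_D_parent n i)) \<and>
             edge_ok (d i) (f i) (b i) (b (dynkin_D_parent n i)))"
    using rows unfolding row_system_def by (elim conjE)
  show "\<And>i. i \<in> {1..n} \<Longrightarrow> i \<noteq> n - 2 \<Longrightarrow> \<not> (ex \<and> i = n - 1) \<Longrightarrow>
      edge_ok (d i) (f i) (a i) (a (dynkin_D_parent n i)) \<and> edge_ok (d i) (f i) (b i) (b (dynkin_D_parent n i))"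
    using * by (auto split: if_splits)
  show "ex \<Longrightarrow> if d (n - 1) then f (n - 1) (a (n - 1)) = a (n - 2) + b (n - 2)
      else f (n - 1) (a (n - 2)) = a (n - 1) \<and> f (n - 1) (b (n - 2)) = a (n - 1)"
    using *[rule_format, OF n1] by simp
qed

lemma joint_simps: "joint div 2 = n - 2" "joint mod 2 = 1" "w joint = b (n - 2)"
  "2 * i \<noteq> joint" "Suc (2 * i) = joint \<longleftrightarrow> i = n - 2"
  "joint \<noteq> 2 * i" "joint = Suc (2 * i) \<longleftrightarrow> i = n - 2"
  by (simp_all add: joint_def; presburger)+

lemma parent_mem: "i \<in> {1..n} \<Longrightarrow> dynkin_D_parent n i \<in> {1..n}"
  using n by (auto simp: dynkin_D_parent_def)

lemma joint_mem: "joint \<in> N \<longleftrightarrow> ex"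
proof -
  have "n - 2 \<in> {1..n}" using n by auto
  then show ?thesis using rowsD(7,8) by (cases ex) (auto simp: N_def joint_simps)
qed

lemma rooted_parent_N: "rooted_parent N (2 * k) p rk"
proof
  show "finite N" by (rule finite_subset[of _ "{..2 * n + 1}"]) (auto simp: N_def)
  show "2 * k \<in> N" using rowsD(1,2) by (simp add: N_def)
  fix x assume x: "x \<in> N" "x \<noteq> 2 * k"
  show "p x \<in> N \<and> rk (p x) < rk x"
  proof (cases "x = joint")
    case True
    then have "a (n - 1) \<noteq> 0" using x(1) joint_mem rowsD(7) by simp
    moreover have "depth (n - 1) = 1" "n - 1 \<in> {1..n}" using n by (auto simp: depth_def)
    ultimately show ?thesis using True by (simp add: p_def N_def rk_def joint_simps)
  next
    case False
    have *: "depth (dynkin_D_parent n i) < depth i" if "i \<in> {1..n}" "i \<noteq> n - 2" for i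
      using that by (auto simp: depth_def dynkin_D_parent_def)
    show ?thesis
    proof (cases x rule: row_cases)
      case (1 i)
      then have i: "i \<in> {1..n}" "a i \<noteq> 0" "i \<noteq> k" using x by (auto simp: N_def)
      then have "i \<noteq> n - 2" "a (dynkin_D_parent n i) \<noteq> 0" using rowsD(4) by auto
      then show ?thesis
        using 1 False *[OF i(1)] parent_mem[OF i(1)] by (simp add: p_def N_def rk_def)
    next
      case (2 i)
      then have i: "i \<in> {1..n}" "b i \<noteq> 0" "i \<noteq> n - 2" using x False by (auto simp: N_def joint_simps)
      then have "b (dynkin_D_parent n i) \<noteq> 0" using rowsD(6) by auto
      then show ?thesis
        using 2 False *[OF i(1,3)] parent_mem[OF i(1)] by (simp add: p_def N_def rk_def)
    qed
  qed
qed

lemma label_mem: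
  assumes "x \<in> N" "x \<noteq> 2 * k"
  shows "label x \<in> {1..n}" "label x \<noteq> n - 2"
proof -
  have "label x \<in> {1..n} \<and> label x \<noteq> n - 2"
  proof (cases "x = joint")
    case True
    then show ?thesis using n by (auto simp: label_def)
  next
    case False
    show ?thesis
    proof (cases x rule: row_cases)
      case (1 i)
      then show ?thesis using assms rowsD(4)[of i] False by (auto simp: label_def N_def)
    next
      case (2 i)
      then show ?thesis using assms False by (auto simp: label_def N_def joint_simps)
    qed
  qed
  then show "label x \<in> {1..n}" "label x \<noteq> n - 2" by auto
qed

lemma ends_div:
  assumes "x \<in> N" "x \<noteq> 2 * k"
  shows "(if up x then x else p x) div 2 =
      (if d (label x) then label x else dynkin_D_parent n (label x))"
    "(if up x then p x else x) div 2 =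
      (if d (label x) then dynkin_D_parent n (label x) else label x)"
proof -
  have "dynkin_D_parent n (n - 1) = n - 2" using n by (auto simp: dynkin_D_parent_def)
  then show "(if up x then x else p x) div 2 =
      (if d (label x) then label x else dynkin_D_parent n (label x))"
    "(if up x then p x else x) div 2 =
      (if d (label x) then dynkin_D_parent n (label x) else label x)"
    by (auto simp: up_def p_def label_def joint_simps)
qed

lemma sum_fibre:
  assumes "q \<in> {1..n}"
  shows "(\<Sum>m\<in>{m \<in> N. m div 2 = q}. \<phi> m *s w m) = \<phi> (2 * q) *s a q + \<phi> (2 * q + 1) *s b q"
proof -
  have "(\<Sum>m\<in>{m \<in> N. m div 2 = q}. \<phi> m *s w m) = (\<Sum>m\<in>{2 * q, 2 * q + 1}. \<phi> m *s w m)"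
    using assms by (intro sum.mono_neutral_left) (auto simp: N_def)
  then show ?thesis by simp
qed

text \<open>An arrow of the diagram acts by the tree arrows lying over it. In general there is at
  most one for each row, as \<open>edge_ok\<close> describes; only at the leaf \<open>n - 1\<close>,
  if both rows occur, do two tree arrows over the same arrow share an end.\<close>

lemma action:
  assumes i: "i \<in> {1..n}" "i \<noteq> n - 2" and m: "m \<in> N"
    and md: "m div 2 = (if d i then i else dynkin_D_parent n i)"
  shows "f i (w m) =
    (\<Sum>x | x \<in> N - {2 * k} \<and> (if up x then x else p x) = m \<and> label x = i. w (if up x then p x else x))"
    (is "_ = sum ?g ?A")
proof -
  have wm: "w m \<noteq> 0" using m by (simp add: N_def)
  have par_ne: "dynkin_D_parent n i \<noteq> i" using i by (auto simp: dynkin_D_parent_def)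
  have par_n1: "dynkin_D_parent n (n - 1) = n - 2" using n by (auto simp: dynkin_D_parent_def)
  have n1: "n - 1 \<noteq> n - 2" "n - 1 \<in> {1..n}" using n by auto
  have lab: "label x = i \<longleftrightarrow> x = 2 * i \<or> x = 2 * i + 1 \<or> x = joint \<and> i = n - 1" for x
    using i(2) by (auto simp: label_def joint_simps)
  have nj: "2 * i + 1 \<noteq> joint" using i(2) by (simp add: joint_simps)
  let ?par = "dynkin_D_parent n i"
  show ?thesis
  proof (cases "ex \<and> i = n - 1")
    case False
    then have ok: "edge_ok (d i) (f i) (a i) (a ?par)" "edge_ok (d i) (f i) (b i) (b ?par)"
      using rowsD(9)[OF i] by auto
    have notj: "x \<noteq> joint" if "x \<in> ?A" for x
    proof
      assume "x = joint"
      then have "joint \<in> N" "n - 1 = i" using that by (simp_all add: label_def)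
      then show False using False joint_mem by simp
    qed
    show ?thesis
    proof (cases "d i")
      case True
      have A: "?A = {m} - {2 * k}"
      proof
        show "?A \<subseteq> {m} - {2 * k}"
        proof
          fix x assume x: "x \<in> ?A"
          then have "x div 2 = i" using notj[OF x] by (simp add: label_def)
          then have "up x" using notj[OF x] True by (simp add: up_def)
          then show "x \<in> {m} - {2 * k}" using x by simp
        qed
        have "m \<noteq> joint" using md True i(2) by (auto simp: joint_simps)
        then show "{m} - {2 * k} \<subseteq> ?A" using m md True by (auto simp: up_def label_def)
      qed
      have um: "up m" "p m = 2 * ?par + m mod 2"
        using md True i(2) by (auto simp: up_def p_def joint_simps)
      have fm: "f i (w m) = w (p m)"
        unfolding um(2) using wm md True ok
        by (cases m rule: row_cases) (auto simp: edge_ok_def)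
      show ?thesis
      proof (cases "m = 2 * k")
        \<comment> \<open>The root names no arrow, so the sum is empty; this is correct because row
          \<open>a\<close> vanishes at the parent of k.\<close>
        case True
        then have "k = i" using md \<open>d i\<close> by simp
        then have "a ?par = 0" using rowsD(5) i(2) by simp
        then show ?thesis unfolding A fm using True um(2) by simp
      next
        case False
        then show ?thesis unfolding A fm using um(1) by simp
      qed
    next
      case nd: False
      \<comment> \<open>The arrow leaving m is named by the copy of i in the same row; if that copy
        is absent, the sum is empty and the image is 0.\<close>
      let ?x = "2 * i + m mod 2"
      have fm: "f i (w m) = w ?x"
        using wm md nd ok by (cases m rule: row_cases) (auto simp: edge_ok_def)
      have xr: "?x \<noteq> 2 * k"
      proof
        assume x: "?x = 2 * k"
        then have "m mod 2 = 0" "i = k" by presburger+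
        then have "a ?par = 0" using rowsD(5) i(2) by simp
        moreover have "m = 2 * ?par" using md nd \<open>m mod 2 = 0\<close> by auto
        ultimately show False using wm by simp
      qed
      have nj': "?x \<noteq> joint" using nj by (cases m rule: row_cases) (auto simp: joint_simps)
      have mx: "m = 2 * ?par + m mod 2" using md nd by (metis div_mult_mod_eq mult.commute)
      have A: "?A = (if w ?x \<noteq> 0 then {?x} else {})"
      proof -
        have "x \<in> ?A \<longleftrightarrow> x = ?x \<and> w ?x \<noteq> 0" for x
        proof
          assume x: "x \<in> ?A"
          then have "x div 2 = i" using notj[OF x] by (simp add: label_def)
          then have "p x = 2 * ?par + x mod 2" "\<not> up x" using notj[OF x] nd by (auto simp: p_def up_def)
          then have "x mod 2 = m mod 2" using x mx by auto
          then have "x = ?x" using \<open>x div 2 = i\<close> by (metis div_mult_mod_eq mult.commute)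
          then show "x = ?x \<and> w ?x \<noteq> 0" using x by (auto simp: N_def)
        next
          assume x: "x = ?x \<and> w ?x \<noteq> 0"
          have "?x div 2 = i" "?x mod 2 = m mod 2" by (cases m rule: row_cases; simp)+
          then have "?x \<in> N" "\<not> up ?x" "p ?x = m" "label ?x = i"
            using x nj' nd i(1) mx by (auto simp: N_def up_def p_def label_def)
          then show "x \<in> ?A" using x xr by auto
        qed
        then show ?thesis by auto
      qed
      have "\<not> up ?x" using nj' nd by (cases m rule: row_cases) (auto simp: up_def)
      then show ?thesis unfolding A fm by simp
    qed
  next
    case True
    then have ex and i_eq: "i = n - 1" by simp_all
    note e = rowsD(7)[OF \<open>ex\<close>] and act = rowsD(10)[OF \<open>ex\<close>]
    have par: "?par = n - 2" using par_n1 i_eq by simp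
    have jN: "joint \<in> N" using joint_mem \<open>ex\<close> by simp
    have iN: "2 * i \<in> N" "2 * i + 1 \<notin> N" using e i i_eq by (auto simp: N_def)
    have ir: "2 * i \<noteq> 2 * k" "joint \<noteq> 2 * k" using e n1 i_eq joint_simps(4) by auto
    have upj: "up joint = (\<not> d i)" "p joint = 2 * i" using i_eq by (simp_all add: up_def p_def)
    have upi: "up (2 * i) = d i" "p (2 * i) = 2 * (n - 2)"
      using par by (simp_all add: up_def p_def joint_simps)
    have A0: "x \<in> ?A \<longleftrightarrow> (x = 2 * i \<or> x = joint) \<and> (if up x then x else p x) = m" for x
      using lab[of x] jN iN ir i_eq by auto
    show ?thesis
    proof (cases "d i")
      \<comment> \<open>Both arrows leave the copy of the leaf, one for each copy of the branch
        vertex.\<close>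
      case True
      have "m \<noteq> 2 * i + 1" using m iN by auto
      then have m_eq: "m = 2 * i" using md True by auto
      have "?A = {2 * i, joint}" using A0 upj upi True m_eq by auto
      then have "sum ?g ?A = a (n - 2) + b (n - 2)"
        using upj upi True joint_simps(3,4) by simp
      then show ?thesis using m_eq act True i_eq by simp
    next
      \<comment> \<open>Both arrows end at the copy of the leaf, and each copy of the branch vertex
        is the source of exactly one of them.\<close>
      case False
      then have "m = 2 * (n - 2) \<or> m = joint" using md par unfolding joint_def by auto
      then show ?thesis
      proof
        assume m_eq: "m = 2 * (n - 2)"
        then have "?A = {2 * i}" using A0 upj upi False joint_simps(4,6) by auto
        then show ?thesis using upi False m_eq act i_eq by simp
      next
        assume m_eq: "m = joint"
        then have "?A = {joint}" using A0 upj upi False joint_simps(4,6) by auto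
        then show ?thesis using upj False m_eq act i_eq joint_simps(3) by simp
      qed
    qed
  qed
qed

end

section \<open>The arrows of a Dynkin quiver, and the conclusion\<close>

lemma dynkin_D_edges_parent:
  assumes "4 \<le> n"
  shows "dynkin_D_edges n = (\<lambda>i. {i, dynkin_D_parent n i}) ` ({1..n} - {n - 2})"
proof -
  have *: "{1..n} - {n - 2} = {i. 1 \<le> i \<and> i \<le> n - 3} \<union> {n - 1, n}" using assms by auto
  have "(\<lambda>i. {i, dynkin_D_parent n i}) ` {i. 1 \<le> i \<and> i \<le> n - 3} = {{i, i + 1} | i. 1 \<le> i \<and> i \<le> n - 3}"
    using assms by (fastforce simp: dynkin_D_parent_def)
  moreover have "(\<lambda>i. {i, dynkin_D_parent n i}) ` {n - 1, n} = {{n - 2, n - 1}, {n - 2, n}}"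
    using assms by (auto simp: dynkin_D_parent_def)
  ultimately show ?thesis unfolding * image_Un dynkin_D_edges_def by simp
qed

lemma inj_on_parent_edge: "inj_on (\<lambda>i. {i, dynkin_D_parent n i}) ({1..n} - {n - 2})"
proof (rule inj_onI)
  fix i j assume "i \<in> {1..n} - {n - 2}" "j \<in> {1..n} - {n - 2}"
    "{i, dynkin_D_parent n i} = {j, dynkin_D_parent n j}"
  then show "i = j" by (auto simp: doubleton_eq_iff dynkin_D_parent_def split: if_splits)
qed

text \<open>Reindexes the arrows by the vertices other than the branch vertex, each standing for its
  edge to its parent, so that arrows and tree labels are both natural numbers.\<close>

lemma dynkin_D_quiver_arrows:
  assumes n: "4 \<le> n" and Q: "dynkin_D_quiver n Q"
  obtains e where "bij_betw e ({1..n} - {n - 2}) (arcs Q)"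
    "\<And>i. i \<in> {1..n} - {n - 2} \<Longrightarrow> {tail Q (e i), head Q (e i)} = {i, dynkin_D_parent n i}"
proof -
  let ?I = "{1..n} - {n - 2}" and ?g = "\<lambda>i. {i, dynkin_D_parent n i}"
  let ?ends = "\<lambda>a. {tail Q a, head Q a}"
  have b: "bij_betw ?ends (arcs Q) (dynkin_D_edges n)" using Q by (simp add: dynkin_D_quiver_def)
  have g: "bij_betw ?g ?I (dynkin_D_edges n)"
    using inj_on_parent_edge dynkin_D_edges_parent[OF n] by (simp add: bij_betw_def)
  let ?e = "the_inv_into (arcs Q) ?ends \<circ> ?g"
  have "bij_betw ?e ?I (arcs Q)"
    using g bij_betw_the_inv_into[OF b] by (rule bij_betw_trans)
  moreover have "?ends (?e i) = ?g i" if "i \<in> ?I" for i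
  proof -
    have "?g i \<in> ?ends ` arcs Q" using bij_betwE[OF g] b that by (auto simp: bij_betw_def)
    then show ?thesis using f_the_inv_into_f[of ?ends "arcs Q" "?g i"] b by (simp add: bij_betw_def)
  qed
  ultimately show ?thesis by (rule that)
qed

theorem mainTheorem4:
  fixes Q :: "(nat, 'e) pre_digraph"
    and M :: "(nat, 'e, 'k::field, 'b::ab_group_add) quiver_rep"
    and n :: nat
  assumes "CHAR('k) \<noteq> 2"
    and "4 \<le> n"
    and "dynkin_D_quiver n Q"
    and "quiver_representation Q M"
    and "finite_dimensional_rep Q M"
    and "indecomposable_rep Q M"
  shows "\<exists>(T :: (nat, nat) pre_digraph) F\<^sub>0 F\<^sub>1.
           tree_quiver T \<and> quiver_morphism T Q F\<^sub>0 F\<^sub>1 \<and>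
           isomorphic_reps Q M (tree_rep T F\<^sub>0 F\<^sub>1 :: (nat, 'e, 'k, nat \<Rightarrow> 'k) quiver_rep)"
proof -
  note n = assms(2)
  let ?I = "{1..n} - {n - 2}"
  have Q: "wf_digraph Q" "verts Q = {1..n}" using assms(3) by (auto simp: dynkin_D_quiver_def)
  obtain e where e: "bij_betw e ?I (arcs Q)"
    and ends: "\<And>i. i \<in> ?I \<Longrightarrow> {tail Q (e i), head Q (e i)} = {i, dynkin_D_parent n i}"
    using dynkin_D_quiver_arrows[OF n assms(3)] by blast
  have e_arc: "e i \<in> arcs Q" if "i \<in> ?I" for i using bij_betwE[OF e] that by blast
  have arc_obtain: "\<exists>i\<in>?I. \<gamma> = e i" if "\<gamma> \<in> arcs Q" for \<gamma>
    using that bij_betw_imp_surj_on[OF e] by blast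
  \<comment> \<open>\<open>e\<close> is meaningful only at vertices other than the branch vertex;
    the clause for 0 describes the artificial outer end of the long arm.\<close>
  define d where "d i \<longleftrightarrow> i = 0 \<or> tail Q (e i) = i" for i
  define V where "V i = (if i = 0 then {0} else rep_space M i)" for i
  define f where "f i = (if i = 0 then (\<lambda>_. 0) else rep_map M (e i))" for i
  have ti: "tail Q (e i) = (if d i then i else dynkin_D_parent n i)"
    and hd: "head Q (e i) = (if d i then dynkin_D_parent n i else i)" if "i \<in> ?I" for i
    using ends[OF that] that by (auto simp: d_def doubleton_eq_iff)
  have par: "dynkin_D_parent n i \<in> {1..n}" if "i \<in> {1..n}" for i
    using that n by (auto simp: dynkin_D_parent_def)
  have par0: "dynkin_D_parent n i \<noteq> 0" for i using n by (auto simp: dynkin_D_parent_def)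
  interpret ambient_space "rep_scale M"
    using assms(4) by (auto simp: ambient_space_def quiver_representation_def)
  have sub: "subspace (rep_space M q)" if "q \<in> {1..n}" for q
    using assms(4) that Q(2) by (simp add: quiver_representation_def)
  interpret dynkin_D_data "rep_scale M" n V d f
  proof
    show "4 \<le> n" "V 0 = {0}" "d 0" "f 0 = (\<lambda>_. 0)" using n by (simp_all add: V_def d_def f_def)
    show "edge (d i) (f i) (V i) (V (dynkin_D_parent n i))" if i: "i \<in> {1..n}" "i \<noteq> n - 2" for i
    proof -
      have "linear_between (rep_scale M) (rep_space M (tail Q (e i)))
          (rep_scale M) (rep_space M (head Q (e i))) (rep_map M (e i))"
        using assms(4) e_arc i by (simp add: quiver_representation_def)
      then show ?thesis
        using i par0[of i] ti[of i] hd[of i] sub[OF i(1)] sub[OF par[OF i(1)]]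
        by (auto simp: edge_def V_def f_def)
    qed
    show "\<exists>i\<in>{1..n}. V i \<noteq> {0}"
      using assms(6) Q(2) by (auto simp: indecomposable_rep_def V_def)
    fix U W
    assume s: "\<And>i. i \<in> {1..n} \<Longrightarrow> splits (V i) (U i) (W i)"
      and stU: "\<And>i. i \<in> {1..n} \<Longrightarrow> i \<noteq> n - 2 \<Longrightarrow> edge_stable (d i) (f i) (U i) (U (dynkin_D_parent n i))"
      and stW: "\<And>i. i \<in> {1..n} \<Longrightarrow> i \<noteq> n - 2 \<Longrightarrow> edge_stable (d i) (f i) (W i) (W (dynkin_D_parent n i))"
    have s': "splits (rep_space M q) (U q) (W q)" if "q \<in> {1..n}" for q
      using s[OF that] that by (simp add: V_def)
    have stable: "rep_map M \<gamma> ` X (tail Q \<gamma>) \<subseteq> X (head Q \<gamma>)"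
      if \<gamma>: "\<gamma> \<in> arcs Q"
        and st: "\<And>i. i \<in> {1..n} \<Longrightarrow> i \<noteq> n - 2 \<Longrightarrow> edge_stable (d i) (f i) (X i) (X (dynkin_D_parent n i))"
      for \<gamma> X
    proof -
      obtain i where i: "i \<in> ?I" "\<gamma> = e i" using arc_obtain[OF \<gamma>] by blast
      then show ?thesis
        using st[of i] ti[OF i(1)] hd[OF i(1)] by (auto simp: edge_stable_def f_def split: if_splits)
    qed
    have "subrepresentation Q M U" "subrepresentation Q M W"
      unfolding subrepresentation_def Q(2)
      using splitsD(1,2,4,5)[OF s'] stable[OF _ stU] stable[OF _ stW] by simp_all
    moreover have "\<forall>v\<in>verts Q. U v \<inter> W v = {0} \<and> rep_space M v = {u + w | u w. u \<in> U v \<and> w \<in> W v}"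
      unfolding Q(2) using s' by (simp add: splits_def)
    ultimately have "(\<forall>v\<in>verts Q. U v = {0}) \<or> (\<forall>v\<in>verts Q. W v = {0})"
      by (intro assms(6)[unfolded indecomposable_rep_def, THEN conjunct2, THEN spec, THEN spec, THEN mp] conjI)
    then show "(\<forall>i\<in>{1..n}. U i = {0}) \<or> (\<forall>i\<in>{1..n}. W i = {0})"
      unfolding Q(2) .
  qed
  obtain a b k ex where rows: "row_system n V d f a b k ex" using ex_row_system by blast
  interpret row_data "rep_scale M" n V d f a b k ex
    by unfold_locales (fact n rows)+
  interpret T: rooted_parent N "2 * k" p up rk by (rule rooted_parent_N)
  let ?T = "rooted_quiver N (2 * k) p up"
  let ?F0 = "\<lambda>x :: nat. x div 2" and ?F1 = "\<lambda>x. e (label x)"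
  have lab: "label x \<in> ?I" if "x \<in> N" "x \<noteq> 2 * k" for x using label_mem[OF that] by simp
  have mor: "quiver_morphism ?T Q ?F0 ?F1"
    unfolding quiver_morphism_def
  proof (intro conjI ballI)
    show "?F0 x \<in> verts Q" if "x \<in> verts ?T" for x using that Q(2) by (simp add: in_N)
    fix x assume "x \<in> arcs ?T"
    then have x: "x \<in> N" "x \<noteq> 2 * k" by auto
    show "?F1 x \<in> arcs Q" by (rule e_arc[OF lab[OF x]])
    show "tail Q (?F1 x) = ?F0 (tail ?T x)" "head Q (?F1 x) = ?F0 (head ?T x)"
      using ends_div[OF x] ti[OF lab[OF x]] hd[OF lab[OF x]] by simp_all
  qed
  have frame: "frame (rep_space M q) (a q) (b q)" if "q \<in> {1..n}" for q
    using rowsD(3)[OF that] that by (simp add: V_def)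
  have "isomorphic_reps Q M (tree_rep ?T ?F0 ?F1 :: (nat, 'e, 'k, nat \<Rightarrow> 'k) quiver_rep)"
  proof (rule isomorphic_reps_tree_rep[OF Q(1) assms(4) refl T.fin_digraph_T mor, where w = w])
    show "w m \<in> rep_space M (?F0 m)" if "m \<in> verts ?T" for m
      using frameD(4,5)[OF frame[of "m div 2"]] that by (auto simp: in_N w_def)
    show "\<exists>\<phi>. x = (\<Sum>m\<in>{m \<in> verts ?T. ?F0 m = q}. rep_scale M (\<phi> m) (w m))"
      if q: "q \<in> verts Q" and x: "x \<in> rep_space M q" for q x
    proof -
      have q': "q \<in> {1..n}" using q Q(2) by simp
      obtain s t where "x = rep_scale M s (a q) + rep_scale M t (b q)"
        using frameD(7)[OF frame[OF q'] x] by blast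
      \<comment> \<open>The fibre over q holds at most one entry from each row, told apart by
        parity.\<close>
      then show ?thesis
        using sum_fibre[OF q', of "\<lambda>m. if even m then s else t"]
        by (intro exI[of _ "\<lambda>m. if even m then s else t"]) simp
    qed
    show "\<phi> m = 0"
      if q: "q \<in> verts Q" and 0: "(\<Sum>m\<in>{m \<in> verts ?T. ?F0 m = q}. rep_scale M (\<phi> m) (w m)) = 0"
        and m: "m \<in> verts ?T" "?F0 m = q" for q \<phi> m
    proof -
      have q': "q \<in> {1..n}" using q Q(2) by simp
      have "rep_scale M (\<phi> (2 * q)) (a q) + rep_scale M (\<phi> (2 * q + 1)) (b q) = 0"
        using 0 sum_fibre[OF q', of \<phi>] by simp
      then have *: "rep_scale M (\<phi> (2 * q)) (a q) = 0" "rep_scale M (\<phi> (2 * q + 1)) (b q) = 0"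
        using frameD(2,3)[OF frame[OF q']] by blast+
      show ?thesis using m * by (cases m rule: row_cases) (auto simp: in_N)
    qed
    show "rep_map M \<gamma> (w m) =
        (\<Sum>x | x \<in> arcs ?T \<and> tail ?T x = m \<and> ?F1 x = \<gamma>. w (head ?T x))"
      if \<gamma>: "\<gamma> \<in> arcs Q" and m: "m \<in> verts ?T" "?F0 m = tail Q \<gamma>" for \<gamma> m
    proof -
      obtain i where i: "i \<in> ?I" "\<gamma> = e i" using arc_obtain[OF \<gamma>] by blast
      have "rep_map M \<gamma> (w m) = f i (w m)" using i by (simp add: f_def)
      also have "\<dots> = (\<Sum>x | x \<in> N - {2 * k} \<and> (if up x then x else p x) = m \<and> label x = i.
          w (if up x then p x else x))"
        using i m ti[OF i(1)] by (intro action) auto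
      also have "\<dots> = (\<Sum>x | x \<in> arcs ?T \<and> tail ?T x = m \<and> ?F1 x = \<gamma>. w (head ?T x))"
      proof (rule sum.cong)
        \<comment> \<open>By injectivity of \<open>e\<close>, lying over the arrow is the same as
          carrying its label.\<close>
        have "label x = i \<longleftrightarrow> ?F1 x = \<gamma>" if "x \<in> N - {2 * k}" for x
          using inj_on_eq_iff[OF bij_betw_imp_inj_on[OF e] lab[of x] i(1)] that i(2) by simp
        then show "{x. x \<in> N - {2 * k} \<and> (if up x then x else p x) = m \<and> label x = i} =
            {x. x \<in> arcs ?T \<and> tail ?T x = m \<and> ?F1 x = \<gamma>}" by auto
      qed simp
      finally show ?thesis .
    qed
  qed
  then show ?thesis using T.tree_quiver_T mor by blast
qed

end
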